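(* For every pure simplicial complex $\Delta$ and every triangulation $\Delta'$ of $\Delta$, $$h(\Delta', x) = \sum_{F \in \Delta} \theta(\Delta'_F, x)\, h(\mathrm{sd}(\mathrm{link}_\Delta(F)), x).$$
   Context: All simplicial complexes are finite and abstract: a collection $\Delta$ of subsets (faces) of a finite set, containing $\varnothing$ and closed under taking subsets; $\dim F = |F|-1$ and $\dim\Delta$ is the maximum dimension of a face; facets are the inclusion-maximal faces; $\Delta$ is pure if all its facets have the same dimension. The sum ranges over all faces including $\varnothing$. The link of $F \in \Delta$ is $\mathrm{link}_\Delta(F) = \{G \setminus F : G \in \Delta,\ F \subseteq G\}$. The $h$-polynomial of an $(n-1)$-dimensional simplicial complex is $h(\Delta,x) = \sum_{i=0}^n f_{i-1}(\Delta)\, x^i(1-x)^{n-i}$, where $f_i(\Delta)$ is the number of $i$-dimensional faces (so $h(\{\varnothing\},x)=1$). The barycentric subdivision $\mathrm{sd}(\Delta)$ is the simplicial complex on the vertex set $\Delta \setminus \{\varnothing\}$ whose faces are the chains $F_0 \subsetneq F_1 \subsetneq \cdots \subsetneq F_k$ of nonempty faces of $\Delta$ (together with the empty chain). Triangulations are geometric: $\Delta'$ is a triangulation of $\Delta$ if there is a geometric realization $K'$ of $\Delta'$ which geometrically subdivides a geometric realization $K$ of $\Delta$. The carrier of $F' \in \Delta'$ is the smallest face $F \in \Delta$ whose corresponding face in $K$ contains the face of $K'$ corresponding to $F'$. For $F \in \Delta$, the restriction $\Delta'_F$ is the subcomplex of faces of $\Delta'$ whose carrier is contained in $F$; it is a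 triangulation of the simplex $2^F$. Fix a field $\mathbf{k}$. A simplicial complex $\Delta$ is a homology sphere if for every $F\in\Delta$ and every $i$, $\widetilde{H}_i(\mathrm{link}_\Delta(F),\mathbf{k})$ is $\mathbf{k}$ for $i=\dim\mathrm{link}_\Delta(F)$ and $0$ otherwise. An $(n-1)$-dimensional $\Delta$ is a homology ball if there is a subcomplex $\partial\Delta$ (the boundary) which is an $(n-2)$-dimensional homology sphere and such that for every $F \in \Delta$ and every $i$, $\widetilde{H}_i(\mathrm{link}_\Delta(F),\mathbf{k})$ is $\mathbf{k}$ if $F\notin\partial\Delta$ and $i=\dim\mathrm{link}_\Delta(F)$, and $0$ otherwise. The theta polynomial of a homology ball $\Delta$ is $\theta(\Delta,x)=h(\Delta,x)-h(\partial\Delta,x)$; by convention $\theta(\{\varnothing\},x)=1$. In particular it is defined for each $\Delta'_F$, with $\theta(\Delta'_\varnothing,x)=1$. *)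

theory Defs
  imports "HOL-Analysis.Analysis" "HOL-Computational_Algebra.Polynomial"
begin

section \<open>Abstract simplicial complexes\<close>

text \<open>The void collection is excluded: the empty face always belongs to a complex.\<close>

definition abstract_complex :: "'a set set \<Rightarrow> bool" where
  "abstract_complex \<Delta> \<longleftrightarrow>
     finite (\<Union>\<Delta>) \<and> {} \<in> \<Delta> \<and> (\<forall>F\<in>\<Delta>. \<forall>G. G \<subseteq> F \<longrightarrow> G \<in> \<Delta>)"

definition face_dim :: "'a set \<Rightarrow> int" where
  "face_dim F = int (card F) - 1"

definition complex_dim :: "'a set set \<Rightarrow> int" where
  "complex_dim \<Delta> = Max (face_dim ` \<Delta>)"

definition facets :: "'a set set \<Rightarrow> 'a set set" where
  "facets \<Delta> = {F \<in> \<Delta>. \<forall>G\<in>\<Delta>. F \<subseteq> G \<longrightarrow> G = F}"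

definition pure_complex :: "'a set set \<Rightarrow> bool" where
  "pure_complex \<Delta> \<longleftrightarrow> (\<forall>F\<in>facets \<Delta>. \<forall>G\<in>facets \<Delta>. face_dim F = face_dim G)"

definition link :: "'a set set \<Rightarrow> 'a set \<Rightarrow> 'a set set" where
  "link \<Delta> F = {G - F |G. G \<in> \<Delta> \<and> F \<subseteq> G}"

definition barycentric_subdivision :: "'a set set \<Rightarrow> 'a set set set" where
  "barycentric_subdivision \<Delta> = {C. subset.chain (\<Delta> - {{}}) C}"

definition face_number :: "'a set set \<Rightarrow> int \<Rightarrow> nat" where
  "face_number \<Delta> i = card {F \<in> \<Delta>. face_dim F = i}"

text \<open>Here \<^term>\<open>[:0, 1:]\<close> is the indeterminate x and \<^term>\<open>[:1, - 1:]\<close> is 1 - x;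
  a complex of dimension n - 1 gives n as below.\<close>

definition h_poly :: "'a set set \<Rightarrow> int poly" where
  "h_poly \<Delta> =
     (let n = nat (complex_dim \<Delta> + 1) in
       \<Sum>i=0..n. of_nat (face_number \<Delta> (int i - 1)) * [:0, 1:] ^ i * [:1, - 1:] ^ (n - i))"


section \<open>Reduced simplicial homology over a field\<close>

text \<open>
  A duplicate-free list enumerating a face is an ordering of its vertices. An oriented
  i-chain is a function on such orderings of i-dimensional faces which changes sign when two
  neighbouring vertices are swapped; it thus depends only on the orientation, and the space
  has one dimension for every i-dimensional face, in every characteristic and without a choice
  of vertex order. The empty list is the ordering of the empty face, of dimension -1, so the
  complex is the augmented one.
\<close>

definition chains :: "'a set set \<Rightarrow> int \<Rightarrow> ('a list \<Rightarrow> 'k::field) set" where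
  "chains \<Delta> i = {c.
     (\<forall>xs. c xs \<noteq> 0 \<longrightarrow> distinct xs \<and> set xs \<in> \<Delta> \<and> face_dim (set xs) = i) \<and>
     (\<forall>xs a b ys. c (xs @ b # a # ys) = - c (xs @ a # b # ys))}"

text \<open>
  The usual boundary, the alternating sum of the facets of an oriented simplex, read off in
  coordinates: v # ys is the orientation of its face in which ys, the result of deleting v,
  occurs with sign +1. Summands with v in ys, or v # ys not an ordering of a face, vanish.
\<close>

definition boundary_map :: "'a set set \<Rightarrow> ('a list \<Rightarrow> 'k::field) \<Rightarrow> ('a list \<Rightarrow> 'k)" where
  "boundary_map \<Delta> c = (\<lambda>ys. \<Sum>v\<in>\<Union>\<Delta>. c (v # ys))"

definition cycles :: "'a set set \<Rightarrow> int \<Rightarrow> ('a list \<Rightarrow> 'k::field) set" where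
  "cycles \<Delta> i = {c \<in> chains \<Delta> i. boundary_map \<Delta> c = (\<lambda>_. 0)}"

definition boundaries :: "'a set set \<Rightarrow> int \<Rightarrow> ('a list \<Rightarrow> 'k::field) set" where
  "boundaries \<Delta> i = boundary_map \<Delta> ` chains \<Delta> (i + 1)"

definition homology_class ::
    "'a set set \<Rightarrow> int \<Rightarrow> ('a list \<Rightarrow> 'k::field) \<Rightarrow> ('a list \<Rightarrow> 'k) set" where
  "homology_class \<Delta> i c = {d \<in> cycles \<Delta> i. (\<lambda>xs. d xs - c xs) \<in> boundaries \<Delta> i}"

definition reduced_homology :: "'a set set \<Rightarrow> int \<Rightarrow> ('a list \<Rightarrow> 'k::field) set set" where
  "reduced_homology \<Delta> i = homology_class \<Delta> i ` cycles \<Delta> i"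

definition homology_zero :: "'k::field itself \<Rightarrow> 'a set set \<Rightarrow> int \<Rightarrow> bool" where
  "homology_zero _ \<Delta> i \<longleftrightarrow>
     reduced_homology \<Delta> i = {homology_class \<Delta> i (\<lambda>_. 0 :: 'k)}"

text \<open>The quotient space is isomorphic to the ground field as a vector space.\<close>

definition homology_field :: "'k::field itself \<Rightarrow> 'a set set \<Rightarrow> int \<Rightarrow> bool" where
  "homology_field _ \<Delta> i \<longleftrightarrow>
     (\<exists>f :: ('a list \<Rightarrow> 'k) set \<Rightarrow> 'k.
        bij_betw f (reduced_homology \<Delta> i) UNIV \<and>
        (\<forall>c\<in>cycles \<Delta> i. \<forall>d\<in>cycles \<Delta> i.
           f (homology_class \<Delta> i (\<lambda>xs. c xs + d xs))
             = f (homology_class \<Delta> i c) + f (homology_class \<Delta> i d)) \<and>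
        (\<forall>a. \<forall>c\<in>cycles \<Delta> i.
           f (homology_class \<Delta> i (\<lambda>xs. a * c xs)) = a * f (homology_class \<Delta> i c)))"


section \<open>Homology spheres, homology balls and the theta polynomial\<close>

definition homology_sphere :: "'k::field itself \<Rightarrow> 'a set set \<Rightarrow> bool" where
  "homology_sphere k \<Delta> \<longleftrightarrow>
     abstract_complex \<Delta> \<and>
     (\<forall>F\<in>\<Delta>. \<forall>i. if i = complex_dim (link \<Delta> F)
        then homology_field k (link \<Delta> F) i
        else homology_zero k (link \<Delta> F) i)"

definition homology_ball_with_boundary ::
    "'k::field itself \<Rightarrow> 'a set set \<Rightarrow> 'a set set \<Rightarrow> bool" where
  "homology_ball_with_boundary k \<Delta> B \<longleftrightarrow>
     abstract_complex \<Delta> \<and> B \<subseteq> \<Delta> \<and>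
     homology_sphere k B \<and> complex_dim B = complex_dim \<Delta> - 1 \<and>
     (\<forall>F\<in>\<Delta>. \<forall>i. if F \<notin> B \<and> i = complex_dim (link \<Delta> F)
        then homology_field k (link \<Delta> F) i
        else homology_zero k (link \<Delta> F) i)"

text \<open>The boundary of a homology ball is unique: it consists of the faces whose link has no
  homology in top degree. For collections that are not homology balls the value is
  unspecified.\<close>

definition ball_boundary :: "'k::field itself \<Rightarrow> 'a set set \<Rightarrow> 'a set set" where
  "ball_boundary k \<Delta> = (THE B. homology_ball_with_boundary k \<Delta> B)"

definition theta_poly :: "'k::field itself \<Rightarrow> 'a set set \<Rightarrow> int poly" where
  "theta_poly k \<Delta> = (if \<Delta> = {{}} then 1 else h_poly \<Delta> - h_poly (ball_boundary k \<Delta>))"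


section \<open>Geometric triangulations\<close>

definition geometric_face :: "('a \<Rightarrow> 'e::euclidean_space) \<Rightarrow> 'a set \<Rightarrow> 'e set" where
  "geometric_face \<phi> F = convex hull (\<phi> ` F)"

text \<open>The vertex map \<open>\<phi>\<close> identifies \<open>\<Delta>\<close> with the geometric simplicial complex consisting of
  the convex hulls of the images of its faces.\<close>

definition geometric_realization :: "'a set set \<Rightarrow> ('a \<Rightarrow> 'e::euclidean_space) \<Rightarrow> bool" where
  "geometric_realization \<Delta> \<phi> \<longleftrightarrow>
     inj_on \<phi> (\<Union>\<Delta>) \<and>
     (\<forall>F\<in>\<Delta>. \<not> affine_dependent (\<phi> ` F)) \<and>
     simplicial_complex (geometric_face \<phi> ` \<Delta>)"

text \<open>Geometric subdivision: both complexes cover the same point set, and every simplex of the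
  second one lies in a simplex of the first one.\<close>

definition triangulates ::
    "'a set set \<Rightarrow> ('a \<Rightarrow> 'e::euclidean_space) \<Rightarrow> 'b set set \<Rightarrow> ('b \<Rightarrow> 'e) \<Rightarrow> bool" where
  "triangulates \<Delta> \<phi> \<Delta>' \<psi> \<longleftrightarrow>
     geometric_realization \<Delta> \<phi> \<and> geometric_realization \<Delta>' \<psi> \<and>
     \<Union> (geometric_face \<psi> ` \<Delta>') = \<Union> (geometric_face \<phi> ` \<Delta>) \<and>
     (\<forall>F'\<in>\<Delta>'. \<exists>F\<in>\<Delta>. geometric_face \<psi> F' \<subseteq> geometric_face \<phi> F)"

definition carrier_face ::
    "'a set set \<Rightarrow> ('a \<Rightarrow> 'e::euclidean_space) \<Rightarrow> ('b \<Rightarrow> 'e) \<Rightarrow> 'b set \<Rightarrow> 'a set" where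
  "carrier_face \<Delta> \<phi> \<psi> F' =
     (THE F. F \<in> \<Delta> \<and> geometric_face \<psi> F' \<subseteq> geometric_face \<phi> F \<and>
        (\<forall>G\<in>\<Delta>. geometric_face \<psi> F' \<subseteq> geometric_face \<phi> G \<longrightarrow> F \<subseteq> G))"

definition restriction ::
    "'a set set \<Rightarrow> ('a \<Rightarrow> 'e::euclidean_space) \<Rightarrow> 'b set set \<Rightarrow> ('b \<Rightarrow> 'e) \<Rightarrow> 'a set \<Rightarrow> 'b set set"
  where
  "restriction \<Delta> \<phi> \<Delta>' \<psi> F = {F' \<in> \<Delta>'. carrier_face \<Delta> \<phi> \<psi> F' \<subseteq> F}"

end

theory Submission
  imports Defs
begin

text \<open>
  Group the faces of \<open>\<Delta>'\<close> by carrier and let \<open>I G\<close> be the sum of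
  \<open>x^card \<tau> (1 - x)^(card G - card \<tau>)\<close> over the faces \<open>\<tau>\<close> with carrier \<open>G\<close>. Then
  \<open>h(\<Delta>')\<close> is the sum of the \<open>(1 - x)^(n - card G) I G\<close>, and, once the boundary of \<open>\<Delta>'_F\<close> is known
  to consist of the faces with carrier properly inside \<open>F\<close>, the theta polynomials are expressed
  through the \<open>I G\<close> as well. The formula follows from the recursion for \<open>h(sd(link G))\<close> obtained by
  splitting off the least element of a flag.

  The substance is that \<open>\<Delta>'_F\<close> really is a homology ball with that boundary, over every field.
  After homogenization \<open>\<Delta>'_F\<close> is a simplicial fan subdividing a simplicial cone. The link of a face
  \<open>\<sigma>\<close> stratifies the tangent cone at \<open>\<sigma>\<close> minus the span of \<open>\<sigma>\<close>, and so does a model complex, the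
  join of a cross-polytope with a simplex. Both stratifications are coarsenings of the
  sign vectors of finitely many linear functionals, with convex closed strata. The order complex
  of the sign vectors of a convex set is acyclic, by induction on the number of functionals, so
  the homological version of Quillen's fibre lemma identifies the homology of the link with that
  of the model.
\<close>

section \<open>Reduced homology of simplicial complexes\<close>

text \<open>The boundary in \<open>theta_poly\<close> is a definite description, so no count can
  start before the boundary of every restriction is determined, and that takes the homology of all
  links. A link and its model come with no map from one to the other. What they share is a point
  set, and the sign vectors of enough functionals on it form one poset with monotone maps to both
  face posets. Points in the span of \<sigma> would have to go to the empty face, which these posets
  omit; this is why the span is removed.

  All homology is computed by two moves on chains: a face with acyclic link may be deleted, and if
  the deletion of a face is acyclic, the homology is that of its link, shifted. Neither uses exact
  sequences or Euler characteristics, and both work over every field.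

  Homogenization puts the origin in the place of the empty face, so that the empty face and its link
  are treated like all others.\<close>

abbreviation alternating :: "('a list \<Rightarrow> 'k::field) \<Rightarrow> bool" where
  "alternating c \<equiv> \<forall>xs a b ys. c (xs @ b # a # ys) = - c (xs @ a # b # ys)"

lemma abstract_complexD:
  assumes "abstract_complex \<Delta>"
  shows "finite (\<Union>\<Delta>)" "finite \<Delta>" "{} \<in> \<Delta>" "\<And>F G. F \<in> \<Delta> \<Longrightarrow> G \<subseteq> F \<Longrightarrow> G \<in> \<Delta>"
    "\<And>F. F \<in> \<Delta> \<Longrightarrow> finite F"
  using assms finite_UnionD by (auto simp: abstract_complex_def intro: finite_subset[of _ "\<Union>\<Delta>"])

lemma abstract_complexI:
  assumes "finite \<Delta>" "{} \<in> \<Delta>" "\<And>F G. F \<in> \<Delta> \<Longrightarrow> G \<subseteq> F \<Longrightarrow> G \<in> \<Delta>" "\<And>F. F \<in> \<Delta> \<Longrightarrow> finite F"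
  shows "abstract_complex \<Delta>"
  using assms by (auto simp: abstract_complex_def)

section \<open>Alternating chains and the boundary map\<close>

lemma chainsD:
  assumes "c \<in> chains \<Delta> i"
  shows "\<And>xs. c xs \<noteq> 0 \<Longrightarrow> distinct xs \<and> set xs \<in> \<Delta> \<and> face_dim (set xs) = i" "alternating c"
  using assms unfolding chains_def by blast+

lemma chainsI:
  assumes "\<And>xs. c xs \<noteq> 0 \<Longrightarrow> distinct xs \<and> set xs \<in> \<Delta> \<and> face_dim (set xs) = i"
    "\<And>xs a b ys. c (xs @ b # a # ys) = - c (xs @ a # b # ys)"
  shows "c \<in> chains \<Delta> i"
  using assms unfolding chains_def by blast

lemma chains_mono: "\<Delta> \<subseteq> \<Gamma> \<Longrightarrow> chains \<Delta> i \<subseteq> chains \<Gamma> i"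
  by (auto simp: chains_def)

lemma chains_zero: "(\<lambda>_. 0) \<in> chains \<Delta> i"
  by (auto simp: chains_def)

lemma chains_lincomb:
  assumes "c \<in> chains \<Delta> i" "d \<in> chains \<Delta> i"
  shows "(\<lambda>xs. a * c xs + b * d xs) \<in> chains \<Delta> i"
proof (rule chainsI)
  fix xs assume "a * c xs + b * d xs \<noteq> 0"
  then have "c xs \<noteq> 0 \<or> d xs \<noteq> 0" by auto
  then show "distinct xs \<and> set xs \<in> \<Delta> \<and> face_dim (set xs) = i"
    using chainsD(1)[OF assms(1)] chainsD(1)[OF assms(2)] by blast
next
  fix xs x y ys
  show "a * c (xs @ y # x # ys) + b * d (xs @ y # x # ys)
      = - (a * c (xs @ x # y # ys) + b * d (xs @ x # y # ys))"
    using chainsD(2)[OF assms(1), rule_format, of xs y x ys]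
      chainsD(2)[OF assms(2), rule_format, of xs y x ys] by (simp only:) (simp add: algebra_simps)
qed

lemma chains_diff: "c \<in> chains \<Delta> i \<Longrightarrow> d \<in> chains \<Delta> i \<Longrightarrow> (\<lambda>xs. c xs - d xs) \<in> chains \<Delta> i"
  using chains_lincomb[of c \<Delta> i d 1 "-1"] by simp

lemma chains_vanish: "c \<in> chains \<Delta> i \<Longrightarrow> v \<notin> \<Union>\<Delta> \<Longrightarrow> v \<in> set xs \<Longrightarrow> c xs = 0"
  using chainsD(1) by blast

lemma boundary_map_mono:
  assumes "c \<in> chains \<Delta> i" "\<Delta> \<subseteq> \<Gamma>" "finite (\<Union>\<Gamma>)"
  shows "boundary_map \<Gamma> c = boundary_map \<Delta> c"
proof
  fix ys
  show "boundary_map \<Gamma> c ys = boundary_map \<Delta> c ys"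
    unfolding boundary_map_def
    by (rule sum.mono_neutral_right) (use assms chains_vanish[OF assms(1)] in auto)
qed

lemma boundary_map_lincomb:
  "boundary_map \<Delta> (\<lambda>xs. a * c xs + b * d xs)
    = (\<lambda>ys. a * boundary_map \<Delta> c ys + b * boundary_map \<Delta> d ys)"
  by (simp add: boundary_map_def sum.distrib sum_distrib_left)

lemma boundary_map_diff:
  "boundary_map \<Delta> (\<lambda>xs. c xs - d xs) = (\<lambda>ys. boundary_map \<Delta> c ys - boundary_map \<Delta> d ys)"
  using boundary_map_lincomb[of \<Delta> 1 c "-1" d] by simp

lemma boundary_map_zero: "boundary_map \<Delta> (\<lambda>_. 0) = (\<lambda>_. 0)"
  by (simp add: boundary_map_def)

lemma boundary_map_chains:
  assumes "abstract_complex \<Delta>" "c \<in> chains \<Delta> i"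
  shows "boundary_map \<Delta> c \<in> chains \<Delta> (i - 1)"
proof (rule chainsI)
  fix ys assume "boundary_map \<Delta> c ys \<noteq> 0"
  then obtain v where "c (v # ys) \<noteq> 0"
    unfolding boundary_map_def by (meson sum.neutral)
  then have "distinct (v # ys)" "set (v # ys) \<in> \<Delta>" "face_dim (set (v # ys)) = i"
    using chainsD(1)[OF assms(2)] by blast+
  then show "distinct ys \<and> set ys \<in> \<Delta> \<and> face_dim (set ys) = i - 1"
    using abstract_complexD(4)[OF assms(1), of "set (v # ys)" "set ys"]
    by (auto simp: face_dim_def)
next
  fix xs a b ys
  have "c (v # xs @ b # a # ys) = - c (v # xs @ a # b # ys)" for v
    using chainsD(2)[OF assms(2), rule_format, of "v # xs" b a ys] by simp
  then show "boundary_map \<Delta> c (xs @ b # a # ys) = - boundary_map \<Delta> c (xs @ a # b # ys)"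
    unfolding boundary_map_def sum_negf[symmetric] by (intro sum.cong refl)
qed

text \<open>Vanishing on the diagonal is a separate hypothesis because antisymmetry does not force
  it in characteristic two. In \<open>boundary_boundary\<close> the two orders of deleting two
  vertices cancel by this.\<close>

lemma sum_antisymmetric:
  fixes g :: "'a \<Rightarrow> 'a \<Rightarrow> 'k::ab_group_add"
  assumes "finite A" "\<And>u v. g u v = - g v u" "\<And>u. g u u = 0"
  shows "(\<Sum>u\<in>A. \<Sum>v\<in>A. g u v) = 0"
  using assms(1)
proof induction
  case (insert x A)
  have "(\<Sum>u\<in>A. g u x) = - (\<Sum>v\<in>A. g x v)"
    unfolding sum_negf[symmetric] by (rule sum.cong[OF refl]) (rule assms(2))
  then show ?case using insert assms(3) by (simp add: sum.distrib)
qed simp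

lemma boundary_boundary:
  assumes "abstract_complex \<Delta>" "c \<in> chains \<Delta> i"
  shows "boundary_map \<Delta> (boundary_map \<Delta> c) = (\<lambda>_. 0)"
proof
  fix ys
  have "c (v # u # ys) = - c (u # v # ys)" for u v
    using chainsD(2)[OF assms(2), rule_format, of "[]" v u ys] by simp
  moreover have "c (u # u # ys) = 0" for u
    using chainsD(1)[OF assms(2), of "u # u # ys"] by auto
  ultimately show "boundary_map \<Delta> (boundary_map \<Delta> c) ys = 0"
    unfolding boundary_map_def
    by (rule sum_antisymmetric[OF abstract_complexD(1)[OF assms(1)]])
qed

text \<open>Adjacent swaps bring the first entry to the front, and induction treats the rest. The
  sign stays undetermined because only vanishing is carried from one ordering of a face to
  another.\<close>

lemma alternating_mset:
  assumes "alternating c" "mset xs = mset ys"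
  shows "c xs = c ys \<or> c xs = - c ys"
  using assms
proof (induction xs arbitrary: ys c)
  case Nil then show ?case by simp
next
  case (Cons x xs)
  then obtain as bs where ys: "ys = as @ x # bs"
    by (metis list.set_intros(1) mset_eq_setD split_list)
  have front: "c (as @ x # bs) = c (x # as @ bs) \<or> c (as @ x # bs) = - c (x # as @ bs)"
    if "alternating c" for c :: "'a list \<Rightarrow> 'b" and as
    using that
  proof (induction as arbitrary: c)
    case (Cons z as)
    have alt: "alternating (\<lambda>l. c (z # l))"
      by (intro allI Cons.prems[rule_format, of "z # _", simplified])
    have "c (z # x # as @ bs) = - c (x # z # as @ bs)"
      using Cons.prems[rule_format, of "[]" x z "as @ bs"] by simp
    then show ?case using Cons.IH[OF alt] by (simp only: append_Cons) auto
  qed simp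
  have "alternating (\<lambda>l. c (x # l))"
    by (intro allI Cons.prems(1)[rule_format, of "x # _", simplified])
  then have "c (x # xs) = c (x # as @ bs) \<or> c (x # xs) = - c (x # as @ bs)"
    by (rule Cons.IH) (use Cons.prems(2) ys in simp)
  then show ?case using front[OF Cons.prems(1), of as] ys by auto
qed

lemma alternating_move:
  assumes "alternating c"
  shows "c (v # rs @ ys) = (- 1) ^ length rs * c (rs @ v # ys)"
  using assms
proof (induction rs arbitrary: c)
  case (Cons r rs)
  have "alternating (\<lambda>l. c (r # l))"
    by (intro allI Cons.prems[rule_format, of "r # _", simplified])
  then have "c (r # v # rs @ ys) = (- 1) ^ length rs * c (r # rs @ v # ys)"
    by (rule Cons.IH)
  moreover have "c (v # r # rs @ ys) = - c (r # v # rs @ ys)"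
    using Cons.prems[rule_format, of "[]" v r "rs @ ys"] by simp
  ultimately show ?case by simp
qed simp

text \<open>Every ordering of a face that contains \<open>rs\<close> can be permuted to begin with
  \<open>rs\<close>, so testing these orderings decides whether a chain avoids the face.\<close>

lemma chains_eq_zero_superset:
  assumes "c \<in> chains \<Delta> i" "\<And>ys. c (rs @ ys) = 0" "distinct rs" "set rs \<subseteq> set zs"
  shows "c zs = 0"
proof (cases "distinct zs")
  case True
  have "mset zs = mset (rs @ filter (\<lambda>z. z \<notin> set rs) zs)"
    by (rule set_eq_iff_mset_eq_distinct[THEN iffD1]) (use True assms in auto)
  then show ?thesis
    using alternating_mset[OF chainsD(2)[OF assms(1)]] assms(2) by fastforce
next
  case False
  then show ?thesis using chainsD(1)[OF assms(1)] by blast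
qed

text \<open>The cone over \<open>e\<close> with apex \<open>v\<close>, in coordinates: the first
  occurrence of \<open>v\<close> is removed, with the sign of moving it to the front. Iterated over
  \<open>rs\<close> it is the join with the simplex on \<open>rs\<close>, normalized so that
  \<open>foldr_cone_append\<close> holds.\<close>

fun cone_chain :: "'a \<Rightarrow> ('a list \<Rightarrow> 'k::field) \<Rightarrow> 'a list \<Rightarrow> 'k" where
  "cone_chain v e [] = 0"
| "cone_chain v e (x # xs) = (if x = v then e xs else - cone_chain v (\<lambda>ys. e (x # ys)) xs)"

lemma cone_chain_uminus: "cone_chain v (\<lambda>l. - e l) xs = - cone_chain v e xs"
  by (induction xs arbitrary: e) auto

lemma cone_chain_nonzero:
  "cone_chain v e xs \<noteq> 0 \<Longrightarrow> \<exists>as bs. xs = as @ v # bs \<and> e (as @ bs) \<noteq> 0"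
proof (induction xs arbitrary: e)
  case (Cons x xs)
  show ?case
  proof (cases "x = v")
    case True
    then show ?thesis using Cons.prems by (intro exI[of _ "[]"] exI[of _ xs]) auto
  next
    case False
    then obtain as bs where "xs = as @ v # bs" "e (x # as @ bs) \<noteq> 0"
      using Cons.IH[of "\<lambda>ys. e (x # ys)"] Cons.prems by auto
    then show ?thesis by (intro exI[of _ "x # as"] exI[of _ bs]) auto
  qed
qed simp

text \<open>The vanishing of \<open>e\<close> on lists with \<open>v\<close> settles the swap of two
  adjacent copies of the apex.\<close>

lemma cone_chain_alternating:
  assumes "alternating e" "\<And>xs. v \<in> set xs \<Longrightarrow> e xs = 0"
  shows "cone_chain v e (xs @ b # a # ys) = - cone_chain v e (xs @ a # b # ys)"
  using assms
proof (induction xs arbitrary: e)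
  case Nil
  have "(\<lambda>l. e (b # a # l)) = (\<lambda>l. - e (a # b # l))"
    by (intro ext Nil.prems(1)[rule_format, of "[]", simplified])
  then have "cone_chain v (\<lambda>l. e (b # a # l)) ys = - cone_chain v (\<lambda>l. e (a # b # l)) ys"
    by (simp add: cone_chain_uminus)
  then show ?case using Nil.prems(2)[of "v # ys"] by auto
next
  case (Cons x xs)
  have "alternating (\<lambda>l. e (x # l))"
    by (intro allI Cons.prems(1)[rule_format, of "x # _", simplified])
  then have "cone_chain v (\<lambda>l. e (x # l)) (xs @ b # a # ys)
      = - cone_chain v (\<lambda>l. e (x # l)) (xs @ a # b # ys)"
    by (rule Cons.IH) (simp add: Cons.prems(2))
  then show ?case
    using Cons.prems(1)[rule_format, of xs b a ys] by simp
qed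

lemma foldr_cone_append: "foldr cone_chain rs e (rs @ ys) = e ys"
  by (induction rs) auto

lemma foldr_cone_chains:
  assumes "e \<in> chains \<Lambda> i" "distinct rs" "set rs \<inter> \<Union>\<Lambda> = {}"
  shows "foldr cone_chain rs e \<in> chains ((\<lambda>G. set rs \<union> G) ` \<Lambda>) (i + int (length rs))"
  using assms(2,3)
proof (induction rs)
  case Nil
  then show ?case using assms(1) by simp
next
  case (Cons r rs)
  define d where "d = foldr cone_chain rs e"
  have d: "d \<in> chains ((\<lambda>G. set rs \<union> G) ` \<Lambda>) (i + int (length rs))"
    using Cons unfolding d_def by auto
  have "cone_chain r d \<in> chains ((\<lambda>G. set (r # rs) \<union> G) ` \<Lambda>) (i + int (length (r # rs)))"
  proof (rule chainsI)
    fix xs assume "cone_chain r d xs \<noteq> 0"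
    then obtain as bs where xs: "xs = as @ r # bs" "d (as @ bs) \<noteq> 0"
      using cone_chain_nonzero by metis
    then have *: "distinct (as @ bs)" "set (as @ bs) \<in> (\<lambda>G. set rs \<union> G) ` \<Lambda>"
      "face_dim (set (as @ bs)) = i + int (length rs)"
      using chainsD(1)[OF d] by blast+
    then have r: "r \<notin> set (as @ bs)" using Cons.prems by auto
    have "set xs = insert r (set (as @ bs))" using xs by auto
    moreover have "distinct xs" using * r xs by auto
    moreover have "face_dim (insert r (set (as @ bs))) = face_dim (set (as @ bs)) + 1"
      using r by (simp add: face_dim_def)
    ultimately show "distinct xs \<and> set xs \<in> (\<lambda>G. set (r # rs) \<union> G) ` \<Lambda>
        \<and> face_dim (set xs) = i + int (length (r # rs))"
      using * by auto
  next
    fix xs a b ys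
    show "cone_chain r d (xs @ b # a # ys) = - cone_chain r d (xs @ a # b # ys)"
    proof (rule cone_chain_alternating[OF chainsD(2)[OF d]])
      show "d xs = 0" if "r \<in> set xs" for xs
        using chains_vanish[OF d _ that] Cons.prems by auto
    qed
  qed
  then show ?case by (simp add: d_def)
qed

section \<open>Homology through linear functionals on cycles\<close>

lemma boundariesD:
  assumes "c \<in> boundaries \<Delta> i"
  obtains d where "d \<in> chains \<Delta> (i + 1)" "c = boundary_map \<Delta> d"
  using assms unfolding boundaries_def by auto

lemma boundariesI: "d \<in> chains \<Delta> (i + 1) \<Longrightarrow> boundary_map \<Delta> d \<in> boundaries \<Delta> i"
  unfolding boundaries_def by auto

lemma cycles_lincomb:
  assumes "c \<in> cycles \<Delta> i" "d \<in> cycles \<Delta> i"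
  shows "(\<lambda>xs. a * c xs + b * d xs) \<in> cycles \<Delta> i"
  using assms chains_lincomb by (auto simp: cycles_def boundary_map_lincomb)

lemma cycles_diff: "c \<in> cycles \<Delta> i \<Longrightarrow> d \<in> cycles \<Delta> i \<Longrightarrow> (\<lambda>xs. c xs - d xs) \<in> cycles \<Delta> i"
  using cycles_lincomb[of c \<Delta> i d 1 "-1"] by simp

lemma cycles_zero: "(\<lambda>_. 0) \<in> cycles \<Delta> i"
  by (simp add: cycles_def chains_zero boundary_map_zero)

lemma boundaries_lincomb:
  assumes "c \<in> boundaries \<Delta> i" "d \<in> boundaries \<Delta> i"
  shows "(\<lambda>xs. a * c xs + b * d xs) \<in> boundaries \<Delta> i"
proof -
  obtain c' d' where *: "c' \<in> chains \<Delta> (i + 1)" "c = boundary_map \<Delta> c'"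
    "d' \<in> chains \<Delta> (i + 1)" "d = boundary_map \<Delta> d'"
    using assms boundariesD by metis
  show ?thesis
    using boundariesI[OF chains_lincomb[OF *(1,3), of a b]] * by (simp add: boundary_map_lincomb)
qed

lemma boundaries_zero: "(\<lambda>_. 0) \<in> boundaries \<Delta> i"
  using boundariesI[OF chains_zero] by (simp add: boundary_map_zero)

lemma homology_class_self: "c \<in> cycles \<Delta> i \<Longrightarrow> c \<in> homology_class \<Delta> i c"
  by (simp add: homology_class_def boundaries_zero)

lemma homology_class_eq_iff:
  assumes "c \<in> cycles \<Delta> i" "d \<in> cycles \<Delta> i"
  shows "homology_class \<Delta> i c = homology_class \<Delta> i d \<longleftrightarrow> (\<lambda>xs. c xs - d xs) \<in> boundaries \<Delta> i"
proof
  assume "homology_class \<Delta> i c = homology_class \<Delta> i d"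
  then show "(\<lambda>xs. c xs - d xs) \<in> boundaries \<Delta> i"
    using homology_class_self[OF assms(1)] by (auto simp: homology_class_def)
next
  assume *: "(\<lambda>xs. c xs - d xs) \<in> boundaries \<Delta> i"
  have "(\<lambda>xs. e xs - c xs) \<in> boundaries \<Delta> i \<longleftrightarrow> (\<lambda>xs. e xs - d xs) \<in> boundaries \<Delta> i" for e
    using boundaries_lincomb[OF _ *, of "\<lambda>xs. e xs - c xs" 1 1]
      boundaries_lincomb[OF _ *, of "\<lambda>xs. e xs - d xs" 1 "-1"] by auto
  then show "homology_class \<Delta> i c = homology_class \<Delta> i d"
    by (simp add: homology_class_def)
qed

lemma homology_zero_iff:
  "homology_zero TYPE('k::field) \<Delta> i \<longleftrightarrow> (cycles \<Delta> i :: ('a list \<Rightarrow> 'k) set) \<subseteq> boundaries \<Delta> i"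
proof -
  have "homology_zero TYPE('k) \<Delta> i \<longleftrightarrow>
      (\<forall>c \<in> cycles \<Delta> i. homology_class \<Delta> i c = homology_class \<Delta> i (\<lambda>_. 0 :: 'k))"
    (is "_ \<longleftrightarrow> ?R")
  proof
    assume "homology_zero TYPE('k) \<Delta> i"
    then show ?R unfolding homology_zero_def reduced_homology_def by blast
  next
    assume ?R
    then show "homology_zero TYPE('k) \<Delta> i"
      unfolding homology_zero_def reduced_homology_def
      using imageI[OF cycles_zero, of "homology_class \<Delta> i"] by blast
  qed
  also have "\<dots> \<longleftrightarrow> (\<forall>c \<in> cycles \<Delta> i. c \<in> (boundaries \<Delta> i :: ('a list \<Rightarrow> 'k) set))"
    by (rule ball_cong[OF refl]) (simp add: homology_class_eq_iff cycles_zero)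
  finally show ?thesis by blast
qed

definition linear_on_cycles :: "'a set set \<Rightarrow> int \<Rightarrow> (('a list \<Rightarrow> 'k::field) \<Rightarrow> 'k) \<Rightarrow> bool" where
  "linear_on_cycles \<Delta> i g \<longleftrightarrow> (\<forall>c\<in>cycles \<Delta> i. \<forall>d\<in>cycles \<Delta> i. \<forall>a b.
     g (\<lambda>xs. a * c xs + b * d xs) = a * g c + b * g d)"

text \<open>Composed with the class map, an isomorphism of the quotient with the field is a nonzero
  functional on cycles that vanishes exactly on boundaries. Conversely such a functional descends to
  the quotient, so cosets can be avoided from here on.\<close>

lemma homology_field_iff:
  "homology_field TYPE('k::field) \<Delta> i \<longleftrightarrow>
    (\<exists>g :: ('a list \<Rightarrow> 'k) \<Rightarrow> 'k. linear_on_cycles \<Delta> i g \<and>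
      (\<forall>c\<in>cycles \<Delta> i. g c = 0 \<longleftrightarrow> c \<in> boundaries \<Delta> i) \<and> (\<exists>c\<in>cycles \<Delta> i. g c \<noteq> 0))"
    (is "_ \<longleftrightarrow> (\<exists>g. ?P g)")
proof
  assume "homology_field TYPE('k) \<Delta> i"
  then obtain f :: "('a list \<Rightarrow> 'k) set \<Rightarrow> 'k" where
    bij: "bij_betw f (reduced_homology \<Delta> i) UNIV" and
    add: "\<And>c d. c\<in>cycles \<Delta> i \<Longrightarrow> d\<in>cycles \<Delta> i \<Longrightarrow> f (homology_class \<Delta> i (\<lambda>xs. c xs + d xs))
             = f (homology_class \<Delta> i c) + f (homology_class \<Delta> i d)" and
    scale: "\<And>a c. c\<in>cycles \<Delta> i \<Longrightarrow> f (homology_class \<Delta> i (\<lambda>xs. a * c xs)) = a * f (homology_class \<Delta> i c)"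
    unfolding homology_field_def by blast
  define g where "g c = f (homology_class \<Delta> i c)" for c
  have sc: "(\<lambda>xs. a * c xs) \<in> cycles \<Delta> i" if "c \<in> cycles \<Delta> i" for a and c :: "'a list \<Rightarrow> 'k"
    using cycles_lincomb[OF that cycles_zero, of a] by simp
  have g0: "g (\<lambda>_. 0) = 0" using scale[OF cycles_zero, of 0] by (simp add: g_def)
  have "linear_on_cycles \<Delta> i g"
    unfolding linear_on_cycles_def g_def using sc by (simp add: add scale)
  moreover have "g c = 0 \<longleftrightarrow> c \<in> boundaries \<Delta> i" if "c \<in> cycles \<Delta> i" for c
  proof -
    have "g c = 0 \<longleftrightarrow> f (homology_class \<Delta> i c) = f (homology_class \<Delta> i (\<lambda>_. 0))"
      using g0 by (simp add: g_def)
    also have "\<dots> \<longleftrightarrow> homology_class \<Delta> i c = homology_class \<Delta> i (\<lambda>_. 0)"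
      by (rule inj_on_eq_iff[OF bij_betw_imp_inj_on[OF bij]])
        (auto simp: reduced_homology_def that cycles_zero)
    finally show ?thesis using homology_class_eq_iff[OF that cycles_zero] by simp
  qed
  moreover have "\<exists>c\<in>cycles \<Delta> i. g c \<noteq> 0"
  proof -
    obtain C where "C \<in> reduced_homology \<Delta> i" "f C = 1"
      using bij unfolding bij_betw_def by (metis UNIV_I imageE)
    then obtain c where "c \<in> cycles \<Delta> i" "g c = 1" by (auto simp: g_def reduced_homology_def)
    then show ?thesis by (intro bexI[of _ c]) auto
  qed
  ultimately show "\<exists>g. ?P g" by blast
next
  assume "\<exists>g. ?P g"
  then obtain g where g: "?P g" by blast
  define f where "f C = g (SOME c. c \<in> cycles \<Delta> i \<and> C = homology_class \<Delta> i c)" for C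
  have diff: "g (\<lambda>xs. c xs - d xs) = g c - g d" if "c \<in> cycles \<Delta> i" "d \<in> cycles \<Delta> i" for c d
  proof -
    have "g (\<lambda>xs. 1 * c xs + (- 1) * d xs) = 1 * g c + (- 1) * g d"
      using g that unfolding linear_on_cycles_def by blast
    then show ?thesis by simp
  qed
  have eq: "homology_class \<Delta> i c = homology_class \<Delta> i d \<longleftrightarrow> g c = g d"
    if "c \<in> cycles \<Delta> i" "d \<in> cycles \<Delta> i" for c d
  proof -
    have "g (\<lambda>xs. c xs - d xs) = 0 \<longleftrightarrow> (\<lambda>xs. c xs - d xs) \<in> boundaries \<Delta> i"
      using g cycles_diff[OF that] by blast
    then show ?thesis unfolding homology_class_eq_iff[OF that] diff[OF that] by simp
  qed
  have f: "f (homology_class \<Delta> i c) = g c" if "c \<in> cycles \<Delta> i" for c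
    unfolding f_def by (rule someI2[of _ c]) (use that eq in blast)+
  have lin: "g (\<lambda>xs. a * c xs + b * d xs) = a * g c + b * g d"
    if "c \<in> cycles \<Delta> i" "d \<in> cycles \<Delta> i" for a b c d
    using g that unfolding linear_on_cycles_def by blast
  obtain c0 where c0: "c0 \<in> cycles \<Delta> i" "g c0 \<noteq> 0" using g by blast
  have "bij_betw f (reduced_homology \<Delta> i) UNIV"
  proof (rule bij_betwI')
    fix C D :: "('a list \<Rightarrow> 'k) set" assume "C \<in> reduced_homology \<Delta> i" "D \<in> reduced_homology \<Delta> i"
    then obtain c d where "c \<in> cycles \<Delta> i" "d \<in> cycles \<Delta> i"
      "C = homology_class \<Delta> i c" "D = homology_class \<Delta> i d"
      unfolding reduced_homology_def by blast
    then show "f C = f D \<longleftrightarrow> C = D" by (simp only: f eq)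
  next
    fix y :: 'k
    have "g (\<lambda>xs. (y / g c0) * c0 xs + 0 * c0 xs) = y"
      using lin[OF c0(1) c0(1), of "y / g c0" 0] c0(2) by simp
    moreover have "(\<lambda>xs. (y / g c0) * c0 xs + 0 * c0 xs) \<in> cycles \<Delta> i"
      by (rule cycles_lincomb[OF c0(1) c0(1)])
    ultimately show "\<exists>C\<in>reduced_homology \<Delta> i. y = f C"
      unfolding reduced_homology_def
      by (intro bexI[OF _ imageI]) (auto simp only: f)
  qed simp
  moreover have "f (homology_class \<Delta> i (\<lambda>xs. c xs + d xs))
             = f (homology_class \<Delta> i c) + f (homology_class \<Delta> i d)"
    if "c \<in> cycles \<Delta> i" "d \<in> cycles \<Delta> i" for c d
    using lin[OF that, of 1 1] cycles_lincomb[OF that, of 1 1] f[OF that(1)] f[OF that(2)]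
      f[of "\<lambda>xs. c xs + d xs"] by simp
  moreover have "f (homology_class \<Delta> i (\<lambda>xs. a * c xs)) = a * f (homology_class \<Delta> i c)"
    if "c \<in> cycles \<Delta> i" for a c
    using lin[OF that that, of a 0] cycles_lincomb[OF that that, of a 0] f[OF that]
      f[of "\<lambda>xs. a * c xs"] by simp
  ultimately show "homology_field TYPE('k) \<Delta> i"
    unfolding homology_field_def by blast
qed

lemma homology_field_not_zero:
  "homology_field TYPE('k::field) \<Delta> i \<Longrightarrow> \<not> homology_zero TYPE('k) \<Delta> i"
  unfolding homology_field_iff homology_zero_iff by blast

text \<open>The assumptions say that \<open>\<Phi>\<close> is injective and surjective on homology
  in one pair of degrees. They do not ask for a chain map, which admits restriction to a link: that
  commutes with boundaries only up to sign, and it shifts degrees.\<close>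

lemma homology_transfer:
  fixes \<Phi> :: "('a list \<Rightarrow> 'k::field) \<Rightarrow> ('b list \<Rightarrow> 'k)"
  assumes cyc: "\<And>c. c \<in> cycles \<Delta> i \<Longrightarrow> \<Phi> c \<in> cycles \<Gamma> j"
    and lin: "\<And>a b c d. \<Phi> (\<lambda>xs. a * c xs + b * d xs) = (\<lambda>xs. a * \<Phi> c xs + b * \<Phi> d xs)"
    and bd: "\<And>c. c \<in> cycles \<Delta> i \<Longrightarrow> \<Phi> c \<in> boundaries \<Gamma> j \<longleftrightarrow> c \<in> boundaries \<Delta> i"
    and surj: "\<And>d. d \<in> cycles \<Gamma> j \<Longrightarrow> \<exists>c\<in>cycles \<Delta> i. (\<lambda>xs. d xs - \<Phi> c xs) \<in> boundaries \<Gamma> j"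
  shows "(homology_zero TYPE('k) \<Delta> i \<longleftrightarrow> homology_zero TYPE('k) \<Gamma> j) \<and>
    (homology_field TYPE('k) \<Delta> i \<longleftrightarrow> homology_field TYPE('k) \<Gamma> j)"
proof -
  have split: "\<exists>c e. c \<in> cycles \<Delta> i \<and> e \<in> boundaries \<Gamma> j \<and> d = (\<lambda>xs. 1 * e xs + 1 * \<Phi> c xs)"
    if d: "d \<in> cycles \<Gamma> j" for d
  proof -
    obtain c where "c\<in>cycles \<Delta> i" "(\<lambda>xs. d xs - \<Phi> c xs) \<in> boundaries \<Gamma> j"
      using surj[OF d] by blast
    then show ?thesis by (intro exI[of _ c] exI[of _ "\<lambda>xs. d xs - \<Phi> c xs"]) auto
  qed
  have "homology_zero TYPE('k) \<Delta> i \<longleftrightarrow> homology_zero TYPE('k) \<Gamma> j"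
  proof
    assume "homology_zero TYPE('k) \<Delta> i"
    then have z: "\<And>c :: 'a list \<Rightarrow> 'k. c \<in> cycles \<Delta> i \<Longrightarrow> \<Phi> c \<in> boundaries \<Gamma> j"
      using bd by (auto simp: homology_zero_iff)
    have "d \<in> boundaries \<Gamma> j" if d: "d \<in> cycles \<Gamma> j" for d :: "'b list \<Rightarrow> 'k"
    proof -
      obtain c e where "c \<in> cycles \<Delta> i" "e \<in> boundaries \<Gamma> j" and eq: "d = (\<lambda>xs. 1 * e xs + 1 * \<Phi> c xs)"
        using split[OF d] by blast
      then show ?thesis unfolding eq by (intro boundaries_lincomb z)
    qed
    then show "homology_zero TYPE('k) \<Gamma> j" by (auto simp: homology_zero_iff)
  next
    assume "homology_zero TYPE('k) \<Gamma> j"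
    then show "homology_zero TYPE('k) \<Delta> i" using cyc bd by (auto simp: homology_zero_iff)
  qed
  moreover have "homology_field TYPE('k) \<Delta> i \<longleftrightarrow> homology_field TYPE('k) \<Gamma> j"
  proof
    assume "homology_field TYPE('k) \<Gamma> j"
    then obtain g :: "('b list \<Rightarrow> 'k) \<Rightarrow> 'k" where g: "linear_on_cycles \<Gamma> j g"
      "\<And>c. c\<in>cycles \<Gamma> j \<Longrightarrow> g c = 0 \<longleftrightarrow> c \<in> boundaries \<Gamma> j" "\<exists>c\<in>cycles \<Gamma> j. g c \<noteq> 0"
      unfolding homology_field_iff by blast
    have "linear_on_cycles \<Delta> i (\<lambda>c. g (\<Phi> c))"
      using g(1) cyc unfolding linear_on_cycles_def lin by blast
    moreover have "\<forall>c\<in>cycles \<Delta> i. g (\<Phi> c) = 0 \<longleftrightarrow> c \<in> boundaries \<Delta> i"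
      using g(2) bd cyc by blast
    moreover have "\<exists>c\<in>cycles \<Delta> i. g (\<Phi> c) \<noteq> 0"
    proof (rule ccontr)
      assume contr: "\<not> ?thesis"
      obtain d where d: "d \<in> cycles \<Gamma> j" "g d \<noteq> 0" using g(3) by blast
      obtain c e where ce: "c \<in> cycles \<Delta> i" "e \<in> boundaries \<Gamma> j" and eq: "d = (\<lambda>xs. 1 * e xs + 1 * \<Phi> c xs)"
        using split[OF d(1)] by blast
      have "\<Phi> c \<in> boundaries \<Gamma> j" using contr ce(1) g(2) cyc by blast
      then have "d \<in> boundaries \<Gamma> j" unfolding eq using ce(2) by (intro boundaries_lincomb)
      then show False using d g(2) by blast
    qed
    ultimately show "homology_field TYPE('k) \<Delta> i" unfolding homology_field_iff by blast
  next
    assume "homology_field TYPE('k) \<Delta> i"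
    then obtain g :: "('a list \<Rightarrow> 'k) \<Rightarrow> 'k" where g: "linear_on_cycles \<Delta> i g"
      "\<And>c. c\<in>cycles \<Delta> i \<Longrightarrow> g c = 0 \<longleftrightarrow> c \<in> boundaries \<Delta> i" "\<exists>c\<in>cycles \<Delta> i. g c \<noteq> 0"
      unfolding homology_field_iff by blast
    \<comment> \<open>The functional on the source is transported along a chosen preimage;
      \<open>gpre\<close> shows that its value does not depend on the choice.\<close>
    define pre where "pre d = (SOME c. c \<in> cycles \<Delta> i \<and> (\<lambda>xs. d xs - \<Phi> c xs) \<in> boundaries \<Gamma> j)" for d
    have pre: "pre d \<in> cycles \<Delta> i" "(\<lambda>xs. d xs - \<Phi> (pre d) xs) \<in> boundaries \<Gamma> j"
      if "d \<in> cycles \<Gamma> j" for d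
      using someI_ex[of "\<lambda>c. c \<in> cycles \<Delta> i \<and> (\<lambda>xs. d xs - \<Phi> c xs) \<in> boundaries \<Gamma> j"] surj[OF that]
      unfolding pre_def by blast+
    have glin: "g (\<lambda>xs. a * c xs + b * d xs) = a * g c + b * g d"
      if "c \<in> cycles \<Delta> i" "d \<in> cycles \<Delta> i" for a b and c d :: "'a list \<Rightarrow> 'k"
      using g(1) that unfolding linear_on_cycles_def by blast
    have gpre: "g (pre d) = g c"
      if d: "d \<in> cycles \<Gamma> j" and c: "c \<in> cycles \<Delta> i"
        and dc: "(\<lambda>xs. d xs - \<Phi> c xs) \<in> boundaries \<Gamma> j" for c d
    proof -
      let ?u = "\<lambda>xs. 1 * pre d xs + (- 1) * c xs"
      have u: "?u \<in> cycles \<Delta> i" by (rule cycles_lincomb[OF pre(1)[OF d] c])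
      have "\<Phi> ?u = (\<lambda>xs. 1 * (d xs - \<Phi> c xs) + (- 1) * (d xs - \<Phi> (pre d) xs))"
        unfolding lin by (simp add: algebra_simps)
      then have "\<Phi> ?u \<in> boundaries \<Gamma> j"
        using boundaries_lincomb[OF dc pre(2)[OF d], of 1 "- 1"] by (simp only:)
      then have "g ?u = 0" using bd[OF u] g(2)[OF u] by blast
      then show ?thesis using glin[OF pre(1)[OF d] c, of 1 "- 1"] by simp
    qed
    have "linear_on_cycles \<Gamma> j (\<lambda>d. g (pre d))"
      unfolding linear_on_cycles_def
    proof (intro ballI allI)
      fix c d :: "'b list \<Rightarrow> 'k" and a b assume c: "c \<in> cycles \<Gamma> j" and d: "d \<in> cycles \<Gamma> j"
      have "(\<lambda>xs. (a * c xs + b * d xs) - \<Phi> (\<lambda>xs. a * pre c xs + b * pre d xs) xs)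
          = (\<lambda>xs. a * (c xs - \<Phi> (pre c) xs) + b * (d xs - \<Phi> (pre d) xs))"
        unfolding lin by (simp add: algebra_simps)
      then have "g (pre (\<lambda>xs. a * c xs + b * d xs)) = g (\<lambda>xs. a * pre c xs + b * pre d xs)"
        using boundaries_lincomb[OF pre(2)[OF c] pre(2)[OF d], of a b]
        by (intro gpre cycles_lincomb c d pre(1)) (simp only:)
      then show "g (pre (\<lambda>xs. a * c xs + b * d xs)) = a * g (pre c) + b * g (pre d)"
        using glin[OF pre(1)[OF c] pre(1)[OF d]] by simp
    qed
    moreover have "g (pre d) = 0 \<longleftrightarrow> d \<in> boundaries \<Gamma> j" if d: "d \<in> cycles \<Gamma> j" for d
    proof -
      have "g (pre d) = 0 \<longleftrightarrow> \<Phi> (pre d) \<in> boundaries \<Gamma> j"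
        using g(2) bd pre(1)[OF d] by blast
      also have "\<dots> \<longleftrightarrow> d \<in> boundaries \<Gamma> j"
        using boundaries_lincomb[OF pre(2)[OF d], of "\<Phi> (pre d)" 1 1]
          boundaries_lincomb[OF _ pre(2)[OF d], of d 1 "- 1"] by auto
      finally show ?thesis .
    qed
    moreover have "\<exists>d\<in>cycles \<Gamma> j. g (pre d) \<noteq> 0"
    proof -
      obtain c where c: "c \<in> cycles \<Delta> i" "g c \<noteq> 0" using g(3) by blast
      have "g (pre (\<Phi> c)) = g c"
        by (rule gpre[OF cyc[OF c(1)] c(1)]) (simp add: boundaries_zero)
      then show ?thesis using c cyc by (intro bexI[of _ "\<Phi> c"]) auto
    qed
    ultimately show "homology_field TYPE('k) \<Gamma> j" unfolding homology_field_iff by blast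
  qed
  ultimately show ?thesis ..
qed

text \<open>Degree -1 is included, so \<open>{{}}\<close> is not acyclic.\<close>

definition acyclic_complex :: "'k::field itself \<Rightarrow> 'a set set \<Rightarrow> bool" where
  "acyclic_complex k \<Delta> \<longleftrightarrow> (\<forall>i. homology_zero k \<Delta> i)"

text \<open>Only vanishing and one-dimensionality are compared, because the definitions of homology
  spheres and balls ask for nothing else.\<close>

definition same_homology :: "'k::field itself \<Rightarrow> int \<Rightarrow> 'a set set \<Rightarrow> 'b set set \<Rightarrow> bool" where
  "same_homology k s \<Delta> \<Gamma> \<longleftrightarrow> (\<forall>i.
     (homology_zero k \<Delta> i \<longleftrightarrow> homology_zero k \<Gamma> (i + s)) \<and>
     (homology_field k \<Delta> i \<longleftrightarrow> homology_field k \<Gamma> (i + s)))"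

lemma same_homology_refl: "same_homology k 0 \<Delta> \<Delta>"
  by (simp add: same_homology_def)

lemma same_homology_sym: "same_homology k s \<Delta> \<Gamma> \<Longrightarrow> same_homology k (- s) \<Gamma> \<Delta>"
  unfolding same_homology_def by (metis add.commute diff_add_cancel uminus_add_conv_diff)

lemma same_homology_sym0: "same_homology k 0 \<Delta> \<Gamma> \<Longrightarrow> same_homology k 0 \<Gamma> \<Delta>"
  using same_homology_sym[of k 0] by simp

lemma same_homology_trans:
  "same_homology k s \<Delta> \<Gamma> \<Longrightarrow> same_homology k t \<Gamma> \<Lambda> \<Longrightarrow> same_homology k (s + t) \<Delta> \<Lambda>"
  unfolding same_homology_def by (simp add: add.assoc)

lemma same_homology_trans0:
  "same_homology k 0 \<Delta> \<Gamma> \<Longrightarrow> same_homology k 0 \<Gamma> \<Lambda> \<Longrightarrow> same_homology k 0 \<Delta> \<Lambda>"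
  using same_homology_trans[of k 0 _ _ 0] by simp

lemma same_homology_acyclic:
  assumes "same_homology k s \<Delta> \<Gamma>"
  shows "acyclic_complex k \<Delta> \<longleftrightarrow> acyclic_complex k \<Gamma>"
  using assms unfolding same_homology_def acyclic_complex_def by (metis diff_add_cancel)

section \<open>Deletions, links and cones\<close>

definition deletion :: "'a set set \<Rightarrow> 'a set \<Rightarrow> 'a set set" where
  "deletion \<Delta> F = {G \<in> \<Delta>. \<not> F \<subseteq> G}"

lemma abstract_complex_deletion:
  assumes "abstract_complex \<Delta>" "F \<noteq> {}" shows "abstract_complex (deletion \<Delta> F)"
proof (rule abstract_complexI)
  show "G \<in> deletion \<Delta> F" if "H \<in> deletion \<Delta> F" "G \<subseteq> H" for G H
    using abstract_complexD(4)[OF assms(1), of H G] that unfolding deletion_def by blast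
qed (use abstract_complexD(2,3,5)[OF assms(1)] assms(2) in \<open>auto simp: deletion_def\<close>)

lemma link_altdef: "link \<Delta> F = {G. G \<inter> F = {} \<and> F \<union> G \<in> \<Delta>}"
proof -
  have "\<exists>H. G = H - F \<and> H \<in> \<Delta> \<and> F \<subseteq> H" if "G \<inter> F = {}" "F \<union> G \<in> \<Delta>" for G
    using that by (intro exI[of _ "F \<union> G"]) auto
  moreover have "F \<union> (G - F) = G" if "F \<subseteq> G" for G using that by auto
  ultimately show ?thesis unfolding link_def by auto
qed

lemma abstract_complex_link:
  assumes "abstract_complex \<Delta>" "F \<in> \<Delta>" shows "abstract_complex (link \<Delta> F)"
proof (rule abstract_complexI)
  show "finite (link \<Delta> F)" using abstract_complexD(2)[OF assms(1)] by (simp add: link_def)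
  show "G \<in> link \<Delta> F" if "H \<in> link \<Delta> F" "G \<subseteq> H" for G H
    using abstract_complexD(4)[OF assms(1), of "F \<union> H" "F \<union> G"] that unfolding link_altdef by auto
  show "finite G" if "G \<in> link \<Delta> F" for G
    using abstract_complexD(5)[OF assms(1), of "F \<union> G"] that by (auto simp: link_altdef)
qed (use assms in \<open>auto simp: link_altdef\<close>)

lemma link_subset: "abstract_complex \<Delta> \<Longrightarrow> link \<Delta> F \<subseteq> \<Delta>"
  using abstract_complexD(4) by (fastforce simp: link_def)

lemma link_chain:
  assumes "c \<in> chains \<Delta> i" "distinct rs"
  shows "(\<lambda>ys. c (rs @ ys)) \<in> chains (link \<Delta> (set rs)) (i - int (length rs))"
proof (rule chainsI)
  fix ys assume "c (rs @ ys) \<noteq> 0"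
  then have "distinct (rs @ ys)" "set (rs @ ys) \<in> \<Delta>" "face_dim (set (rs @ ys)) = i"
    using chainsD(1)[OF assms(1)] by blast+
  then show "distinct ys \<and> set ys \<in> link \<Delta> (set rs) \<and> face_dim (set ys) = i - int (length rs)"
    by (auto simp: link_altdef face_dim_def card_Un_disjoint distinct_card)
next
  fix xs a b ys
  show "c (rs @ xs @ b # a # ys) = - c (rs @ xs @ a # b # ys)"
    using chainsD(2)[OF assms(1), rule_format, of "rs @ xs" b a ys] by simp
qed

text \<open>Restriction to the orderings that begin with \<open>rs\<close> is a chain map up to
  sign: the new vertex is inserted behind \<open>rs\<close> in the link and in front of it in
  \<open>\<Delta>\<close>.\<close>

lemma boundary_link_chain:
  assumes "abstract_complex \<Delta>" "c \<in> chains \<Delta> i" "distinct rs"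
  shows "boundary_map (link \<Delta> (set rs)) (\<lambda>ys. c (rs @ ys)) ys
    = (- 1) ^ length rs * boundary_map \<Delta> c (rs @ ys)"
proof -
  have "boundary_map (link \<Delta> (set rs)) (\<lambda>ys. c (rs @ ys)) ys = boundary_map \<Delta> (\<lambda>ys. c (rs @ ys)) ys"
    using boundary_map_mono[OF link_chain[OF assms(2,3)] link_subset[OF assms(1)]
        abstract_complexD(1)[OF assms(1)]] by simp
  also have "\<dots> = (- 1) ^ length rs * boundary_map \<Delta> c (rs @ ys)"
    unfolding boundary_map_def sum_distrib_left
  proof (rule sum.cong[OF refl])
    fix v
    have "(- 1 :: 'b) ^ length rs * (- 1) ^ length rs = 1"
      by (simp flip: power_mult_distrib)
    then show "c (rs @ v # ys) = (- 1) ^ length rs * c (v # rs @ ys)"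
      using alternating_move[OF chainsD(2)[OF assms(2)], of v rs ys] by (simp flip: mult.assoc)
  qed
  finally show ?thesis .
qed

lemma link_disjoint: "F \<inter> \<Union>(link \<Delta> F) = {}"
  by (auto simp: link_altdef)

lemma link_cone_chains:
  assumes "e \<in> chains (link \<Delta> (set rs)) i" "distinct rs"
  shows "foldr cone_chain rs e \<in> chains \<Delta> (i + int (length rs))"
proof -
  have "foldr cone_chain rs e \<in> chains ((\<lambda>G. set rs \<union> G) ` link \<Delta> (set rs)) (i + int (length rs))"
    by (rule foldr_cone_chains[OF assms link_disjoint])
  moreover have "(\<lambda>G. set rs \<union> G) ` link \<Delta> (set rs) \<subseteq> \<Delta>" by (auto simp: link_altdef)
  ultimately show ?thesis by (rule subsetD[OF chains_mono, rotated])
qed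

lemma chains_deletionI:
  assumes "c \<in> chains \<Delta> i" "\<And>ys. c (rs @ ys) = 0" "distinct rs"
  shows "c \<in> chains (deletion \<Delta> (set rs)) i"
proof (rule chainsI)
  fix xs assume "c xs \<noteq> 0"
  then show "distinct xs \<and> set xs \<in> deletion \<Delta> (set rs) \<and> face_dim (set xs) = i"
    using chainsD(1)[OF assms(1)] chains_eq_zero_superset[OF assms] by (auto simp: deletion_def)
qed (rule chainsD(2)[OF assms(1), rule_format])

lemma chains_deletionD:
  assumes "c \<in> chains (deletion \<Delta> (set rs)) i"
  shows "c \<in> chains \<Delta> i" "c (rs @ ys) = 0"
proof -
  show "c \<in> chains \<Delta> i" using chains_mono[of "deletion \<Delta> (set rs)" \<Delta>] assms by (auto simp: deletion_def)
  show "c (rs @ ys) = 0" using chainsD(1)[OF assms, of "rs @ ys"] by (auto simp: deletion_def)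
qed

lemma boundary_map_deletion:
  assumes "c \<in> chains (deletion \<Delta> F) i" "finite (\<Union>\<Delta>)"
  shows "boundary_map (deletion \<Delta> F) c = boundary_map \<Delta> c"
  by (rule boundary_map_mono[OF assms(1) _ assms(2), symmetric]) (auto simp: deletion_def)

lemma cycles_deletion:
  assumes "finite (\<Union>\<Delta>)"
  shows "c \<in> cycles (deletion \<Delta> F) i \<longleftrightarrow> c \<in> chains (deletion \<Delta> F) i \<and> boundary_map \<Delta> c = (\<lambda>_. 0)"
  using boundary_map_deletion[OF _ assms] by (fastforce simp: cycles_def)

text \<open>If the part of \<open>c\<close> around the face bounds \<open>e\<close> in the link,
  then the boundary of the join of the face with \<open>e\<close> agrees with \<open>c\<close>
  around the face, up to sign. Subtracting it pushes \<open>c\<close> off the face.\<close>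

lemma link_acyclic_push:
  fixes c :: "'a list \<Rightarrow> 'k::field"
  assumes "abstract_complex \<Delta>" "distinct rs"
    and "(\<lambda>ys. c (rs @ ys)) \<in> boundaries (link \<Delta> (set rs)) (i - int (length rs))"
    and c: "c \<in> chains \<Delta> i"
  obtains d where "d \<in> chains \<Delta> (i + 1)"
    "(\<lambda>xs. c xs - boundary_map \<Delta> d xs) \<in> chains (deletion \<Delta> (set rs)) i"
proof -
  obtain e where e: "e \<in> chains (link \<Delta> (set rs)) (i - int (length rs) + 1)"
    "(\<lambda>ys. c (rs @ ys)) = boundary_map (link \<Delta> (set rs)) e"
    using assms(3) boundariesD by metis
  define h where "h = foldr cone_chain rs e"
  have h: "h \<in> chains \<Delta> (i + 1)"
    using link_cone_chains[OF e(1) assms(2)] by (simp add: h_def algebra_simps)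
  \<comment> \<open>The sign cancels the one in \<open>boundary_link_chain\<close>. The zero summand
    only brings \<open>d\<close> into the form of \<open>chains_lincomb\<close>.\<close>
  define d where "d = (\<lambda>xs. (- 1) ^ length rs * h xs + 0 * h xs)"
  have d: "d \<in> chains \<Delta> (i + 1)" unfolding d_def by (rule chains_lincomb[OF h h])
  have dh: "boundary_map \<Delta> d xs = (- 1) ^ length rs * boundary_map \<Delta> h xs" for xs
    unfolding d_def boundary_map_lincomb by simp
  have he: "(\<lambda>ys. h (rs @ ys)) = e" unfolding h_def foldr_cone_append ..
  have zero: "c (rs @ ys) - boundary_map \<Delta> d (rs @ ys) = 0" for ys
  proof -
    have "c (rs @ ys) = boundary_map (link \<Delta> (set rs)) e ys" using e(2) by metis
    also have "\<dots> = boundary_map \<Delta> d (rs @ ys)"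
      using boundary_link_chain[OF assms(1) h assms(2), of ys] unfolding he dh .
    finally show ?thesis by simp
  qed
  have "boundary_map \<Delta> d \<in> chains \<Delta> i" using boundary_map_chains[OF assms(1) d] by simp
  then show thesis
    using that[OF d] chains_deletionI[OF chains_diff[OF c] zero assms(2)] by (simp only:)
qed

text \<open>A chain whose boundary avoids \<open>F\<close> restricts to a cycle of the link, which
  bounds, so the chain can be pushed off \<open>F\<close>. Applied to cycles this makes the
  inclusion surjective on homology, applied to bounding chains injective.\<close>

lemma same_homology_deletion:
  assumes cx: "abstract_complex \<Delta>" and F: "F \<in> \<Delta>"
    and ac: "acyclic_complex TYPE('k::field) (link \<Delta> F)"
  shows "same_homology TYPE('k) 0 (deletion \<Delta> F) \<Delta>"
proof -
  obtain rs where rs: "distinct rs" "set rs = F"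
    using finite_distinct_list abstract_complexD(5)[OF cx F] by metis
  note fin = abstract_complexD(1)[OF cx]
  have push: "\<exists>d \<in> chains \<Delta> (i + 1). (\<lambda>xs. c xs - boundary_map \<Delta> d xs) \<in> chains (deletion \<Delta> F) i"
    if c: "c \<in> chains \<Delta> i" and z: "\<And>ys. boundary_map \<Delta> c (rs @ ys) = 0" for c :: "'a list \<Rightarrow> 'k" and i
  proof -
    have "(\<lambda>ys. c (rs @ ys)) \<in> cycles (link \<Delta> (set rs)) (i - int (length rs))"
      using link_chain[OF c rs(1)] boundary_link_chain[OF cx c rs(1)] z
      by (simp add: cycles_def fun_eq_iff)
    then have "(\<lambda>ys. c (rs @ ys)) \<in> boundaries (link \<Delta> (set rs)) (i - int (length rs))"
      using ac rs(2) by (auto simp: acyclic_complex_def homology_zero_iff)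
    from link_acyclic_push[OF cx rs(1) this c] show ?thesis using rs(2) by blast
  qed
  have *: "(homology_zero TYPE('k) (deletion \<Delta> F) i \<longleftrightarrow> homology_zero TYPE('k) \<Delta> i) \<and>
      (homology_field TYPE('k) (deletion \<Delta> F) i \<longleftrightarrow> homology_field TYPE('k) \<Delta> i)" for i
  proof (rule homology_transfer[where \<Phi> = "\<lambda>c. c"])
    fix c :: "'a list \<Rightarrow> 'k" assume c: "c \<in> cycles (deletion \<Delta> F) i"
    then have c': "c \<in> chains (deletion \<Delta> (set rs)) i" "boundary_map \<Delta> c = (\<lambda>_. 0)"
      using cycles_deletion[OF fin] rs by auto
    show "c \<in> cycles \<Delta> i" using chains_deletionD(1)[OF c'(1)] c'(2) by (simp add: cycles_def)
    show "c \<in> boundaries \<Delta> i \<longleftrightarrow> c \<in> boundaries (deletion \<Delta> F) i"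
    proof
      assume "c \<in> boundaries (deletion \<Delta> F) i"
      then obtain d where d: "d \<in> chains (deletion \<Delta> F) (i + 1)" "c = boundary_map (deletion \<Delta> F) d"
        by (rule boundariesD)
      then have "c = boundary_map \<Delta> d" "d \<in> chains \<Delta> (i + 1)"
        using boundary_map_deletion[OF d(1) fin] chains_deletionD(1)[of d \<Delta> rs] rs by auto
      then show "c \<in> boundaries \<Delta> i" using boundariesI[of d \<Delta> i] by simp
    next
      assume "c \<in> boundaries \<Delta> i"
      then obtain d where d: "d \<in> chains \<Delta> (i + 1)" "c = boundary_map \<Delta> d"
        by (rule boundariesD)
      have "boundary_map \<Delta> d (rs @ ys) = 0" for ys
        using chains_deletionD(2)[OF c'(1)] d(2) by simp
      from push[OF d(1) this] obtain e where e: "e \<in> chains \<Delta> (i + 1 + 1)"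
        "(\<lambda>xs. d xs - boundary_map \<Delta> e xs) \<in> chains (deletion \<Delta> F) (i + 1)" by blast
      have "boundary_map (deletion \<Delta> F) (\<lambda>xs. d xs - boundary_map \<Delta> e xs) = c"
        unfolding boundary_map_deletion[OF e(2) fin]
        unfolding boundary_map_diff boundary_boundary[OF cx e(1)] using d(2) by simp
      then show "c \<in> boundaries (deletion \<Delta> F) i" using boundariesI[OF e(2)] by simp
    qed
  next
    fix d :: "'a list \<Rightarrow> 'k" assume d: "d \<in> cycles \<Delta> i"
    then have dc: "d \<in> chains \<Delta> i" and d0: "boundary_map \<Delta> d = (\<lambda>_. 0)" by (auto simp: cycles_def)
    from push[OF dc] d0 obtain e where e: "e \<in> chains \<Delta> (i + 1)"
        "(\<lambda>xs. d xs - boundary_map \<Delta> e xs) \<in> chains (deletion \<Delta> F) i" by auto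
    have "(\<lambda>xs. d xs - boundary_map \<Delta> e xs) \<in> cycles (deletion \<Delta> F) i"
      unfolding cycles_deletion[OF fin] boundary_map_diff boundary_boundary[OF cx e(1)] d0
      using e(2) by simp
    then show "\<exists>c\<in>cycles (deletion \<Delta> F) i. (\<lambda>xs. d xs - c xs) \<in> boundaries \<Delta> i"
      using boundariesI[OF e(1)] by (intro bexI) auto
  qed simp_all
  then show ?thesis by (simp add: same_homology_def)
qed

text \<open>Restriction to the faces around \<open>F\<close> identifies chains modulo the deletion
  with chains of the link, \<open>card F\<close> degrees lower. Since the deletion is acyclic,
  discarding it does not change the homology.\<close>

lemma same_homology_link:
  assumes cx: "abstract_complex \<Delta>" and F: "F \<in> \<Delta>"
    and ac: "acyclic_complex TYPE('k::field) (deletion \<Delta> F)"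
  shows "same_homology TYPE('k) (- int (card F)) \<Delta> (link \<Delta> F)"
proof -
  obtain rs where rs: "distinct rs" "set rs = F"
    using finite_distinct_list abstract_complexD(5)[OF cx F] by metis
  have card: "int (card F) = int (length rs)" using rs distinct_card by fastforce
  note fin = abstract_complexD(1)[OF cx]
  let ?\<Phi> = "\<lambda>c :: 'a list \<Rightarrow> 'k. \<lambda>ys. c (rs @ ys)"
  have bdry: "d \<in> chains (deletion \<Delta> F) i \<Longrightarrow> boundary_map \<Delta> d = (\<lambda>_. 0) \<Longrightarrow>
      \<exists>u \<in> chains (deletion \<Delta> F) (i + 1). d = boundary_map \<Delta> u" for d :: "'a list \<Rightarrow> 'k" and i
  proof -
    assume d: "d \<in> chains (deletion \<Delta> F) i" "boundary_map \<Delta> d = (\<lambda>_. 0)"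
    then have "d \<in> cycles (deletion \<Delta> F) i" by (simp add: cycles_deletion[OF fin])
    then have "d \<in> boundaries (deletion \<Delta> F) i"
      using ac unfolding acyclic_complex_def homology_zero_iff by blast
    then obtain u where u: "u \<in> chains (deletion \<Delta> F) (i + 1)" "d = boundary_map (deletion \<Delta> F) u"
      by (rule boundariesD)
    then show ?thesis using boundary_map_deletion[OF u(1) fin] by (intro bexI[of _ u]) auto
  qed
  have *: "(homology_zero TYPE('k) \<Delta> i \<longleftrightarrow> homology_zero TYPE('k) (link \<Delta> F) (i - int (length rs))) \<and>
      (homology_field TYPE('k) \<Delta> i \<longleftrightarrow> homology_field TYPE('k) (link \<Delta> F) (i - int (length rs)))" for i
  proof (rule homology_transfer[where \<Phi> = ?\<Phi>])
    fix c :: "'a list \<Rightarrow> 'k" assume "c \<in> cycles \<Delta> i"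
    then have c: "c \<in> chains \<Delta> i" and c0: "boundary_map \<Delta> c = (\<lambda>_. 0)" by (auto simp: cycles_def)
    show "?\<Phi> c \<in> cycles (link \<Delta> F) (i - int (length rs))"
      using link_chain[OF c rs(1)] boundary_link_chain[OF cx c rs(1)] c0 rs(2)
      by (simp add: cycles_def fun_eq_iff)
    show "?\<Phi> c \<in> boundaries (link \<Delta> F) (i - int (length rs)) \<longleftrightarrow> c \<in> boundaries \<Delta> i"
    proof
      assume "?\<Phi> c \<in> boundaries (link \<Delta> F) (i - int (length rs))"
      then obtain d where d: "d \<in> chains \<Delta> (i + 1)"
        "(\<lambda>xs. c xs - boundary_map \<Delta> d xs) \<in> chains (deletion \<Delta> F) i"
        using link_acyclic_push[OF cx rs(1) _ c] rs(2) by metis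
      have "boundary_map \<Delta> (\<lambda>xs. c xs - boundary_map \<Delta> d xs) = (\<lambda>_. 0)"
        unfolding boundary_map_diff boundary_boundary[OF cx d(1)] c0 by simp
      from bdry[OF d(2) this] obtain u where u: "u \<in> chains (deletion \<Delta> (set rs)) (i + 1)"
        "(\<lambda>xs. c xs - boundary_map \<Delta> d xs) = boundary_map \<Delta> u" using rs by blast
      have "c = boundary_map \<Delta> (\<lambda>xs. 1 * d xs + 1 * u xs)"
        unfolding boundary_map_lincomb u(2)[symmetric] by simp
      then show "c \<in> boundaries \<Delta> i"
        using boundariesI[OF chains_lincomb[OF d(1) chains_deletionD(1)[OF u(1)], of 1 1]] by (simp only:)
    next
      assume "c \<in> boundaries \<Delta> i"
      then obtain d where d: "d \<in> chains \<Delta> (i + 1)" "c = boundary_map \<Delta> d" by (rule boundariesD)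
      let ?e = "\<lambda>ys. (- 1) ^ length rs * ?\<Phi> d ys + 0 * ?\<Phi> d ys"
      have e: "?e \<in> chains (link \<Delta> F) (i - int (length rs) + 1)"
      proof -
        have "i - int (length rs) + 1 = i + 1 - int (length rs)" by simp
        then show ?thesis
          using chains_lincomb[OF link_chain[OF d(1) rs(1)] link_chain[OF d(1) rs(1)]] rs(2)
          by (simp only:)
      qed
      have "(- 1 :: 'k) ^ length rs * (- 1) ^ length rs = 1"
        by (simp flip: power_mult_distrib)
      then have "boundary_map (link \<Delta> F) ?e = ?\<Phi> c"
        using boundary_link_chain[OF cx d(1) rs(1)] rs(2) d(2)
        unfolding boundary_map_lincomb by (simp flip: mult.assoc)
      then show "?\<Phi> c \<in> boundaries (link \<Delta> F) (i - int (length rs))"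
        using boundariesI[OF e] by simp
    qed
  next
    fix z :: "'a list \<Rightarrow> 'k" assume "z \<in> cycles (link \<Delta> F) (i - int (length rs))"
    then have z: "z \<in> chains (link \<Delta> (set rs)) (i - int (length rs))"
      and z0: "boundary_map (link \<Delta> (set rs)) z = (\<lambda>_. 0)" using rs by (auto simp: cycles_def)
    \<comment> \<open>The join of the face with \<open>z\<close> is a cycle only modulo the
      deletion. Its boundary is a cycle there and hence bounds some \<open>u\<close>; then
      \<open>w - u\<close> is a cycle with the same part around the face.\<close>
    define w where "w = foldr cone_chain rs z"
    have w: "w \<in> chains \<Delta> i" using link_cone_chains[OF z rs(1)] by (simp add: w_def)
    have wz: "?\<Phi> w = z" unfolding w_def foldr_cone_append ..
    have "boundary_map \<Delta> w (rs @ ys) = 0" for ys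
      using boundary_link_chain[OF cx w rs(1), of ys] unfolding wz z0 by simp
    from chains_deletionI[OF boundary_map_chains[OF cx w] this rs(1)]
    have "boundary_map \<Delta> w \<in> chains (deletion \<Delta> F) (i - 1)" using rs by simp
    from bdry[OF this boundary_boundary[OF cx w]] obtain u
      where u: "u \<in> chains (deletion \<Delta> (set rs)) i" "boundary_map \<Delta> w = boundary_map \<Delta> u" using rs by auto
    show "\<exists>c\<in>cycles \<Delta> i. (\<lambda>ys. z ys - ?\<Phi> c ys) \<in> boundaries (link \<Delta> F) (i - int (length rs))"
    proof (rule bexI)
      show "(\<lambda>xs. w xs - u xs) \<in> cycles \<Delta> i"
        using chains_diff[OF w chains_deletionD(1)[OF u(1)]] u(2) by (simp add: cycles_def boundary_map_diff)
      have "?\<Phi> (\<lambda>xs. w xs - u xs) = z" unfolding chains_deletionD(2)[OF u(1)] using wz by simp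
      then show "(\<lambda>ys. z ys - ?\<Phi> (\<lambda>xs. w xs - u xs) ys) \<in> boundaries (link \<Delta> F) (i - int (length rs))"
        using boundaries_zero by (simp add: fun_eq_iff)
    qed
  qed simp_all
  then show ?thesis by (simp add: same_homology_def card)
qed

lemma acyclic_cone:
  assumes cx: "abstract_complex \<Delta>" and v: "\<And>F. F \<in> \<Delta> \<Longrightarrow> insert v F \<in> \<Delta>"
  shows "acyclic_complex TYPE('k::field) \<Delta>"
  unfolding acyclic_complex_def homology_zero_iff
proof (intro allI subsetI)
  fix i and c :: "'a list \<Rightarrow> 'k" assume "c \<in> cycles \<Delta> i"
  then have c: "c \<in> chains \<Delta> i" and c0: "boundary_map \<Delta> c = (\<lambda>_. 0)" by (auto simp: cycles_def)
  note fin = abstract_complexD(1)[OF cx]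
  have v\<Delta>: "v \<in> \<Union>\<Delta>" using v[OF abstract_complexD(3)[OF cx]] by blast
  \<comment> \<open>Only the part of \<open>c\<close> that avoids the apex is coned. The boundary of
    this cone agrees with \<open>c\<close> off \<open>v\<close> by construction, and on faces with
    \<open>v\<close> because \<open>c\<close> is a cycle.\<close>
  define b where "b = (\<lambda>xs. if v \<in> set xs then 0 else c xs)"
  have b: "b \<in> chains (link \<Delta> {v}) i"
  proof (rule chainsI)
    fix xs assume "b xs \<noteq> 0"
    then have "v \<notin> set xs" "c xs \<noteq> 0" by (auto simp: b_def split: if_splits)
    then show "distinct xs \<and> set xs \<in> link \<Delta> {v} \<and> face_dim (set xs) = i"
      using chainsD(1)[OF c] v by (auto simp: link_altdef)
  next
    fix xs x y ys
    show "b (xs @ y # x # ys) = - b (xs @ x # y # ys)"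
      using chainsD(2)[OF c, rule_format, of xs y x ys] by (auto simp: b_def)
  qed
  define d where "d = cone_chain v b"
  have d: "d \<in> chains \<Delta> (i + 1)"
    using link_cone_chains[of b \<Delta> "[v]" i] b by (simp add: d_def)
  have d0: "d xs = 0" if "v \<notin> set xs" for xs
    using that cone_chain_nonzero[of v b xs] unfolding d_def by force
  have dv: "d (v # xs) = b xs" for xs by (simp add: d_def)
  have sum_v: "(\<Sum>u\<in>\<Union>\<Delta>. g u) = g v + (\<Sum>u\<in>\<Union>\<Delta> - {v}. g u)" for g :: "'a \<Rightarrow> 'k"
    by (rule sum.remove[OF fin v\<Delta>])
  define f where "f = (\<lambda>xs. boundary_map \<Delta> d xs - c xs)"
  have f: "f \<in> chains \<Delta> i"
    unfolding f_def using boundary_map_chains[OF cx d] by (intro chains_diff c) simp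
  have f1: "f xs = 0" if "v \<notin> set xs" for xs
  proof -
    have "(\<Sum>u\<in>\<Union>\<Delta> - {v}. d (u # xs)) = 0" by (intro sum.neutral ballI d0) (use that in auto)
    then show ?thesis using that by (simp add: f_def boundary_map_def sum_v dv b_def)
  qed
  have f2: "f (v # ys) = 0" for ys
  proof (cases "v \<in> set ys")
    case True
    then show ?thesis using chainsD(1)[OF f, of "v # ys"] by auto
  next
    case False
    have "d (u # v # ys) = - c (u # ys)" if "u \<noteq> v" for u
      using chainsD(2)[OF d, rule_format, of "[]" u v ys] that False by (simp add: dv b_def)
    then have "(\<Sum>u\<in>\<Union>\<Delta> - {v}. d (u # v # ys)) = - (\<Sum>u\<in>\<Union>\<Delta> - {v}. c (u # ys))"
      by (simp add: sum_negf)
    moreover have "d (v # v # ys) = 0" using chainsD(1)[OF d, of "v # v # ys"] by auto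
    moreover have "c (v # ys) + (\<Sum>u\<in>\<Union>\<Delta> - {v}. c (u # ys)) = 0"
      using fun_cong[OF c0, of ys] unfolding boundary_map_def sum_v .
    ultimately show ?thesis unfolding f_def boundary_map_def sum_v
      by (simp add: add_eq_0_iff)
  qed
  have "f xs = 0" for xs
    using f1[of xs] chains_eq_zero_superset[OF f, of "[v]" xs] f2 by auto
  then have "boundary_map \<Delta> d = c" by (simp add: f_def fun_eq_iff)
  then show "c \<in> boundaries \<Delta> i" using boundariesI[OF d] by simp
qed

section \<open>Order complexes and the fibre lemma\<close>

definition relabel :: "('a \<Rightarrow> 'b) \<Rightarrow> 'a set set \<Rightarrow> ('b list \<Rightarrow> 'k::field) \<Rightarrow> 'a list \<Rightarrow> 'k" where
  "relabel g \<Delta> c = (\<lambda>xs. if set xs \<subseteq> \<Union>\<Delta> then c (map g xs) else 0)"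

lemma relabel_chains:
  assumes g: "inj_on g (\<Union>\<Delta>)" and c: "c \<in> chains ((`) g ` \<Delta>) i"
  shows "relabel g \<Delta> c \<in> chains \<Delta> i"
proof (rule chainsI)
  fix xs assume "relabel g \<Delta> c xs \<noteq> 0"
  then have xs: "set xs \<subseteq> \<Union>\<Delta>" and nz: "c (map g xs) \<noteq> 0"
    by (auto simp: relabel_def split: if_splits)
  have *: "distinct (map g xs)" "g ` set xs \<in> (`) g ` \<Delta>" "face_dim (g ` set xs) = i"
    using chainsD(1)[OF c nz] by auto
  then obtain F where F: "F \<in> \<Delta>" "g ` set xs = g ` F" by auto
  then have "set xs = F" using inj_on_image_eq_iff[OF g xs, of F] by blast
  moreover have "face_dim (set xs) = face_dim (g ` set xs)"
    unfolding face_dim_def using card_image[OF inj_on_subset[OF g xs]] by simp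
  ultimately show "distinct xs \<and> set xs \<in> \<Delta> \<and> face_dim (set xs) = i"
    using * F by (simp add: distinct_map)
next
  fix xs a b ys
  show "relabel g \<Delta> c (xs @ b # a # ys) = - relabel g \<Delta> c (xs @ a # b # ys)"
    using chainsD(2)[OF c, rule_format, of "map g xs" "g b" "g a" "map g ys"]
    by (auto simp: relabel_def)
qed

lemma boundary_relabel:
  assumes g: "inj_on g (\<Union>\<Delta>)"
  shows "boundary_map \<Delta> (relabel g \<Delta> c) = relabel g \<Delta> (boundary_map ((`) g ` \<Delta>) c)"
proof
  fix ys
  have "\<Union>((`) g ` \<Delta>) = g ` \<Union>\<Delta>" by blast
  then have "boundary_map ((`) g ` \<Delta>) c (map g ys) = (\<Sum>v\<in>\<Union>\<Delta>. c (g v # map g ys))"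
    unfolding boundary_map_def by (simp add: sum.reindex[OF g])
  moreover have "boundary_map \<Delta> (relabel g \<Delta> c) ys
      = (\<Sum>v\<in>\<Union>\<Delta>. if set ys \<subseteq> \<Union>\<Delta> then c (g v # map g ys) else 0)"
    unfolding boundary_map_def relabel_def by (rule sum.cong) auto
  ultimately show "boundary_map \<Delta> (relabel g \<Delta> c) ys = relabel g \<Delta> (boundary_map ((`) g ` \<Delta>) c) ys"
    by (simp add: relabel_def)
qed

lemma same_homology_image:
  assumes g: "inj_on g (\<Union>\<Delta>)"
  shows "same_homology TYPE('k::field) 0 \<Delta> ((`) g ` \<Delta>)"
proof -
  define \<Gamma> where "\<Gamma> = (`) g ` \<Delta>"
  define h where "h = inv_into (\<Union>\<Delta>) g"
  have un: "\<Union>\<Gamma> = g ` \<Union>\<Delta>" unfolding \<Gamma>_def by blast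
  have h: "inj_on h (\<Union>\<Gamma>)" unfolding un h_def by (rule inj_on_inv_into) simp
  have "h ` g ` F = F" if "F \<in> \<Delta>" for F
    unfolding h_def by (rule inv_into_image_cancel[OF g]) (use that in blast)
  then have \<Gamma>: "(`) h ` \<Gamma> = \<Delta>" unfolding \<Gamma>_def by (auto simp: image_image)
  have hg: "map h (map g xs) = xs" if "set xs \<subseteq> \<Union>\<Delta>" for xs
    unfolding map_map h_def using that inv_into_f_f[OF g] by (intro map_idI) auto
  have gh: "map g (map h xs) = xs" if "set xs \<subseteq> \<Union>\<Gamma>" for xs
    unfolding map_map h_def using that un by (intro map_idI) (simp add: f_inv_into_f subset_iff)
  have trip1: "relabel g \<Delta> (relabel h \<Gamma> d) = d" if "d \<in> chains \<Delta> i" for d :: "'a list \<Rightarrow> 'k" and i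
  proof
    fix xs show "relabel g \<Delta> (relabel h \<Gamma> d) xs = d xs"
      using chainsD(1)[OF that, of xs] hg[of xs] un by (auto simp: relabel_def)
  qed
  have trip2: "relabel h \<Gamma> (relabel g \<Delta> d) = d" if "d \<in> chains \<Gamma> i" for d :: "'b list \<Rightarrow> 'k" and i
  proof
    fix xs
    have "set (map h xs) \<subseteq> \<Union>\<Delta>" if "set xs \<subseteq> \<Union>\<Gamma>"
    proof
      fix y assume "y \<in> set (map h xs)"
      then obtain x where "x \<in> set xs" "y = h x" by auto
      moreover from this have "x \<in> g ` \<Union>\<Delta>" using that un by auto
      ultimately show "y \<in> \<Union>\<Delta>" unfolding h_def by (metis inv_into_into)
    qed
    then show "relabel h \<Gamma> (relabel g \<Delta> d) xs = d xs"
      using chainsD(1)[OF that, of xs] gh[of xs] by (auto simp: relabel_def)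
  qed
  have to: "relabel g \<Delta> c \<in> chains \<Delta> i" if "c \<in> chains \<Gamma> i" for c :: "'b list \<Rightarrow> 'k" and i
    using relabel_chains[OF g] that unfolding \<Gamma>_def by blast
  have bk: "relabel h \<Gamma> c \<in> chains \<Gamma> i" if "c \<in> chains \<Delta> i" for c :: "'a list \<Rightarrow> 'k" and i
    using relabel_chains[OF h] that unfolding \<Gamma> by blast
  note bto = boundary_relabel[OF g, folded \<Gamma>_def]
  note bback = boundary_relabel[OF h, unfolded \<Gamma>]
  have *: "(homology_zero TYPE('k) \<Gamma> i \<longleftrightarrow> homology_zero TYPE('k) \<Delta> i) \<and>
      (homology_field TYPE('k) \<Gamma> i \<longleftrightarrow> homology_field TYPE('k) \<Delta> i)" for i
  proof (rule homology_transfer[where \<Phi> = "relabel g \<Delta>"])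
    fix c :: "'b list \<Rightarrow> 'k" assume c: "c \<in> cycles \<Gamma> i"
    then show "relabel g \<Delta> c \<in> cycles \<Delta> i"
      using to by (auto simp: cycles_def bto) (simp add: relabel_def)
    show "relabel g \<Delta> c \<in> boundaries \<Delta> i \<longleftrightarrow> c \<in> boundaries \<Gamma> i"
    proof
      assume "c \<in> boundaries \<Gamma> i"
      then obtain d where d: "d \<in> chains \<Gamma> (i + 1)" "c = boundary_map \<Gamma> d" by (rule boundariesD)
      then show "relabel g \<Delta> c \<in> boundaries \<Delta> i"
        using boundariesI[OF to[OF d(1)]] by (simp add: bto)
    next
      assume "relabel g \<Delta> c \<in> boundaries \<Delta> i"
      then obtain d where d: "d \<in> chains \<Delta> (i + 1)" "relabel g \<Delta> c = boundary_map \<Delta> d"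
        by (rule boundariesD)
      have "c \<in> chains \<Gamma> i" using c by (simp add: cycles_def)
      then have "c = relabel h \<Gamma> (boundary_map \<Delta> d)" using trip2 d(2) by metis
      then show "c \<in> boundaries \<Gamma> i" using boundariesI[OF bk[OF d(1)]] by (simp add: bback)
    qed
  next
    fix d :: "'a list \<Rightarrow> 'k" assume d: "d \<in> cycles \<Delta> i"
    then have dc: "d \<in> chains \<Delta> i" by (simp add: cycles_def)
    have "relabel h \<Gamma> d \<in> cycles \<Gamma> i"
      using d bk by (auto simp: cycles_def bback) (simp add: relabel_def)
    then show "\<exists>c\<in>cycles \<Gamma> i. (\<lambda>xs. d xs - relabel g \<Delta> c xs) \<in> boundaries \<Delta> i"
      using trip1[OF dc] boundaries_zero by (intro bexI[of _ "relabel h \<Gamma> d"]) simp_all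
  qed (simp add: relabel_def fun_eq_iff)
  then show ?thesis by (simp add: same_homology_def \<Gamma>_def)
qed

section \<open>Clique complexes built vertex by vertex\<close>

definition clique_complex :: "('a \<Rightarrow> 'a \<Rightarrow> bool) \<Rightarrow> 'a set \<Rightarrow> 'a set set" where
  "clique_complex R A = {c. c \<subseteq> A \<and> (\<forall>x\<in>c. \<forall>y\<in>c. R x y)}"

lemma abstract_complex_clique: "finite A \<Longrightarrow> abstract_complex (clique_complex R A)"
proof (rule abstract_complexI)
  assume A: "finite A"
  show "finite (clique_complex R A)"
    by (rule finite_subset[of _ "Pow A"]) (use A in \<open>auto simp: clique_complex_def\<close>)
  show "finite F" if "F \<in> clique_complex R A" for F
    using that A finite_subset by (auto simp: clique_complex_def)
qed (auto simp: clique_complex_def)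

text \<open>In a clique complex the link of a vertex is the clique complex on its neighbours, and
  its deletion is the clique complex on the other vertices, so this is
  \<open>same_homology_deletion\<close> for a single vertex.\<close>

lemma clique_complex_insert:
  assumes "finite A" "x \<notin> A" "reflp R" "symp R"
    "acyclic_complex TYPE('k::field) (clique_complex R {y \<in> A. R x y})"
  shows "same_homology TYPE('k) 0 (clique_complex R A) (clique_complex R (insert x A))"
proof -
  have "deletion (clique_complex R (insert x A)) {x} = clique_complex R A"
    using assms(2) by (auto simp: deletion_def clique_complex_def)
  moreover have "link (clique_complex R (insert x A)) {x} = clique_complex R {y \<in> A. R x y}"
    using assms(2,3) sympD[OF assms(4)] reflpD[OF assms(3)] by (auto simp: link_altdef clique_complex_def)
  moreover have "{x} \<in> clique_complex R (insert x A)"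
    using reflpD[OF assms(3)] by (simp add: clique_complex_def)
  ultimately show ?thesis
    using same_homology_deletion[OF abstract_complex_clique, of "insert x A" "{x}" R] assms(1,5) by simp
qed

lemma clique_complex_cone:
  assumes "finite A" "x \<in> A" "symp R" "\<And>y. y \<in> A \<Longrightarrow> R x y"
  shows "acyclic_complex TYPE('k::field) (clique_complex R A)"
proof (rule acyclic_cone[OF abstract_complex_clique[OF assms(1)]])
  show "insert x F \<in> clique_complex R A" if "F \<in> clique_complex R A" for F
    using that assms(2,4) sympD[OF assms(3)] by (auto simp: clique_complex_def)
qed

text \<open>The vertices of \<open>B\<close> are added one at a time. The neighbours of a new vertex
  are again \<open>A\<close> joined with a smaller part of \<open>B\<close>, hence the induction
  over proper subsets.\<close>

lemma clique_complex_join: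
  assumes "finite A" "finite B" "A \<inter> B = {}" "reflp R" "symp R"
    "acyclic_complex TYPE('k::field) (clique_complex R A)" "\<And>a b. a \<in> A \<Longrightarrow> b \<in> B \<Longrightarrow> R a b"
  shows "acyclic_complex TYPE('k) (clique_complex R (A \<union> B))"
  using assms(2,3,7)
proof (induction B rule: finite_psubset_induct)
  case (psubset B)
  show ?case
  proof (cases "B = {}")
    case True then show ?thesis using assms(6) by simp
  next
    case False
    then obtain b where b: "b \<in> B" by auto
    define B' where "B' = B - {b}"
    have ins: "A \<union> B = insert b (A \<union> B')" "b \<notin> A \<union> B'" using b psubset.prems(1) by (auto simp: B'_def)
    have ab: "R b a" if "a \<in> A" for a
      using psubset.prems(2)[OF that b] sympD[OF assms(5)] by blast
    have "{y \<in> A \<union> B'. R b y} = A \<union> {y \<in> B'. R b y}"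
      using ab by auto
    moreover have "acyclic_complex TYPE('k) (clique_complex R (A \<union> {y \<in> B'. R b y}))"
      by (rule psubset.IH) (use b psubset.prems in \<open>auto simp: B'_def\<close>)
    ultimately have "same_homology TYPE('k) 0 (clique_complex R (A \<union> B')) (clique_complex R (insert b (A \<union> B')))"
      using assms(1,4,5) psubset.hyps ins by (intro clique_complex_insert) (auto simp: B'_def)
    moreover have "acyclic_complex TYPE('k) (clique_complex R (A \<union> B'))"
      by (rule psubset.IH) (use b psubset.prems in \<open>auto simp: B'_def\<close>)
    ultimately show ?thesis using same_homology_acyclic ins(1) by metis
  qed
qed

lemma same_homology_clique_image:
  assumes g: "inj_on g A" and R: "\<And>x y. x \<in> A \<Longrightarrow> y \<in> A \<Longrightarrow> R' (g x) (g y) \<longleftrightarrow> R x y"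
  shows "same_homology TYPE('k::field) 0 (clique_complex R A) (clique_complex R' (g ` A))"
proof -
  have "clique_complex R' (g ` A) = (`) g ` clique_complex R A"
  proof (rule Set.set_eqI)
    fix c
    show "c \<in> clique_complex R' (g ` A) \<longleftrightarrow> c \<in> (`) g ` clique_complex R A"
    proof
      assume c: "c \<in> clique_complex R' (g ` A)"
      then obtain d where d: "d \<subseteq> A" "c = g ` d" by (auto simp: clique_complex_def subset_image_iff)
      then have "R x y" if "x \<in> d" "y \<in> d" for x y
        using c that R[of x y] by (auto simp: clique_complex_def)
      then show "c \<in> (`) g ` clique_complex R A" using d by (auto simp: clique_complex_def)
    next
      assume "c \<in> (`) g ` clique_complex R A"
      then obtain d where "d \<subseteq> A" "\<forall>x\<in>d. \<forall>y\<in>d. R x y" "c = g ` d" by (auto simp: clique_complex_def)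
      then show "c \<in> clique_complex R' (g ` A)" by (auto simp: clique_complex_def R subset_iff)
    qed
  qed
  moreover have "\<Union>(clique_complex R A) \<subseteq> A" by (auto simp: clique_complex_def)
  ultimately show ?thesis using same_homology_image[OF inj_on_subset[OF g]] by simp
qed

section \<open>Mapping cylinders of monotone maps\<close>

abbreviation comparable :: "'a set \<Rightarrow> 'a set \<Rightarrow> bool" where
  "comparable x y \<equiv> x \<subseteq> y \<or> y \<subseteq> x"

definition order_complex :: "'a set set \<Rightarrow> 'a set set set" where
  "order_complex P = clique_complex comparable P"

lemma barycentric_subdivision_order: "barycentric_subdivision \<Delta> = order_complex (\<Delta> - {{}})"
  by (auto simp: barycentric_subdivision_def order_complex_def clique_complex_def subset_chain_def)

lemma order_complex_cone:
  assumes "finite P" "x \<in> P" "\<And>y. y \<in> P \<Longrightarrow> comparable x y"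
  shows "acyclic_complex TYPE('k::field) (order_complex P)"
  unfolding order_complex_def
proof (rule clique_complex_cone[OF assms(1,2)])
  show "comparable x y" if "y \<in> P" for y by (rule assms(3)[OF that])
qed (auto simp: symp_def)

text \<open>Comparability in the poset mapping cylinder of \<open>f\<close>. Its cliques interpolate
  between the flags of the two posets.\<close>

fun cylinder_rel :: "('a set \<Rightarrow> 'b set) \<Rightarrow> 'a set + 'b set \<Rightarrow> 'a set + 'b set \<Rightarrow> bool" where
  "cylinder_rel f (Inl p) (Inl p') \<longleftrightarrow> comparable p p'"
| "cylinder_rel f (Inr q) (Inr q') \<longleftrightarrow> comparable q q'"
| "cylinder_rel f (Inl p) (Inr q) \<longleftrightarrow> f p \<subseteq> q"
| "cylinder_rel f (Inr q) (Inl p) \<longleftrightarrow> f p \<subseteq> q"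

lemma cylinder_rel_refl_sym: "reflp (cylinder_rel f)" "symp (cylinder_rel f)"
proof -
  have "cylinder_rel f x x" for x by (cases x) auto
  then show "reflp (cylinder_rel f)" by (simp add: reflp_def)
  have "cylinder_rel f x y \<longleftrightarrow> cylinder_rel f y x" for x y by (cases x; cases y) auto
  then show "symp (cylinder_rel f)" by (simp add: symp_def)
qed

text \<open>The mapping cylinder grows from either end, one vertex at a time, without a change of
  homology. Starting from \<open>P\<close>, elements of \<open>Q\<close> are added from the top
  down, which is where the acyclic fibres enter; starting from \<open>Q\<close>, elements of
  \<open>P\<close> are added from the bottom up.\<close>

lemma quillen_fibre:
  fixes P :: "'a set set" and Q :: "'b set set"
  assumes fin: "finite P" "finite Q" and fPQ: "f ` P \<subseteq> Q"
    and mono: "\<And>p p'. p \<in> P \<Longrightarrow> p' \<in> P \<Longrightarrow> p \<subseteq> p' \<Longrightarrow> f p \<subseteq> f p'"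
    and fibre: "\<And>q. q \<in> Q \<Longrightarrow> acyclic_complex TYPE('k::field) (order_complex {p \<in> P. f p \<subseteq> q})"
  shows "same_homology TYPE('k) 0 (order_complex P) (order_complex Q)"
proof -
  let ?C = "clique_complex (cylinder_rel f)"
  note rs = cylinder_rel_refl_sym[of f]
  have inl: "same_homology TYPE('k) 0 (order_complex A) (?C (Inl ` A))" for A
    unfolding order_complex_def by (rule same_homology_clique_image) auto
  have inr: "same_homology TYPE('k) 0 (order_complex A) (?C (Inr ` A))" for A
    unfolding order_complex_def by (rule same_homology_clique_image) auto
  have add_Q: "same_homology TYPE('k) 0 (?C (Inl ` P)) (?C (Inl ` P \<union> Inr ` U))"
    if "finite U" "U \<subseteq> Q" "\<And>q q'. q \<in> U \<Longrightarrow> q' \<in> Q \<Longrightarrow> q \<subseteq> q' \<Longrightarrow> q' \<in> U" for U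
    using that
  proof (induction U rule: finite_psubset_induct)
    case (psubset U)
    show ?case
    proof (cases "U = {}")
      case True then show ?thesis by (simp add: same_homology_refl)
    next
      case False
      then obtain q where q: "q \<in> U" and min: "\<And>q'. q' \<in> U \<Longrightarrow> q' \<subseteq> q \<Longrightarrow> q = q'"
        using finite_has_minimal[OF psubset.hyps] by metis
      define U' where "U' = U - {q}"
      have IH: "same_homology TYPE('k) 0 (?C (Inl ` P)) (?C (Inl ` P \<union> Inr ` U'))"
      proof (rule psubset.IH)
        show "U' \<subset> U" "U' \<subseteq> Q" using q psubset.prems(1) by (auto simp: U'_def)
        show "q'' \<in> U'" if "q' \<in> U'" "q'' \<in> Q" "q' \<subseteq> q''" for q' q''
          using that psubset.prems(2)[of q' q''] min[of q'] by (auto simp: U'_def)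
      qed
      \<comment> \<open>By minimality the members of \<open>U'\<close> comparable to
        \<open>q\<close> lie above it, hence above the images of the fibre. So the neighbours of
        \<open>q\<close> form the join of the fibre with these members.\<close>
      have eq: "{y \<in> Inl ` P \<union> Inr ` U'. cylinder_rel f (Inr q) y}
          = Inl ` {p \<in> P. f p \<subseteq> q} \<union> Inr ` {q' \<in> U'. comparable q q'}" by auto
      have "acyclic_complex TYPE('k) (?C (Inl ` {p \<in> P. f p \<subseteq> q}))"
        using fibre inl same_homology_acyclic q psubset.prems(1) by blast
      then have "acyclic_complex TYPE('k) (?C {y \<in> Inl ` P \<union> Inr ` U'. cylinder_rel f (Inr q) y})"
        unfolding eq
      proof (rule clique_complex_join[OF _ _ _ rs, rotated 3])
        fix a b :: "'a set + 'b set" assume "a \<in> Inl ` {p \<in> P. f p \<subseteq> q}" "b \<in> Inr ` {q' \<in> U'. comparable q q'}"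
        then obtain p q' where "a = Inl p" "f p \<subseteq> q" "b = Inr q'" "q' \<in> U'" "comparable q q'" by auto
        then show "cylinder_rel f a b" using min[of q'] by (auto simp: U'_def)
      qed (use fin psubset.hyps in \<open>auto simp: U'_def\<close>)
      from clique_complex_insert[OF _ _ rs this]
      have "same_homology TYPE('k) 0 (?C (Inl ` P \<union> Inr ` U')) (?C (insert (Inr q) (Inl ` P \<union> Inr ` U')))"
        using fin psubset.hyps by (auto simp: U'_def)
      moreover have "insert (Inr q) (Inl ` P \<union> Inr ` U') = Inl ` P \<union> Inr ` U"
        using q by (auto simp: U'_def)
      ultimately show ?thesis using same_homology_trans0[OF IH] by simp
    qed
  qed
  have add_P: "same_homology TYPE('k) 0 (?C (Inr ` Q)) (?C (Inl ` D \<union> Inr ` Q))"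
    if "finite D" "D \<subseteq> P" "\<And>p p'. p \<in> D \<Longrightarrow> p' \<in> P \<Longrightarrow> p' \<subseteq> p \<Longrightarrow> p' \<in> D" for D
    using that
  proof (induction D rule: finite_psubset_induct)
    case (psubset D)
    show ?case
    proof (cases "D = {}")
      case True then show ?thesis by (simp add: same_homology_refl)
    next
      case False
      then obtain p where p: "p \<in> D" and max: "\<And>p'. p' \<in> D \<Longrightarrow> p \<subseteq> p' \<Longrightarrow> p = p'"
        using finite_has_maximal[OF psubset.hyps] by metis
      define D' where "D' = D - {p}"
      have pP: "p \<in> P" using p psubset.prems(1) by blast
      have IH: "same_homology TYPE('k) 0 (?C (Inr ` Q)) (?C (Inl ` D' \<union> Inr ` Q))"
      proof (rule psubset.IH)
        show "D' \<subset> D" "D' \<subseteq> P" using p psubset.prems(1) by (auto simp: D'_def)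
        show "p'' \<in> D'" if "p' \<in> D'" "p'' \<in> P" "p'' \<subseteq> p'" for p' p''
          using that psubset.prems(2)[of p' p''] max[of p'] by (auto simp: D'_def)
      qed
      \<comment> \<open>\<open>f p\<close> is a cone apex: it lies above the images of the earlier
        elements below \<open>p\<close>, and below every member of \<open>Q\<close> that is adjacent
        to \<open>p\<close>.\<close>
      have "acyclic_complex TYPE('k) (?C {y \<in> Inl ` D' \<union> Inr ` Q. cylinder_rel f (Inl p) y})"
      proof (rule clique_complex_cone[where x = "Inr (f p)", OF _ _ rs(2)])
        show "Inr (f p) \<in> {y \<in> Inl ` D' \<union> Inr ` Q. cylinder_rel f (Inl p) y}"
          using fPQ pP by auto
        fix y assume y: "y \<in> {y \<in> Inl ` D' \<union> Inr ` Q. cylinder_rel f (Inl p) y}"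
        show "cylinder_rel f (Inr (f p)) y"
        proof (cases y)
          case (Inl p')
          then have p': "p' \<in> D'" "comparable p p'" using y by auto
          then have "p' \<subseteq> p" "p' \<in> P" using max[of p'] psubset.prems(1) by (auto simp: D'_def)
          then show ?thesis using mono[OF _ pP] Inl by simp
        qed (use y in auto)
      qed (use fin psubset.hyps in \<open>auto simp: D'_def\<close>)
      from clique_complex_insert[OF _ _ rs this]
      have "same_homology TYPE('k) 0 (?C (Inl ` D' \<union> Inr ` Q)) (?C (insert (Inl p) (Inl ` D' \<union> Inr ` Q)))"
        using fin psubset.hyps by (auto simp: D'_def)
      moreover have "insert (Inl p) (Inl ` D' \<union> Inr ` Q) = Inl ` D \<union> Inr ` Q"
        using p by (auto simp: D'_def)
      ultimately show ?thesis using same_homology_trans0[OF IH] by simp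
    qed
  qed
  have "same_homology TYPE('k) 0 (order_complex P) (?C (Inl ` P \<union> Inr ` Q))"
    using same_homology_trans0[OF inl add_Q[of Q]] fin by blast
  moreover have "same_homology TYPE('k) 0 (order_complex Q) (?C (Inl ` P \<union> Inr ` Q))"
    using same_homology_trans0[OF inr add_P[of P]] fin by blast
  ultimately show ?thesis using same_homology_trans0 same_homology_sym0 by blast
qed

section \<open>A complex and its barycentric subdivision\<close>

lemma sum_set_split: "X = Inl ` (Inl -` X) \<union> Inr ` (Inr -` X)"
proof (rule Set.set_eqI)
  fix z :: "'a + 'b"
  show "z \<in> X \<longleftrightarrow> z \<in> Inl ` (Inl -` X) \<union> Inr ` (Inr -` X)" by (cases z) auto
qed

lemma vimage_Inl_Inr: "Inl -` Inr ` A = {}" "Inr -` Inl ` A = {}" "Inl -` Inl ` A = A" "Inr -` Inr ` A = A"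
  by auto

text \<open>Interpolates between a complex (vertices \<open>Inr v\<close>) and its barycentric subdivision
  (vertices \<open>Inl \<tau>\<close>).\<close>

definition sd_cylinder :: "'a set set \<Rightarrow> 'a set set \<Rightarrow> ('a set + 'a) set set" where
  "sd_cylinder U D = {X. Inl -` X \<in> order_complex U \<and> Inr -` X \<in> D \<and> (\<forall>\<tau>\<in>Inl -` X. Inr -` X \<subseteq> \<tau>)}"

lemma abstract_complex_order: "finite P \<Longrightarrow> abstract_complex (order_complex P)"
  unfolding order_complex_def by (rule abstract_complex_clique)

lemma abstract_complex_sd_cylinder:
  assumes "finite U" "abstract_complex D"
  shows "abstract_complex (sd_cylinder U D)"
proof (rule abstract_complexI)
  have sub: "X \<subseteq> Inl ` U \<union> Inr ` \<Union>D" if "X \<in> sd_cylinder U D" for X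
  proof -
    have "Inl -` X \<subseteq> U" "Inr -` X \<subseteq> \<Union>D"
      using that by (auto simp: sd_cylinder_def order_complex_def clique_complex_def)
    then show ?thesis by (subst sum_set_split) (intro Un_mono image_mono)
  qed
  have fin: "finite (Inl ` U \<union> Inr ` \<Union>D)" using assms abstract_complexD(1) by blast
  show "finite (sd_cylinder U D)"
    by (rule finite_subset[of _ "Pow (Inl ` U \<union> Inr ` \<Union>D)"]) (use sub fin in auto)
  show "finite F" if "F \<in> sd_cylinder U D" for F
    using finite_subset[OF sub[OF that] fin] .
  show "{} \<in> sd_cylinder U D"
    using abstract_complexD(3)[OF assms(2)] by (simp add: sd_cylinder_def order_complex_def clique_complex_def)
  show "Y \<in> sd_cylinder U D" if X: "X \<in> sd_cylinder U D" and "Y \<subseteq> X" for X Y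
  proof -
    have "Inl -` Y \<subseteq> Inl -` X" "Inr -` Y \<subseteq> Inr -` X" using that by auto
    moreover from this have "Inr -` Y \<in> D"
      using X abstract_complexD(4)[OF assms(2), of "Inr -` X" "Inr -` Y"] by (simp add: sd_cylinder_def)
    moreover have "Inl -` Y \<in> order_complex U"
      using X \<open>Inl -` Y \<subseteq> Inl -` X\<close>
        abstract_complexD(4)[OF abstract_complex_order[OF assms(1)], of "Inl -` X" "Inl -` Y"]
      by (simp add: sd_cylinder_def)
    ultimately show ?thesis
      using X unfolding sd_cylinder_def mem_Collect_eq by (meson subset_iff)
  qed
qed

text \<open>The cylinder has \<open>T\<close> at one end and the flags at the other. Flag vertices
  are added to \<open>T\<close> with minimal ones last, and faces of \<open>T\<close> are added to
  the flags with maximal ones last; every step adds a face with acyclic link.\<close>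

lemma same_homology_sd:
  assumes T: "abstract_complex T"
  shows "same_homology TYPE('k::field) 0 T (order_complex (T - {{}}))"
proof -
  have finT: "finite T" using abstract_complexD(2)[OF T] .
  have 1: "sd_cylinder {} T = (`) Inr ` T"
  proof (intro Set.set_eqI iffI)
    fix X assume X: "X \<in> sd_cylinder {} T"
    then have "Inl -` X = {}" "Inr -` X \<in> T" by (auto simp: sd_cylinder_def order_complex_def clique_complex_def)
    moreover have "X = Inl ` (Inl -` X) \<union> Inr ` (Inr -` X)" by (rule sum_set_split)
    ultimately show "X \<in> (`) Inr ` T" by (metis image_empty image_eqI sup_bot_left)
  next
    fix X :: "('a set + 'a) set" assume "X \<in> (`) Inr ` T"
    then obtain \<rho> where "X = Inr ` \<rho>" "\<rho> \<in> T" by auto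
    then show "X \<in> sd_cylinder {} T"
      by (simp add: vimage_Inl_Inr sd_cylinder_def order_complex_def clique_complex_def)
  qed
  have 2: "sd_cylinder U {{}} = (`) Inl ` order_complex U" for U :: "'a set set"
  proof (intro Set.set_eqI iffI)
    fix X assume X: "X \<in> sd_cylinder U {{}}"
    then have "Inr -` X = {}" "Inl -` X \<in> order_complex U" by (auto simp: sd_cylinder_def)
    moreover have "X = Inl ` (Inl -` X) \<union> Inr ` (Inr -` X)" by (rule sum_set_split)
    ultimately show "X \<in> (`) Inl ` order_complex U" by (metis image_empty image_eqI sup_bot_right)
  next
    fix X :: "('a set + 'a) set" assume "X \<in> (`) Inl ` order_complex U"
    then obtain \<rho> where "X = Inl ` \<rho>" "\<rho> \<in> order_complex U" by auto
    then show "X \<in> sd_cylinder U {{}}" by (simp add: vimage_Inl_Inr sd_cylinder_def)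
  qed
  have up: "same_homology TYPE('k) 0 (sd_cylinder {} T) (sd_cylinder U T)"
    if "finite U" "U \<subseteq> T - {{}}" for U
    using that
  proof (induction U rule: finite_psubset_induct)
    case (psubset U)
    show ?case
    proof (cases "U = {}")
      case True then show ?thesis by (simp add: same_homology_refl)
    next
      case False
      then obtain r where r: "r \<in> U" and min: "\<And>r'. r' \<in> U \<Longrightarrow> r' \<subseteq> r \<Longrightarrow> r = r'"
        using finite_has_minimal[OF psubset.hyps] by metis
      have rT: "r \<in> T" "r \<noteq> {}" using r psubset.prems by auto
      \<comment> \<open>In a simplex around \<open>r\<close> all flag members contain
        \<open>r\<close>, which is minimal, and all ordinary vertices lie in \<open>r\<close>. So
        any vertex of \<open>r\<close> is an apex of the link.\<close>
      then obtain v where v: "v \<in> r" by blast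
      have cx: "abstract_complex (sd_cylinder U T)"
        by (rule abstract_complex_sd_cylinder[OF psubset.hyps T])
      have "Inl -` {Inl r :: 'a set + 'a} = {r}" "Inr -` {Inl r :: 'a set + 'a} = {}" by auto
      then have mem: "{Inl r} \<in> sd_cylinder U T"
        using r abstract_complexD(3)[OF T]
        by (simp add: sd_cylinder_def order_complex_def clique_complex_def)
      have del: "deletion (sd_cylinder U T) {Inl r} = sd_cylinder (U - {r}) T"
        unfolding deletion_def sd_cylinder_def order_complex_def clique_complex_def by auto
      have "acyclic_complex TYPE('k) (link (sd_cylinder U T) {Inl r})"
      proof (rule acyclic_cone[OF abstract_complex_link[OF cx mem], where v = "Inr v"])
        fix X assume X: "X \<in> link (sd_cylinder U T) {Inl r}"
        define c where "c = Inl -` X"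
        define \<rho> where "\<rho> = Inr -` X"
        have v1: "Inl -` ({Inl r} \<union> X) = insert r c" "Inr -` ({Inl r} \<union> X) = \<rho>"
          by (auto simp: c_def \<rho>_def)
        have v2: "Inl -` ({Inl r} \<union> insert (Inr v) X) = insert r c"
          "Inr -` ({Inl r} \<union> insert (Inr v) X) = insert v \<rho>"
          by (auto simp: c_def \<rho>_def)
        have X1: "Inl r \<notin> X" "insert r c \<in> order_complex U" "\<rho> \<in> T" "\<forall>\<tau>\<in>insert r c. \<rho> \<subseteq> \<tau>"
          using X unfolding link_altdef sd_cylinder_def mem_Collect_eq v1 by auto
        have "r \<subseteq> \<tau>" if "\<tau> \<in> insert r c" for \<tau>
          using X1(2) that min[of \<tau>] by (auto simp: order_complex_def clique_complex_def)
        then have "\<forall>\<tau>\<in>insert r c. insert v \<rho> \<subseteq> \<tau>" using v X1(4) by blast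
        moreover have "insert v \<rho> \<in> T"
          using abstract_complexD(4)[OF T rT(1), of "insert v \<rho>"] v X1(4) by blast
        ultimately show "insert (Inr v) X \<in> link (sd_cylinder U T) {Inl r}"
          unfolding link_altdef sd_cylinder_def mem_Collect_eq v2 using X1 by auto
      qed
      from same_homology_deletion[OF cx mem this, unfolded del]
      have "same_homology TYPE('k) 0 (sd_cylinder (U - {r}) T) (sd_cylinder U T)" .
      moreover have "same_homology TYPE('k) 0 (sd_cylinder {} T) (sd_cylinder (U - {r}) T)"
        by (rule psubset.IH) (use r psubset.prems in auto)
      ultimately show ?thesis using same_homology_trans0 by blast
    qed
  qed
  let ?U = "T - {{}}"
  have down: "same_homology TYPE('k) 0 (sd_cylinder ?U {{}}) (sd_cylinder ?U D)"
    if "finite D" "D \<subseteq> T" "abstract_complex D" for D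
    using that
  proof (induction D rule: finite_psubset_induct)
    case (psubset D)
    show ?case
    proof (cases "D - {{}} = {}")
      case True
      then have "D = {{}}" using abstract_complexD(3)[OF psubset.prems(2)] by auto
      then show ?thesis by (simp add: same_homology_refl)
    next
      case False
      then obtain \<rho> where \<rho>: "\<rho> \<in> D - {{}}" and max: "\<And>r'. r' \<in> D - {{}} \<Longrightarrow> \<rho> \<subseteq> r' \<Longrightarrow> \<rho> = r'"
        using finite_has_maximal[of "D - {{}}"] psubset.hyps by (metis finite_Diff)
      have max': "\<rho> = r'" if "r' \<in> D" "\<rho> \<subseteq> r'" for r' using max[of r'] that \<rho> by blast
      have cx: "abstract_complex (sd_cylinder ?U D)"
        by (rule abstract_complex_sd_cylinder[OF _ psubset.prems(2)]) (use finT in simp)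
      have mem: "Inr ` \<rho> \<in> sd_cylinder ?U D"
        using \<rho> by (simp add: sd_cylinder_def order_complex_def clique_complex_def vimage_Inl_Inr)
      have sub: "Inr ` \<rho> \<subseteq> X \<longleftrightarrow> \<rho> \<subseteq> Inr -` X" for X :: "('a set + 'a) set" by auto
      have del: "deletion (sd_cylinder ?U D) (Inr ` \<rho>) = sd_cylinder ?U (D - {\<rho>})"
      proof -
        have np: "S \<in> D - {\<rho>} \<longleftrightarrow> S \<in> D \<and> \<not> \<rho> \<subseteq> S" for S using max'[of S] by auto
        show ?thesis unfolding deletion_def sd_cylinder_def sub mem_Collect_eq np
          by (rule Collect_cong) argo
      qed
      have cxD: "abstract_complex (D - {\<rho>})"
      proof (rule abstract_complexI)
        show "G \<in> D - {\<rho>}" if "F \<in> D - {\<rho>}" "G \<subseteq> F" for F G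
          using that max'[of F] abstract_complexD(4)[OF psubset.prems(2), of F G] by auto
      qed (use \<rho> psubset.hyps abstract_complexD(3,5)[OF psubset.prems(2)] in auto)
      \<comment> \<open>Maximality of \<open>\<rho>\<close> in \<open>D\<close> leaves no further
        ordinary vertices in this link, only flags above \<open>\<rho>\<close>, and these form a
        cone with apex \<open>\<rho>\<close> as a flag vertex.\<close>
      have "acyclic_complex TYPE('k) (link (sd_cylinder ?U D) (Inr ` \<rho>))"
      proof (rule acyclic_cone[OF abstract_complex_link[OF cx mem], where v = "Inl \<rho>"])
        fix X assume X: "X \<in> link (sd_cylinder ?U D) (Inr ` \<rho>)"
        define c where "c = Inl -` X"
        define \<sigma> where "\<sigma> = Inr -` X"
        have v1: "Inl -` (Inr ` \<rho> \<union> X) = c" "Inr -` (Inr ` \<rho> \<union> X) = \<rho> \<union> \<sigma>"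
          by (auto simp: c_def \<sigma>_def)
        have v2: "Inl -` (Inr ` \<rho> \<union> insert (Inl \<rho>) X) = insert \<rho> c"
          "Inr -` (Inr ` \<rho> \<union> insert (Inl \<rho>) X) = \<rho> \<union> \<sigma>"
          by (auto simp: c_def \<sigma>_def)
        have X1: "X \<inter> Inr ` \<rho> = {}" "c \<in> order_complex ?U" "\<rho> \<union> \<sigma> \<in> D" "\<forall>\<tau>\<in>c. \<rho> \<union> \<sigma> \<subseteq> \<tau>"
          using X unfolding link_altdef sd_cylinder_def mem_Collect_eq v1 by auto
        have eq: "\<rho> \<union> \<sigma> = \<rho>" using max'[OF X1(3)] by blast
        have "insert \<rho> c \<in> order_complex ?U"
          using X1(2,4) \<rho> psubset.prems(1) unfolding eq by (auto simp: order_complex_def clique_complex_def)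
        then show "insert (Inl \<rho>) X \<in> link (sd_cylinder ?U D) (Inr ` \<rho>)"
          unfolding link_altdef sd_cylinder_def mem_Collect_eq v2 using X1 eq by auto
      qed
      from same_homology_deletion[OF cx mem this, unfolded del]
      have "same_homology TYPE('k) 0 (sd_cylinder ?U (D - {\<rho>})) (sd_cylinder ?U D)" .
      moreover have "same_homology TYPE('k) 0 (sd_cylinder ?U {{}}) (sd_cylinder ?U (D - {\<rho>}))"
        by (rule psubset.IH) (use \<rho> psubset.prems cxD in auto)
      ultimately show ?thesis using same_homology_trans0 by blast
    qed
  qed
  have a: "same_homology TYPE('k) 0 T (sd_cylinder ?U T)"
    using same_homology_trans0[OF same_homology_image[of Inr T] up[of ?U, unfolded 1]] finT by simp
  have b: "same_homology TYPE('k) 0 (order_complex ?U) (sd_cylinder ?U T)"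
    using same_homology_trans0[OF same_homology_image[of Inl "order_complex ?U"] down[of T, unfolded 2]] finT T
    by simp
  show ?thesis using same_homology_trans0[OF a same_homology_sym0[OF b]] .
qed

section \<open>Sign vectors of convex sets\<close>

text \<open>Zero signs are omitted, so inclusion is the face order of the hyperplane arrangement: a
  zero may become either sign, and all other signs are kept.\<close>

definition sign_vector :: "('v \<Rightarrow> real) set \<Rightarrow> 'v \<Rightarrow> (('v \<Rightarrow> real) \<times> bool) set" where
  "sign_vector A x = {(f, b). f \<in> A \<and> (if b then 0 < f x else f x < 0)}"

lemma sign_vector_subset_iff:
  "sign_vector A x \<subseteq> sign_vector A y
    \<longleftrightarrow> (\<forall>f\<in>A. (0 < f x \<longrightarrow> 0 < f y) \<and> (f x < 0 \<longrightarrow> f y < 0))"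
  unfolding sign_vector_def by (auto simp: subset_iff split: if_splits)

lemma finite_sign_vectors:
  assumes "finite A" shows "finite (sign_vector A ` Y)"
  by (rule finite_subset[of _ "Pow (A \<times> UNIV)"]) (use assms in \<open>auto simp: sign_vector_def\<close>)

lemma convex_positive_perturbation:
  fixes a b :: real assumes "0 < a"
  obtains t where "0 < t" "t < 1" "0 < (1 - t) * a + t * b"
proof -
  define S where "S = a + \<bar>b\<bar>"
  \<comment> \<open>With this \<open>t\<close> the value drops by at most
    \<open>t * S = a / 2\<close>.\<close>
  define t where "t = a / (2 * S)"
  have S: "0 < S" "a \<le> S" using assms by (auto simp: S_def)
  have t: "0 < t" "t < 1" "t * S = a / 2" using assms S by (auto simp: t_def divide_simps)
  have "t * b \<ge> t * (- \<bar>b\<bar>)" using t(1) by (intro mult_left_mono) auto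
  then have "(1 - t) * a + t * b \<ge> a - t * S" by (simp add: S_def algebra_simps)
  then show thesis using that[OF t(1,2)] t(3) assms by simp
qed

text \<open>The point \<open>r\<close> is chosen on the segment from \<open>p\<close> to \<open>q\<close>, close to \<open>p\<close>.\<close>

lemma sign_vector_perturbation:
  fixes p q :: "'v::real_vector"
  assumes lin: "\<And>f. f \<in> insert h A \<Longrightarrow> linear f" and Y: "convex Y" "p \<in> Y" "q \<in> Y"
    and le: "sign_vector A p \<subseteq> sign_vector A q"
  obtains r where "r \<in> Y" "sign_vector A r = sign_vector A q"
    "sign_vector (insert h A) p \<subseteq> sign_vector (insert h A) r"
proof -
  have "\<exists>t. 0 < t \<and> t < 1 \<and> (0 < h p \<longrightarrow> 0 < (1 - t) * h p + t * h q)
      \<and> (h p < 0 \<longrightarrow> (1 - t) * h p + t * h q < 0)"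
  proof (cases "h p" "0 :: real" rule: linorder_cases)
    case less
    then obtain t where "0 < t" "t < 1" "0 < (1 - t) * (- h p) + t * (- h q)"
      using convex_positive_perturbation[of "- h p" "- h q"] by auto
    then show ?thesis using less by (intro exI[of _ t]) (auto simp: algebra_simps)
  next
    case equal then show ?thesis by (intro exI[of _ "1/2"]) simp
  next
    case greater
    then obtain t where "0 < t" "t < 1" "0 < (1 - t) * h p + t * h q"
      using convex_positive_perturbation[of "h p" "h q"] by auto
    then show ?thesis using greater by (intro exI[of _ t]) auto
  qed
  then obtain t where t: "0 < t" "t < 1" "0 < h p \<Longrightarrow> 0 < (1 - t) * h p + t * h q"
    "h p < 0 \<Longrightarrow> (1 - t) * h p + t * h q < 0" by blast
  define r where "r = (1 - t) *\<^sub>R p + t *\<^sub>R q"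
  have fr: "f r = (1 - t) * f p + t * f q" if "f \<in> insert h A" for f
    using lin[OF that] by (simp add: r_def linear_add linear_cmul)
  \<comment> \<open>For functionals in \<open>A\<close> every \<open>t\<close> strictly between 0
    and 1 works: where such a functional is nonzero at \<open>p\<close> it has the same sign at
    \<open>q\<close>, so it has the sign of \<open>q\<close> at every point after \<open>p\<close>.
    Only \<open>h\<close> forces \<open>t\<close> to be small.\<close>
  have fA: "0 < f r \<longleftrightarrow> 0 < f q" "f r < 0 \<longleftrightarrow> f q < 0" if f: "f \<in> A" for f
  proof -
    have sgn: "0 < f p \<Longrightarrow> 0 < f q" "f p < 0 \<Longrightarrow> f q < 0"
      using le f by (auto simp: sign_vector_subset_iff)
    have fr': "f r = (1 - t) * f p + t * f q" using fr f by simp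
    have tq: "0 < f q \<Longrightarrow> 0 < t * f q" "f q < 0 \<Longrightarrow> t * f q < 0"
      using t by (simp_all add: mult_pos_neg)
    have tp: "0 \<le> f p \<Longrightarrow> 0 \<le> (1 - t) * f p" "f p \<le> 0 \<Longrightarrow> (1 - t) * f p \<le> 0"
      using t by (simp_all add: mult_nonneg_nonpos)
    have "(0 < f r \<longleftrightarrow> 0 < f q) \<and> (f r < 0 \<longleftrightarrow> f q < 0)"
    proof (cases "f q" "0 :: real" rule: linorder_cases)
      case less
      then have "f p \<le> 0" using sgn by force
      then have "f r < 0" using tp tq less fr' by linarith
      then show ?thesis using less by auto
    next
      case equal
      then have "f p = 0" using sgn by force
      then show ?thesis using equal fr' by auto
    next
      case greater
      then have "f p \<ge> 0" using sgn by force
      then have "f r > 0" using tp tq greater fr' by linarith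
      then show ?thesis using greater by auto
    qed
    then show "0 < f r \<longleftrightarrow> 0 < f q" "f r < 0 \<longleftrightarrow> f q < 0" by auto
  qed
  show thesis
  proof
    show "r \<in> Y" unfolding r_def using Y t by (simp add: convexD)
    show "sign_vector A r = sign_vector A q"
      by (intro equalityI) (simp_all add: sign_vector_subset_iff fA)
    show "sign_vector (insert h A) p \<subseteq> sign_vector (insert h A) r"
      unfolding sign_vector_subset_iff
    proof (intro ballI conjI impI)
      fix f assume f: "f \<in> insert h A"
      show "0 < f r" if "0 < f p"
      proof (cases "f = h")
        case True then show ?thesis using t(3) that fr[OF f] by simp
      next
        case False
        then have "f \<in> A" using f by simp
        then show ?thesis using fA(1) le that by (auto simp: sign_vector_subset_iff)
      qed
      show "f r < 0" if "f p < 0"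
      proof (cases "f = h")
        case True then show ?thesis using t(4) that fr[OF f] by simp
      next
        case False
        then have "f \<in> A" using f by simp
        then show ?thesis using fA(2) le that by (auto simp: sign_vector_subset_iff)
      qed
    qed
  qed
qed

lemma convex_sign_class:
  fixes x y :: "'v::real_vector"
  assumes lin: "\<And>f. f \<in> A \<Longrightarrow> linear f" and "sign_vector A x = q" "sign_vector A y = q"
    and t: "0 < t" "t < (1::real)"
  shows "sign_vector A ((1 - t) *\<^sub>R x + t *\<^sub>R y) = q"
proof -
  have sgn: "0 < f x \<longleftrightarrow> 0 < f y" "f x < 0 \<longleftrightarrow> f y < 0" if "f \<in> A" for f
    using assms(2,3) sign_vector_subset_iff[of A x y] sign_vector_subset_iff[of A y x] that by auto
  have "(0 < f ((1 - t) *\<^sub>R x + t *\<^sub>R y) \<longleftrightarrow> 0 < f x) \<and> (f ((1 - t) *\<^sub>R x + t *\<^sub>R y) < 0 \<longleftrightarrow> f x < 0)"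
    if f: "f \<in> A" for f
  proof -
    have e: "f ((1 - t) *\<^sub>R x + t *\<^sub>R y) = (1 - t) * f x + t * f y"
      using lin[OF f] by (simp add: linear_add linear_cmul)
    show ?thesis
    proof (cases "f x" "0 :: real" rule: linorder_cases)
      case less
      then have "(1 - t) * f x < 0" "t * f y < 0" using sgn[OF f] t by (simp_all add: mult_pos_neg)
      then show ?thesis using less unfolding e by auto
    next
      case equal
      then have "f y = 0" using sgn[OF f] by auto
      then show ?thesis using equal unfolding e by simp
    next
      case greater
      then have "(1 - t) * f x > 0" "t * f y > 0" using sgn[OF f] t by simp_all
      then show ?thesis using greater unfolding e by auto
    qed
  qed
  then have "sign_vector A ((1 - t) *\<^sub>R x + t *\<^sub>R y) = sign_vector A x"
    by (intro equalityI) (simp_all add: sign_vector_subset_iff)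
  then show ?thesis using assms(2) by simp
qed

text \<open>Forgetting \<open>h\<close> is a monotone map, so the fibre lemma reduces the claim to
  its fibres. By perturbation every vector in the fibre below \<open>q\<close> lies under a vector
  over \<open>q\<close> itself, and there are at most three of these: \<open>h\<close> positive,
  zero or negative.\<close>

lemma sign_vectors_convex_acyclic:
  fixes Y :: "'v::real_vector set"
  assumes "finite A" "\<And>f. f \<in> A \<Longrightarrow> linear f" "convex Y" "Y \<noteq> {}"
  shows "acyclic_complex TYPE('k::field) (order_complex (sign_vector A ` Y))"
  using assms(1,2)
proof (induction A rule: finite_induct)
  case empty
  have "sign_vector {} ` Y = {{}}" using assms(4) by (auto simp: sign_vector_def)
  then show ?case using order_complex_cone[of "{{}}" "{}"] by simp
next
  case (insert h A)
  define sv where "sv = sign_vector (insert h A)"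
  define g where "g z = {(f, b). (f, b) \<in> z \<and> f \<noteq> h}" for z :: "(('v \<Rightarrow> real) \<times> bool) set"
  have gs: "g (sv x) = sign_vector A x" for x
    using insert.hyps(2) by (auto simp: g_def sv_def sign_vector_def)
  have fin: "finite (sv ` Y)" "finite (sign_vector A ` Y)"
    unfolding sv_def by (rule finite_sign_vectors; simp add: insert.hyps)+
  have svx: "sv x = sign_vector A x \<union> (if 0 < h x then {(h, True)} else if h x < 0 then {(h, False)} else {})" for x
    using insert.hyps(2) by (auto simp: sv_def sign_vector_def split: if_splits)
  have fibre: "acyclic_complex TYPE('k) (order_complex {z \<in> sv ` Y. g z \<subseteq> q})"
    if q: "q \<in> sign_vector A ` Y" for q
  proof -
    let ?F = "{z \<in> sv ` Y. g z \<subseteq> q}"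
    have finF: "finite ?F" using fin by simp
    obtain q' where q': "q' \<in> Y" "q = sign_vector A q'" using q by blast
    have hq: "(h, b) \<notin> q" for b using insert.hyps(2) by (auto simp: q'(2) sign_vector_def)
    have top: "\<exists>r\<in>Y. sign_vector A r = q \<and> z \<subseteq> sv r" if z: "z \<in> ?F" for z
    proof -
      obtain p where p: "p \<in> Y" "z = sv p" "sign_vector A p \<subseteq> sign_vector A q'"
        using z gs q'(2) by auto
      obtain r where "r \<in> Y" "sign_vector A r = sign_vector A q'" "sv p \<subseteq> sv r"
        using sign_vector_perturbation[OF insert.prems assms(3) p(1) q'(1) p(3)] unfolding sv_def by metis
      then show ?thesis using p q' by blast
    qed
    have mem: "sv r \<in> ?F" if "r \<in> Y" "sign_vector A r = q" for r using that gs by auto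
    show ?thesis
    proof (cases "(\<exists>x\<in>Y. sign_vector A x = q \<and> 0 < h x) \<and> (\<exists>x\<in>Y. sign_vector A x = q \<and> h x < 0)")
      case False
      \<comment> \<open>As \<open>h\<close> does not take both signs over \<open>q\<close>, one
        vector over \<open>q\<close> contains the others and is the greatest element of the
        fibre.\<close>
      obtain m where m: "m \<in> Y" "sign_vector A m = q"
        "\<And>r. r \<in> Y \<Longrightarrow> sign_vector A r = q \<Longrightarrow> sv r \<subseteq> sv m"
      proof (cases "\<exists>x\<in>Y. sign_vector A x = q \<and> h x \<noteq> 0")
        case True
        then obtain m where m: "m \<in> Y" "sign_vector A m = q" "h m \<noteq> 0" by blast
        have "sv r \<subseteq> sv m" if r: "r \<in> Y" "sign_vector A r = q" for r
        proof -
          have "0 < h r \<longrightarrow> 0 < h m" "h r < 0 \<longrightarrow> h m < 0"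
                using False m r linorder_neqE_linordered_idom by metis+
          then show ?thesis unfolding svx m(2) r(2) by (intro Un_mono) (auto split: if_split)
        qed
        then show thesis using that m by blast
      next
        case False
        have "sv r = q" if "r \<in> Y" "sign_vector A r = q" for r
        proof -
          have "h r = 0" using False that by blast
          then show ?thesis by (simp add: svx that(2))
        qed
        then show thesis using that[of q'] q' by simp
      qed
      show ?thesis
      proof (rule order_complex_cone[OF finF mem[OF m(1,2)]])
        show "comparable (sv m) y" if "y \<in> ?F" for y using top[OF that] m(3) by blast
      qed
    next
      case True
      then obtain x y where x: "x \<in> Y" "sign_vector A x = q" "0 < h x"
        and y: "y \<in> Y" "sign_vector A y = q" "h y < 0" by blast
      \<comment> \<open>The zero of \<open>h\<close> on the segment from \<open>x\<close> to
        \<open>y\<close>. By convexity this point lies over \<open>q\<close> as well, so all three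
        vectors over \<open>q\<close> occur.\<close>
      define t where "t = h x / (h x - h y)"
      define w where "w = (1 - t) *\<^sub>R x + t *\<^sub>R y"
      have t: "0 < t" "t < 1" using x(3) y(3) by (auto simp: t_def divide_simps)
      have w: "w \<in> Y" "sign_vector A w = q"
        using convexD[OF assms(3) x(1) y(1)] t convex_sign_class[OF _ x(2) y(2) t] insert.prems
        by (auto simp: w_def)
      have "linear h" using insert.prems by simp
      then have "h w = (1 - t) * h x + t * h y"
        by (simp add: w_def linear_add linear_cmul)
      also have "\<dots> = 0" using x(3) y(3) by (simp add: t_def field_simps)
      finally have hw: "h w = 0" .
      let ?E = "{q, q \<union> {(h, True)}, q \<union> {(h, False)}}"
      have E: "e \<in> ?F" if "e \<in> ?E" for e
      proof -
        have "sv x = q \<union> {(h, True)}" using x(3) by (simp add: svx x(2))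
        moreover have "sv y = q \<union> {(h, False)}" using y(3) by (simp add: svx y(2))
        moreover have "sv w = q" using hw by (simp add: svx w(2))
        ultimately show ?thesis using that mem[OF x(1,2)] mem[OF y(1,2)] mem[OF w]
          by (elim insertE emptyE) simp_all
      qed
      \<comment> \<open>\<open>k\<close> raises the part on \<open>A\<close> to \<open>q\<close> and
        keeps the sign of \<open>h\<close>. The vectors with image below \<open>e\<close> have
        \<open>e\<close> as greatest element, and the three targets form a cone with apex
        \<open>q\<close>.\<close>
      define k where "k z = q \<union> (z \<inter> {(h, True), (h, False)})" for z
      have zk: "z = g z \<union> (z \<inter> {(h, True), (h, False)})" for z
        by (auto simp: g_def)
      have kE: "k z \<in> ?E" if z: "z \<in> ?F" for z
      proof -
        obtain p where "z = sv p" using z by blast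
        then have "\<not> ((h, True) \<in> z \<and> (h, False) \<in> z)" by (auto simp: sv_def sign_vector_def)
        then have "z \<inter> {(h, True), (h, False)} \<in> {{}, {(h, True)}, {(h, False)}}" by blast
        then show ?thesis unfolding k_def by (elim insertE emptyE) simp_all
      qed
      have "same_homology TYPE('k) 0 (order_complex ?F) (order_complex ?E)"
      proof (rule quillen_fibre[OF finF, where f = k])
        show "k ` ?F \<subseteq> ?E" using kE by blast
        show "k p \<subseteq> k p'" if "p \<subseteq> p'" for p p' using that by (auto simp: k_def)
        fix e assume e: "e \<in> ?E"
        show "acyclic_complex TYPE('k) (order_complex {p \<in> ?F. k p \<subseteq> e})"
        proof (rule order_complex_cone)
          show "e \<in> {p \<in> ?F. k p \<subseteq> e}" using E[OF e] e by (auto simp: k_def)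
          fix z assume z: "z \<in> {p \<in> ?F. k p \<subseteq> e}"
          then have "z \<subseteq> e" using zk[of z] unfolding k_def by blast
          then show "comparable e z" ..
        next
          show "finite {p \<in> ?F. k p \<subseteq> e}" using finF by (rule rev_finite_subset) auto
        qed
      qed simp
      moreover have "acyclic_complex TYPE('k) (order_complex ?E)"
        by (rule order_complex_cone[of _ q]) auto
      ultimately show ?thesis using same_homology_acyclic by blast
    qed
  qed
  have "same_homology TYPE('k) 0 (order_complex (sv ` Y)) (order_complex (sign_vector A ` Y))"
  proof (rule quillen_fibre[OF fin, where f = g])
    show "g ` sv ` Y \<subseteq> sign_vector A ` Y" using gs by auto
    show "g p \<subseteq> g p'" if "p \<subseteq> p'" for p p' using that by (auto simp: g_def)
  qed (rule fibre)
  moreover have "acyclic_complex TYPE('k) (order_complex (sign_vector A ` Y))"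
    using insert by simp
  ultimately show ?case using same_homology_acyclic unfolding sv_def by blast
qed

section \<open>Stratified point sets\<close>

definition stratified :: "('v::real_vector \<Rightarrow> real) set \<Rightarrow> 'v set \<Rightarrow> 'b set set \<Rightarrow> ('v \<Rightarrow> 'b set) \<Rightarrow> bool" where
  "stratified A X T s \<longleftrightarrow> (\<forall>x\<in>X. s x \<in> T - {{}}) \<and>
     (\<forall>x\<in>X. \<forall>y\<in>X. sign_vector A x \<subseteq> sign_vector A y \<longrightarrow> s x \<subseteq> s y) \<and>
     (\<forall>\<tau>\<in>T - {{}}. convex {x\<in>X. s x \<subseteq> \<tau>} \<and> {x\<in>X. s x \<subseteq> \<tau>} \<noteq> {})"

text \<open>Monotonicity makes \<open>s\<close> constant on sign classes, so it descends to a map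
  from sign vectors to nonempty faces. Its fibres are the sign vectors of the closed strata, which
  are convex, and the fibre lemma applies; \<open>same_homology_sd\<close> then removes the
  subdivision.\<close>

lemma stratified_homology:
  assumes A: "finite A" "\<And>f. f \<in> A \<Longrightarrow> linear f" and T: "abstract_complex T"
    and st: "stratified A X T s"
  shows "same_homology TYPE('k::field) 0 (order_complex (sign_vector A ` X)) T"
proof -
  have le: "\<And>x y. x \<in> X \<Longrightarrow> y \<in> X \<Longrightarrow> sign_vector A x \<subseteq> sign_vector A y \<Longrightarrow> s x \<subseteq> s y"
    using st unfolding stratified_def by blast
  define f where "f z = s (SOME x. x \<in> X \<and> sign_vector A x = z)" for z
  have f: "f (sign_vector A x) = s x" if x: "x \<in> X" for x
  proof -
    define y where "y = (SOME y. y \<in> X \<and> sign_vector A y = sign_vector A x)"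
    have y: "y \<in> X \<and> sign_vector A y = sign_vector A x"
      unfolding y_def by (rule someI[of _ x]) (use x in simp)
    have "s y = s x" using y x by (intro equalityI le) simp_all
    then show ?thesis unfolding f_def y_def .
  qed
  have "same_homology TYPE('k) 0 (order_complex (sign_vector A ` X)) (order_complex (T - {{}}))"
  proof (rule quillen_fibre[where f = f])
    show "finite (sign_vector A ` X)" by (rule finite_sign_vectors[OF A(1)])
    show "finite (T - {{}})" using abstract_complexD(2)[OF T] by simp
    show "f ` sign_vector A ` X \<subseteq> T - {{}}"
      using st f unfolding stratified_def by auto
    show "f p \<subseteq> f p'" if pp: "p \<in> sign_vector A ` X" "p' \<in> sign_vector A ` X" "p \<subseteq> p'" for p p'
    proof -
      obtain x y where "x \<in> X" "y \<in> X" "p = sign_vector A x" "p' = sign_vector A y" using pp by blast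
      then show ?thesis using le[of x y] pp(3) by (simp add: f)
    qed
    fix \<tau> assume \<tau>: "\<tau> \<in> T - {{}}"
    have "{p \<in> sign_vector A ` X. f p \<subseteq> \<tau>} = sign_vector A ` {x \<in> X. s x \<subseteq> \<tau>}"
      using f by auto
    then show "acyclic_complex TYPE('k) (order_complex {p \<in> sign_vector A ` X. f p \<subseteq> \<tau>})"
      using sign_vectors_convex_acyclic[OF A, of "{x \<in> X. s x \<subseteq> \<tau>}"] st \<tau>
      unfolding stratified_def by simp
  qed
  then show ?thesis using same_homology_trans0 same_homology_sym0[OF same_homology_sd[OF T]] by blast
qed

text \<open>The closed stratum of a face in \<open>B\<close> only involves faces of
  \<open>B\<close>, so cutting \<open>X\<close> down leaves it unchanged.\<close>

lemma stratified_subcomplex: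
  assumes "stratified A X T s" "B \<subseteq> T" "abstract_complex B"
  shows "stratified A {x \<in> X. s x \<in> B} B s"
proof -
  have "{x \<in> {x \<in> X. s x \<in> B}. s x \<subseteq> \<tau>} = {x \<in> X. s x \<subseteq> \<tau>}" if "\<tau> \<in> B" for \<tau>
    using abstract_complexD(4)[OF assms(3) that] by auto
  note eq = this
  show ?thesis unfolding stratified_def
  proof (intro conjI ballI impI)
    fix \<tau> assume \<tau>: "\<tau> \<in> B - {{}}"
    then have "\<tau> \<in> T - {{}}" using assms(2) by blast
    then show "convex {x \<in> {x \<in> X. s x \<in> B}. s x \<subseteq> \<tau>}" "{x \<in> {x \<in> X. s x \<in> B}. s x \<subseteq> \<tau>} \<noteq> {}"
      using assms(1) eq[of \<tau>] \<tau> unfolding stratified_def by auto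
  qed (use assms(1) in \<open>auto simp: stratified_def\<close>)
qed

text \<open>The common middle term is the order complex of the sign vectors of \<open>X\<close>,
  with one \<open>A\<close> fine enough for both stratifications.\<close>

lemma two_stratifications:
  assumes "finite A" "\<And>f. f \<in> A \<Longrightarrow> linear f" "abstract_complex T" "abstract_complex M"
    "stratified A X T s" "stratified A X M s'"
  shows "same_homology TYPE('k::field) 0 T M"
  using same_homology_trans0[OF same_homology_sym0[OF stratified_homology[OF assms(1-3,5)]]
    stratified_homology[OF assms(1,2,4,6)]] .

section \<open>Homology of the model complexes\<close>

definition sphere_homology :: "'k::field itself \<Rightarrow> int \<Rightarrow> 'a set set \<Rightarrow> bool" where
  "sphere_homology k d \<Delta> \<longleftrightarrow>
     (\<forall>i. if i = d then homology_field k \<Delta> i else homology_zero k \<Delta> i)"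

lemma sphere_homology_shift:
  assumes "same_homology k s \<Delta> \<Gamma>" "sphere_homology k (d + s) \<Gamma>" shows "sphere_homology k d \<Delta>"
  using assms unfolding sphere_homology_def same_homology_def by (metis add_right_cancel)

lemma sphere_homology_empty_face: "sphere_homology TYPE('k::field) (- 1) {{}}"
proof -
  have c0: "c xs = 0" if "c \<in> chains {{} :: 'a set} i" "xs \<noteq> [] \<or> i \<noteq> - 1"
    for c :: "'a list \<Rightarrow> 'k" and xs i
    using chainsD(1)[OF that(1), of xs] that(2) by (cases "c xs = 0") (auto simp: face_dim_def)
  have zero: "homology_zero TYPE('k) {{} :: 'a set} i" if "i \<noteq> - 1" for i
    unfolding homology_zero_iff
  proof
    fix c :: "'a list \<Rightarrow> 'k" assume "c \<in> cycles {{}} i"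
    then have "c = (\<lambda>_. 0)" using c0 that by (auto simp: cycles_def)
    then show "c \<in> boundaries {{}} i" using boundaries_zero by simp
  qed
  have "homology_field TYPE('k) {{} :: 'a set} (- 1)"
    unfolding homology_field_iff
  proof (intro exI[of _ "\<lambda>c. c []"] conjI ballI)
    show "linear_on_cycles {{} :: 'a set} (- 1) (\<lambda>c. c [] :: 'k)" by (simp add: linear_on_cycles_def)
  next
    fix c :: "'a list \<Rightarrow> 'k" assume c: "c \<in> cycles {{}} (- 1)"
    show "c [] = 0 \<longleftrightarrow> c \<in> boundaries {{}} (- 1)"
    proof
      assume "c [] = 0"
      then have "c xs = 0" for xs using c0[of c "- 1" xs] c by (cases xs) (auto simp: cycles_def)
      then have "c = (\<lambda>_. 0)" by blast
      then show "c \<in> boundaries {{}} (- 1)" using boundaries_zero by simp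
    next
      assume "c \<in> boundaries {{}} (- 1)"
      then obtain d where "c = boundary_map {{}} d" by (rule boundariesD)
      then show "c [] = 0" by (simp add: boundary_map_def)
    qed
  next
    show "\<exists>c\<in>cycles {{} :: 'a set} (- 1). c [] \<noteq> (0 :: 'k)"
      by (rule bexI[of _ "\<lambda>xs. if xs = [] then 1 else 0"])
        (auto simp: cycles_def chains_def boundary_map_def face_dim_def)
  qed
  then show ?thesis using zero by (simp add: sphere_homology_def)
qed

text \<open>The join of the boundary of the cross-polytope on \<open>E\<close> with the simplex on \<open>J\<close>, and
  with the boundary of that simplex.\<close>

definition cross_simplex :: "'v set \<Rightarrow> 'v set \<Rightarrow> ('v \<times> bool) set set" where
  "cross_simplex E J = {U. U \<subseteq> (E \<union> J) \<times> UNIV \<and> (\<forall>w. \<not> ((w, True) \<in> U \<and> (w, False) \<in> U))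
     \<and> (\<forall>w\<in>J. (w, False) \<notin> U)}"

definition cross_simplex_boundary :: "'v set \<Rightarrow> 'v set \<Rightarrow> ('v \<times> bool) set set" where
  "cross_simplex_boundary E J = {U \<in> cross_simplex E J. \<not> J \<times> {True} \<subseteq> U}"

lemma abstract_complex_cross_simplex:
  assumes "finite E" "finite J" shows "abstract_complex (cross_simplex E J)"
proof (rule abstract_complexI)
  have fin: "finite ((E \<union> J) \<times> (UNIV :: bool set))" using assms by simp
  show "finite (cross_simplex E J)"
    by (rule finite_subset[of _ "Pow ((E \<union> J) \<times> UNIV)"]) (use fin in \<open>auto simp: cross_simplex_def\<close>)
  show "finite F" if "F \<in> cross_simplex E J" for F
    using that finite_subset[OF _ fin] by (auto simp: cross_simplex_def)
qed (auto simp: cross_simplex_def)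

lemma abstract_complex_cross_simplex_boundary:
  assumes "finite E" "finite J" "J \<noteq> {}" shows "abstract_complex (cross_simplex_boundary E J)"
  using abstract_complex_deletion[OF abstract_complex_cross_simplex[OF assms(1,2)], of "J \<times> {True}"] assms(3)
  by (simp add: cross_simplex_boundary_def deletion_def)

text \<open>Each axis is a suspension: without the pole \<open>(w, True)\<close> the complex is a
  cone with apex \<open>(w, False)\<close>, and the link of the pole is the cross-polytope on
  \<open>E\<close>.\<close>

lemma cross_polytope_sphere:
  assumes "finite E"
  shows "sphere_homology TYPE('k::field) (int (card E) - 1) (cross_simplex E {})"
  using assms
proof (induction E rule: finite_induct)
  case empty
  have "cross_simplex {} {} = {{} :: ('a \<times> bool) set}" by (auto simp: cross_simplex_def)
  then show ?case using sphere_homology_empty_face by simp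
next
  case (insert w E)
  let ?K = "cross_simplex (insert w E) {}"
  have cx: "abstract_complex ?K" using insert.hyps by (simp add: abstract_complex_cross_simplex)
  have mem: "{(w, True)} \<in> ?K" by (auto simp: cross_simplex_def)
  have "acyclic_complex TYPE('k) (deletion ?K {(w, True)})"
    by (rule acyclic_cone[OF abstract_complex_deletion[OF cx], where v = "(w, False)"])
      (auto simp: deletion_def cross_simplex_def)
  from same_homology_link[OF cx mem this]
  have "same_homology TYPE('k) (- 1) ?K (link ?K {(w, True)})" by simp
  moreover have "link ?K {(w, True)} = cross_simplex E {}"
  proof (intro Set.set_eqI iffI)
    fix U assume U: "U \<in> link ?K {(w, True)}"
    have "p \<in> E \<times> UNIV" if "p \<in> U" for p
    proof -
      obtain v b where p: "p = (v, b)" by (cases p)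
      have "v \<noteq> w" using U that p by (cases b) (auto simp: link_altdef cross_simplex_def)
      then show ?thesis using U that p by (auto simp: link_altdef cross_simplex_def)
    qed
    then show "U \<in> cross_simplex E {}" using U by (auto simp: link_altdef cross_simplex_def)
  next
    fix U assume "U \<in> cross_simplex E {}"
    then show "U \<in> link ?K {(w, True)}" using insert.hyps(2)
      by (auto simp: link_altdef cross_simplex_def)
  qed
  ultimately show ?case
    using sphere_homology_shift[of "TYPE('k)" "- 1" ?K "cross_simplex E {}" "int (card E)"] insert by simp
qed

lemma cross_simplex_acyclic:
  assumes "finite E" "finite J" "j \<in> J"
  shows "acyclic_complex TYPE('k::field) (cross_simplex E J)"
  by (rule acyclic_cone[OF abstract_complex_cross_simplex[OF assms(1,2)], where v = "(j, True)"])
    (use assms(3) in \<open>auto simp: cross_simplex_def\<close>)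

text \<open>The face \<open>\<rho>\<close> is the facet opposite \<open>j\<close> of the simplex on
  \<open>J\<close>. Its deletion is a cone with apex \<open>(j, True)\<close>, since this vertex
  cannot complete \<open>\<rho>\<close>, and so cannot complete the whole simplex either. Its link
  is the cross-polytope on \<open>E\<close>.\<close>

lemma cross_simplex_boundary_sphere:
  assumes fin: "finite E" "finite J" and j: "j \<in> J" and disj: "E \<inter> J = {}"
  shows "sphere_homology TYPE('k::field) (int (card E) + int (card J) - 2) (cross_simplex_boundary E J)"
proof -
  let ?K = "cross_simplex_boundary E J"
  define \<rho> where "\<rho> = (J - {j}) \<times> {True}"
  have card: "int (card J) = int (card \<rho>) + 1"
    using card_Suc_Diff1[OF fin(2) j] by (simp add: \<rho>_def card_cartesian_product)
  have cx: "abstract_complex ?K"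
    using abstract_complex_cross_simplex_boundary[OF fin] j by blast
  have mem: "\<rho> \<in> ?K"
    using j by (auto simp: \<rho>_def cross_simplex_boundary_def cross_simplex_def)
  have link: "link ?K \<rho> = cross_simplex E {}"
  proof (intro Set.set_eqI iffI)
    fix U assume U: "U \<in> link ?K \<rho>"
    have "p \<in> E \<times> UNIV" if "p \<in> U" for p
    proof -
      obtain v b where p: "p = (v, b)" by (cases p)
      have "(v, b) \<in> (E \<union> J) \<times> UNIV" "v \<in> J \<Longrightarrow> b"
        using U that p by (auto simp: link_altdef cross_simplex_boundary_def cross_simplex_def)
      moreover have "(v, True) \<notin> U" if "v \<in> J" for v
      proof (cases "v = j")
        case True
        have "J \<times> {True} \<subseteq> \<rho> \<union> U" if "(j, True) \<in> U" using that by (auto simp: \<rho>_def)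
        then show ?thesis using U True by (auto simp: link_altdef cross_simplex_boundary_def)
      next
        case False
        then show ?thesis using U that by (auto simp: link_altdef \<rho>_def)
      qed
      ultimately show ?thesis using p that by (cases b) auto
    qed
    then show "U \<in> cross_simplex E {}"
      using U by (auto simp: link_altdef cross_simplex_boundary_def cross_simplex_def)
  next
    fix U assume U: "U \<in> cross_simplex E {}"
    then have sub: "U \<subseteq> E \<times> UNIV" by (auto simp: cross_simplex_def)
    then have "(j, True) \<notin> \<rho> \<union> U" using j disj by (auto simp: \<rho>_def)
    then have "\<not> J \<times> {True} \<subseteq> \<rho> \<union> U" using j by blast
    moreover have "\<rho> \<union> U \<in> cross_simplex E J"
      using U disj by (auto simp: cross_simplex_def \<rho>_def)
    moreover have "U \<inter> \<rho> = {}" using sub disj by (auto simp: \<rho>_def)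
    ultimately show "U \<in> link ?K \<rho>"
      by (simp add: link_altdef cross_simplex_boundary_def)
  qed
  show ?thesis
  proof (cases "\<rho> = {}")
    \<comment> \<open>For \<open>J = {j}\<close> the boundary of the simplex is the empty face
      alone, and the complex equals its own link.\<close>
    case True
    then have "?K = cross_simplex E {}" using link by (simp add: link_altdef)
    then show ?thesis using cross_polytope_sphere[OF fin(1)] card True by simp
  next
    case False
    have "acyclic_complex TYPE('k) (deletion ?K \<rho>)"
    proof (rule acyclic_cone[OF abstract_complex_deletion[OF cx False], where v = "(j, True)"])
      fix U assume U: "U \<in> deletion ?K \<rho>"
      have "(j, True) \<notin> \<rho>" by (simp add: \<rho>_def)
      then have "\<not> \<rho> \<subseteq> insert (j, True) U" using U by (auto simp: deletion_def)
      moreover from this have "\<not> J \<times> {True} \<subseteq> insert (j, True) U" by (auto simp: \<rho>_def)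
      moreover have "insert (j, True) U \<in> cross_simplex E J"
        using U j by (auto simp: deletion_def cross_simplex_boundary_def cross_simplex_def)
      ultimately show "insert (j, True) U \<in> deletion ?K \<rho>"
        by (simp add: deletion_def cross_simplex_boundary_def)
    qed
    from same_homology_link[OF cx mem this, unfolded link]
    show ?thesis
      by (rule sphere_homology_shift) (use cross_polytope_sphere[OF fin(1)] card in simp)
  qed
qed

section \<open>Simplicial fans\<close>

text \<open>Coordinates refer to a basis of the whole space. So they are linear everywhere, and
  lying in the span of \<open>B\<close> is itself a condition on signs: the coordinates outside
  \<open>B\<close> vanish.\<close>

definition coef :: "'v::euclidean_space set \<Rightarrow> 'v \<Rightarrow> 'v \<Rightarrow> real" where
  "coef B x b = representation (extend_basis B) x b"

lemma linear_coef:
  assumes "independent B" shows "linear (\<lambda>x. coef B x b)"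
  using independent_extend_basis[OF assms] span_extend_basis[OF assms]
  by (intro linearI) (auto simp: coef_def representation_add representation_scale)

lemma coef_basis:
  assumes "independent B" "c \<in> extend_basis B"
  shows "coef B c b = (if b = c then 1 else 0)"
  using independent_extend_basis[OF assms(1)] assms(2) by (auto simp: coef_def representation_basis)

lemma finite_extend_basis: "independent B \<Longrightarrow> finite (extend_basis (B :: 'v::euclidean_space set))"
  using independent_extend_basis finiteI_independent by blast

lemma coef_sum:
  assumes "independent B"
  shows "coef B (\<Sum>i\<in>I. t i *\<^sub>R g i) b = (\<Sum>i\<in>I. t i * coef B (g i) b)"
  using linear_sum[OF linear_coef[OF assms, of b], of "\<lambda>i. t i *\<^sub>R g i" I]
    linear_cmul[OF linear_coef[OF assms, of b]] by simp

lemma coef_expansion: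
  assumes "independent B"
  shows "(\<Sum>b\<in>extend_basis B. coef B x b *\<^sub>R b) = x"
  unfolding coef_def
  by (rule sum_representation_eq)
    (use assms independent_extend_basis span_extend_basis finite_extend_basis in auto)

lemma coef_span_iff:
  assumes B: "independent B" and S: "S \<subseteq> extend_basis B"
  shows "x \<in> span S \<longleftrightarrow> (\<forall>b\<in>extend_basis B - S. coef B x b = 0)"
proof
  assume x: "x \<in> span S"
  have "coef B x b = representation S x b" for b
    unfolding coef_def using representation_extend[OF independent_extend_basis[OF B] x S] by simp
  then show "\<forall>b\<in>extend_basis B - S. coef B x b = 0"
    using representation_ne_zero[of S x] by auto
next
  assume z: "\<forall>b\<in>extend_basis B - S. coef B x b = 0"
  have "(\<Sum>b\<in>S. coef B x b *\<^sub>R b) = (\<Sum>b\<in>extend_basis B. coef B x b *\<^sub>R b)"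
    by (rule sum.mono_neutral_left[OF finite_extend_basis[OF B] S]) (use z in auto)
  then have "x = (\<Sum>b\<in>S. coef B x b *\<^sub>R b)" using coef_expansion[OF B] by simp
  moreover have "(\<Sum>b\<in>S. coef B x b *\<^sub>R b) \<in> span S"
    by (intro span_sum span_scale span_base)
  ultimately show "x \<in> span S" by metis
qed

lemma coef_expansion_span:
  assumes B: "independent B" and x: "x \<in> span B"
  shows "(\<Sum>b\<in>B. coef B x b *\<^sub>R b) = x"
proof -
  have "(\<Sum>b\<in>B. coef B x b *\<^sub>R b) = (\<Sum>b\<in>extend_basis B. coef B x b *\<^sub>R b)"
    using extend_basis_superset[OF B] coef_span_iff[OF B extend_basis_superset[OF B]] x
    by (intro sum.mono_neutral_left finite_extend_basis[OF B]) auto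
  then show ?thesis using coef_expansion[OF B] by simp
qed

lemma span_image_finite:
  assumes "finite I" "inj_on g I" "x \<in> span (g ` I)"
  obtains c where "x = (\<Sum>i\<in>I. c i *\<^sub>R g i)"
proof -
  obtain u where "x = (\<Sum>v\<in>g ` I. u v *\<^sub>R v)"
    using assms(3) span_finite[OF finite_imageI[OF assms(1)], of g] by auto
  then have "x = (\<Sum>i\<in>I. u (g i) *\<^sub>R g i)" by (simp add: sum.reindex[OF assms(2)])
  then show thesis using that[of "\<lambda>i. u (g i)"] by blast
qed

section \<open>Dimension and boundary read off from homology\<close>

lemma complex_dim_eqI:
  assumes "abstract_complex \<Delta>" "\<And>F. F \<in> \<Delta> \<Longrightarrow> face_dim F \<le> d" "F \<in> \<Delta>" "face_dim F = d"
  shows "complex_dim \<Delta> = d"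
  unfolding complex_dim_def
  by (rule Max_eqI) (use assms abstract_complexD(2) in auto)

text \<open>A nonzero class needs a nonzero chain. Lower bounds for dimensions come from
  this.\<close>

lemma homology_field_face:
  assumes "homology_field TYPE('k::field) \<Delta> i"
  shows "\<exists>F\<in>\<Delta>. face_dim F = i"
proof -
  have "\<not> (cycles \<Delta> i :: ('a list \<Rightarrow> 'k) set) \<subseteq> boundaries \<Delta> i"
    using homology_field_not_zero[OF assms] by (simp add: homology_zero_iff)
  then obtain c :: "'a list \<Rightarrow> 'k" where c: "c \<in> chains \<Delta> i" "c \<notin> boundaries \<Delta> i"
    by (auto simp: cycles_def)
  then have "c \<noteq> (\<lambda>_. 0)" using boundaries_zero by metis
  then obtain xs where "c xs \<noteq> 0" by blast
  then show ?thesis using chainsD(1)[OF c(1)] by blast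
qed

lemma sphere_homology_dim:
  assumes "sphere_homology TYPE('k::field) d \<Delta>" "abstract_complex \<Delta>" "\<And>F. F \<in> \<Delta> \<Longrightarrow> face_dim F \<le> d"
  shows "complex_dim \<Delta> = d"
proof -
  have "homology_field TYPE('k) \<Delta> d" using assms(1) by (simp add: sphere_homology_def)
  then show ?thesis using homology_field_face complex_dim_eqI[OF assms(2,3)] by blast
qed

text \<open>\<open>homology_field\<close> and \<open>homology_zero\<close> exclude each other in top
  degree, so membership in a boundary is decided by the complex alone.\<close>

lemma homology_ball_boundary_unique:
  assumes B: "homology_ball_with_boundary TYPE('k::field) \<Delta> B"
  shows "ball_boundary TYPE('k) \<Delta> = B"
proof -
  have eq: "C = {F \<in> \<Delta>. homology_zero TYPE('k) (link \<Delta> F) (complex_dim (link \<Delta> F))}"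
    if C: "homology_ball_with_boundary TYPE('k) \<Delta> C" for C
  proof -
    have sub: "C \<subseteq> \<Delta>" using C by (simp add: homology_ball_with_boundary_def)
    have "F \<in> C \<longleftrightarrow> homology_zero TYPE('k) (link \<Delta> F) (complex_dim (link \<Delta> F))" if F: "F \<in> \<Delta>" for F
    proof -
      have "if F \<notin> C then homology_field TYPE('k) (link \<Delta> F) (complex_dim (link \<Delta> F))
          else homology_zero TYPE('k) (link \<Delta> F) (complex_dim (link \<Delta> F))"
        using C F unfolding homology_ball_with_boundary_def by presburger
      then show ?thesis using homology_field_not_zero by (auto split: if_splits)
    qed
    then show ?thesis using sub by blast
  qed
  show ?thesis unfolding ball_boundary_def
    by (rule the_equality[where P = "homology_ball_with_boundary TYPE('k) \<Delta>", OF B])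
      (use eq[OF B] eq in simp)
qed

text \<open>The cone over a triangulated simplex: a simplicial fan with rays \<open>\<Psi> v\<close> subdividing the
  simplicial cone spanned by the linearly independent vectors \<open>\<Phi> a\<close>.\<close>

locale simplex_fan =
  fixes F :: "'a set" and \<Phi> :: "'a \<Rightarrow> 'v::euclidean_space"
    and T :: "'b set set" and \<Psi> :: "'b \<Rightarrow> 'v"
  assumes finF: "finite F" and complex: "abstract_complex T"
    and indep: "independent (\<Phi> ` F)" and inj: "inj_on \<Phi> F"
    and unique: "\<lbrakk>\<tau> \<in> T; \<tau>' \<in> T; \<And>v. v \<in> \<tau> \<Longrightarrow> 0 < a v; \<And>v. v \<in> \<tau>' \<Longrightarrow> 0 < b v;
        (\<Sum>v\<in>\<tau>. a v *\<^sub>R \<Psi> v) = (\<Sum>v\<in>\<tau>'. b v *\<^sub>R \<Psi> v)\<rbrakk> \<Longrightarrow> \<tau> = \<tau>' \<and> (\<forall>v\<in>\<tau>. a v = b v)"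
    and nonneg: "v \<in> \<Union>T \<Longrightarrow> \<exists>t. (\<forall>a\<in>F. 0 \<le> t a) \<and> \<Psi> v = (\<Sum>a\<in>F. t a *\<^sub>R \<Phi> a)"
    and cover: "(\<And>a. a \<in> F \<Longrightarrow> 0 \<le> t a) \<Longrightarrow>
        \<exists>\<tau>\<in>T. \<exists>b. (\<forall>v\<in>\<tau>. 0 < b v) \<and> (\<Sum>a\<in>F. t a *\<^sub>R \<Phi> a) = (\<Sum>v\<in>\<tau>. b v *\<^sub>R \<Psi> v)"
begin

section \<open>Cones of the fan and their relative interiors\<close>

definition crd :: "'v \<Rightarrow> 'a \<Rightarrow> real" where
  "crd x a = coef (\<Phi> ` F) x (\<Phi> a)"

abbreviation V :: "'v set" where "V \<equiv> span (\<Phi> ` F)"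

lemma finT: "\<tau> \<in> T \<Longrightarrow> finite \<tau>" using abstract_complexD(5)[OF complex] .

lemma subT: "\<tau> \<in> T \<Longrightarrow> \<rho> \<subseteq> \<tau> \<Longrightarrow> \<rho> \<in> T" using abstract_complexD(4)[OF complex] .

lemma crd_sum: "crd (\<Sum>i\<in>I. t i *\<^sub>R g i) a = (\<Sum>i\<in>I. t i * crd (g i) a)"
  unfolding crd_def by (rule coef_sum[OF indep])

lemma crd_basis: "a \<in> F \<Longrightarrow> b \<in> F \<Longrightarrow> crd (\<Phi> b) a = (if a = b then 1 else 0)"
  unfolding crd_def
  using coef_basis[OF indep, of "\<Phi> b" "\<Phi> a"] extend_basis_superset[OF indep] inj_on_eq_iff[OF inj]
  by auto

lemma crd_comb: "a \<in> F \<Longrightarrow> crd (\<Sum>b\<in>F. t b *\<^sub>R \<Phi> b) a = t a"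
  unfolding crd_sum using finF by (simp add: crd_basis sum.delta' if_distrib cong: if_cong)

lemma crd_expand: "x \<in> V \<Longrightarrow> x = (\<Sum>a\<in>F. crd x a *\<^sub>R \<Phi> a)"
  using coef_expansion_span[OF indep, of x] by (simp add: sum.reindex[OF inj] crd_def)

lemma ray: assumes "v \<in> \<Union>T"
  shows ray_V: "\<Psi> v \<in> V" and ray_nonneg: "a \<in> F \<Longrightarrow> 0 \<le> crd (\<Psi> v) a"
proof -
  obtain t where t: "\<forall>a\<in>F. 0 \<le> t a" "\<Psi> v = (\<Sum>a\<in>F. t a *\<^sub>R \<Phi> a)" using nonneg[OF assms] by blast
  show "\<Psi> v \<in> V" unfolding t(2) by (intro span_sum span_scale span_base imageI)
  show "0 \<le> crd (\<Psi> v) a" if "a \<in> F" unfolding t(2) crd_comb[OF that] using t(1) that by blast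
qed

text \<open>Uniqueness is assumed for positive combinations. Adding a large constant
  \<open>N\<close> to all coefficients turns a linear relation into an equality between two of
  these.\<close>

lemma comb_zero:
  assumes \<tau>: "\<tau> \<in> T" and z: "(\<Sum>v\<in>\<tau>. c v *\<^sub>R \<Psi> v) = 0" and v: "v \<in> \<tau>"
  shows "c v = 0"
proof -
  define N where "N = 1 + (\<Sum>v\<in>\<tau>. \<bar>c v\<bar>)"
  have le: "\<bar>c v\<bar> < N" if "v \<in> \<tau>" for v
    using member_le_sum[OF that, of "\<lambda>v. \<bar>c v\<bar>"] finT[OF \<tau>] by (simp add: N_def)
  have "(\<Sum>v\<in>\<tau>. (c v + N) *\<^sub>R \<Psi> v) = (\<Sum>v\<in>\<tau>. N *\<^sub>R \<Psi> v)"
    using z by (simp add: scaleR_add_left sum.distrib)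
  moreover have "0 < c v + N" "0 < N" if "v \<in> \<tau>" for v using le[OF that] by linarith+
  ultimately have "\<forall>v\<in>\<tau>. c v + N = N"
    using unique[OF \<tau> \<tau>, of "\<lambda>v. c v + N" "\<lambda>_. N"] by blast
  then show ?thesis using v by simp
qed

lemma comb_unique:
  assumes "\<tau> \<in> T" "(\<Sum>v\<in>\<tau>. c v *\<^sub>R \<Psi> v) = (\<Sum>v\<in>\<tau>. d v *\<^sub>R \<Psi> v)" "v \<in> \<tau>"
  shows "c v = d v"
  using comb_zero[OF assms(1), of "\<lambda>v. c v - d v"] assms(2,3)
  by (simp add: scaleR_diff_left sum_subtractf)

lemma inj_ray: assumes "\<tau> \<in> T" shows "inj_on \<Psi> \<tau>"
proof (rule inj_onI, rule ccontr)
  fix u v assume uv: "u \<in> \<tau>" "v \<in> \<tau>" "\<Psi> u = \<Psi> v" "u \<noteq> v"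
  have "(\<Sum>w\<in>\<tau>. ((if w = u then 1 else 0) - (if w = v then 1 else 0)) *\<^sub>R \<Psi> w) = \<Psi> u - \<Psi> v"
    using uv(1,2) finT[OF assms]
    by (simp add: scaleR_diff_left sum_subtractf if_distrib[of "\<lambda>c. c *\<^sub>R _"] sum.delta cong: if_cong)
  then show False
    using comb_zero[OF assms, of "\<lambda>w. (if w = u then 1 else 0) - (if w = v then 1 else 0)" u] uv by auto
qed

lemma indep_ray: assumes "\<tau> \<in> T" shows "independent (\<Psi> ` \<tau>)"
proof -
  have "u w = 0" if "(\<Sum>w\<in>\<Psi> ` \<tau>. u w *\<^sub>R w) = 0" "w \<in> \<Psi> ` \<tau>" for u w
    using that comb_zero[OF assms, of "\<lambda>v. u (\<Psi> v)"] by (auto simp: sum.reindex[OF inj_ray[OF assms]])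
  then show ?thesis using dependent_finite[of "\<Psi> ` \<tau>"] finT[OF assms] by blast
qed

text \<open>The relatively open cone of \<open>\<tau>\<close> after the directions of
  \<open>\<sigma>\<close> have been made two-sided: a stratum of the tangent cone at
  \<open>\<sigma>\<close>.\<close>

definition in_open :: "'b set \<Rightarrow> 'b set \<Rightarrow> 'v \<Rightarrow> bool" where
  "in_open \<sigma> \<tau> x \<longleftrightarrow> (\<exists>c. (\<forall>v\<in>\<tau> - \<sigma>. 0 < c v) \<and> x = (\<Sum>v\<in>\<tau>. c v *\<^sub>R \<Psi> v))"

text \<open>A large multiple of the sum of the rays of \<open>\<sigma>\<close> makes all
  coefficients positive in both expressions, so that the uniqueness of positive combinations
  applies.\<close>

lemma in_open_unique:
  assumes \<sigma>: "\<sigma> \<subseteq> \<tau>" "\<sigma> \<subseteq> \<tau>'" and T: "\<tau> \<in> T" "\<tau>' \<in> T" and x: "in_open \<sigma> \<tau> x" "in_open \<sigma> \<tau>' x"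
  shows "\<tau> = \<tau>'"
proof -
  obtain c d where c: "\<forall>v\<in>\<tau> - \<sigma>. 0 < c v" "x = (\<Sum>v\<in>\<tau>. c v *\<^sub>R \<Psi> v)"
    and d: "\<forall>v\<in>\<tau>' - \<sigma>. 0 < d v" "x = (\<Sum>v\<in>\<tau>'. d v *\<^sub>R \<Psi> v)"
    using x unfolding in_open_def by blast
  have fin: "finite \<sigma>" using finT[OF T(1)] \<sigma>(1) finite_subset by blast
  define N where "N = 1 + (\<Sum>v\<in>\<sigma>. \<bar>c v\<bar>) + (\<Sum>v\<in>\<sigma>. \<bar>d v\<bar>)"
  define shift where "shift e v = e v + (if v \<in> \<sigma> then N else 0)" for e :: "'b \<Rightarrow> real" and v
  have N: "\<bar>c v\<bar> < N" "\<bar>d v\<bar> < N" if "v \<in> \<sigma>" for v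
    using member_le_sum[OF that, of "\<lambda>v. \<bar>c v\<bar>"] member_le_sum[OF that, of "\<lambda>v. \<bar>d v\<bar>"] fin
      sum_nonneg[of \<sigma> "\<lambda>v. \<bar>c v\<bar>"] sum_nonneg[of \<sigma> "\<lambda>v. \<bar>d v\<bar>"] by (simp_all add: N_def)
  have sh: "(\<Sum>v\<in>\<rho>. shift e v *\<^sub>R \<Psi> v) = (\<Sum>v\<in>\<rho>. e v *\<^sub>R \<Psi> v) + (\<Sum>v\<in>\<sigma>. N *\<^sub>R \<Psi> v)"
    if "\<sigma> \<subseteq> \<rho>" "finite \<rho>" for \<rho> e
  proof -
    have "(\<Sum>v\<in>\<rho>. (if v \<in> \<sigma> then N else 0) *\<^sub>R \<Psi> v) = (\<Sum>v\<in>\<sigma>. N *\<^sub>R \<Psi> v)"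
      using that by (intro sum.mono_neutral_cong_right) auto
    then show ?thesis by (simp add: shift_def scaleR_add_left sum.distrib)
  qed
  have "(\<Sum>v\<in>\<tau>. shift c v *\<^sub>R \<Psi> v) = (\<Sum>v\<in>\<tau>'. shift d v *\<^sub>R \<Psi> v)"
    using sh[OF \<sigma>(1) finT[OF T(1)], of c] sh[OF \<sigma>(2) finT[OF T(2)], of d] c(2) d(2) by simp
  moreover have "0 < shift c v" if "v \<in> \<tau>" for v
    using c(1) N(1)[of v] that by (cases "v \<in> \<sigma>") (auto simp: shift_def)
  moreover have "0 < shift d v" if "v \<in> \<tau>'" for v
    using d(1) N(2)[of v] that by (cases "v \<in> \<sigma>") (auto simp: shift_def)
  ultimately show ?thesis using unique[OF T, of "shift c" "shift d"] by blast
qed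

lemma closed_in_open:
  assumes \<tau>: "\<tau> \<in> T" and \<sigma>: "\<sigma> \<subseteq> \<tau>" and c: "\<And>v. v \<in> \<tau> - \<sigma> \<Longrightarrow> 0 \<le> c v"
  shows "in_open \<sigma> (\<sigma> \<union> {v \<in> \<tau> - \<sigma>. 0 < c v}) (\<Sum>v\<in>\<tau>. c v *\<^sub>R \<Psi> v)"
  unfolding in_open_def
proof (intro exI[of _ c] conjI)
  have "c v = 0" if "v \<in> \<tau> - \<sigma>" "\<not> 0 < c v" for v using c[OF that(1)] that(2) by simp
  then show "(\<Sum>v\<in>\<tau>. c v *\<^sub>R \<Psi> v) = (\<Sum>v\<in>\<sigma> \<union> {v \<in> \<tau> - \<sigma>. 0 < c v}. c v *\<^sub>R \<Psi> v)"
    using \<sigma> finT[OF \<tau>] by (intro sum.mono_neutral_right) auto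
qed auto

definition car :: "'b set \<Rightarrow> 'a set" where
  "car \<tau> = {a \<in> F. \<exists>v\<in>\<tau>. 0 < crd (\<Psi> v) a}"

lemma crd_not_car: "\<tau> \<in> T \<Longrightarrow> v \<in> \<tau> \<Longrightarrow> a \<in> F - car \<tau> \<Longrightarrow> crd (\<Psi> v) a = 0"
  using ray_nonneg[of v a] by (fastforce simp: car_def)

lemma in_open_crd:
  assumes \<tau>: "\<tau> \<in> T" and \<sigma>: "\<sigma> \<subseteq> \<tau>" and j: "j \<in> F - car \<sigma>"
  shows "crd (\<Sum>v\<in>\<tau>. c v *\<^sub>R \<Psi> v) j = (\<Sum>v\<in>\<tau> - \<sigma>. c v * crd (\<Psi> v) j)"
  unfolding crd_sum using crd_not_car[OF subT[OF \<tau> \<sigma>] _ j] finT[OF \<tau>]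
  by (intro sum.mono_neutral_right) auto

text \<open>The tangent cone of the simplicial cone at an interior point of the cone of
  \<open>\<sigma>\<close>: the coordinates in \<open>car \<sigma>\<close> are positive there and
  impose no condition.\<close>

definition star_cone :: "'b set \<Rightarrow> 'v set" where
  "star_cone \<sigma> = {x \<in> V. \<forall>j\<in>F - car \<sigma>. 0 \<le> crd x j}"

lemma in_open_star_cone:
  assumes \<tau>: "\<tau> \<in> T" and \<sigma>: "\<sigma> \<subseteq> \<tau>" and x: "in_open \<sigma> \<tau> x"
  shows "x \<in> star_cone \<sigma>"
proof -
  obtain c where c: "\<forall>v\<in>\<tau> - \<sigma>. 0 < c v" "x = (\<Sum>v\<in>\<tau>. c v *\<^sub>R \<Psi> v)"
    using x unfolding in_open_def by blast
  have "x \<in> V" unfolding c(2) using \<tau> by (intro span_sum span_scale ray_V) auto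
  moreover have "0 \<le> crd x j" if "j \<in> F - car \<sigma>" for j
    unfolding c(2) in_open_crd[OF \<tau> \<sigma> that]
    using c(1) ray_nonneg[of _ j] that \<tau> by (intro sum_nonneg mult_nonneg_nonneg) (auto simp: less_imp_le)
  ultimately show ?thesis by (simp add: star_cone_def)
qed

text \<open>Every point of the star cone lies in the cone of the fan after adding a large multiple of
  the interior point \<open>p\<close> of the cone of \<open>\<sigma>\<close>. Some cone of the fan receives infinitely many of
  these translates and hence contains \<open>p\<close>, so \<open>\<sigma>\<close> is one of its faces.\<close>

lemma star_cone_in_open:
  assumes \<sigma>: "\<sigma> \<in> T" and x: "x \<in> star_cone \<sigma>"
  shows "\<exists>\<tau>\<in>T. \<sigma> \<subseteq> \<tau> \<and> in_open \<sigma> \<tau> x"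
proof -
  define p where "p = (\<Sum>v\<in>\<sigma>. 1 *\<^sub>R \<Psi> v)"
  have \<sigma>V: "v \<in> \<Union>T" if "v \<in> \<sigma>" for v using \<sigma> that by blast
  have pV: "p \<in> V" unfolding p_def by (intro span_sum span_scale ray_V \<sigma>V)
  have xV: "x \<in> V" using x by (simp add: star_cone_def)
  have crdp: "crd p a = (\<Sum>v\<in>\<sigma>. crd (\<Psi> v) a)" for a unfolding p_def crd_sum by simp
  have p_pos: "0 < crd p a" if a: "a \<in> car \<sigma>" for a
  proof -
    obtain v where v: "v \<in> \<sigma>" "0 < crd (\<Psi> v) a" "a \<in> F" using a by (auto simp: car_def)
    then show ?thesis unfolding crdp
      using finT[OF \<sigma>] ray_nonneg[OF \<sigma>V] by (intro sum_pos2[of \<sigma> v]) auto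
  qed
  have p_nonneg: "0 \<le> crd p a" if "a \<in> F" for a
    unfolding crdp using ray_nonneg[OF \<sigma>V that] by (rule sum_nonneg)
  \<comment> \<open>From \<open>N\<close> on the translate by \<open>n\<close> times
    \<open>p\<close> has nonnegative coordinates: in \<open>car \<sigma>\<close> because
    \<open>p\<close> is positive there, elsewhere because \<open>x\<close> and \<open>p\<close> are
    nonnegative.\<close>
  define N where "N = (\<Sum>a\<in>car \<sigma>. \<bar>crd x a\<bar> / crd p a)"
  have finG: "finite (car \<sigma>)" using finF by (simp add: car_def)
  have coord: "crd (x + real n *\<^sub>R p) a = crd x a + real n * crd p a" for n a
    unfolding crd_def
    using linear_add[OF linear_coef[OF indep]] linear_cmul[OF linear_coef[OF indep]] by simp
  have nn: "0 \<le> crd x a + real n * crd p a" if a: "a \<in> F" and n: "N \<le> real n" for a n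
  proof (cases "a \<in> car \<sigma>")
    case True
    have "\<bar>crd x a\<bar> / crd p a \<le> N" unfolding N_def
      by (rule member_le_sum[OF True _ finG]) (use p_pos in \<open>auto simp: less_imp_le\<close>)
    then have "\<bar>crd x a\<bar> / crd p a \<le> real n" using n by linarith
    then have "\<bar>crd x a\<bar> \<le> real n * crd p a" using p_pos[OF True] by (simp add: pos_divide_le_eq)
    then show ?thesis by linarith
  next
    case False
    then show ?thesis using x a p_nonneg[OF a] by (simp add: star_cone_def)
  qed
  have ex: "\<exists>\<tau> b. \<tau> \<in> T \<and> (\<forall>v\<in>\<tau>. 0 < b v) \<and> x + real n *\<^sub>R p = (\<Sum>v\<in>\<tau>. b v *\<^sub>R \<Psi> v)"
    if n: "N \<le> real n" for n
  proof -
    have "x + real n *\<^sub>R p \<in> V" using xV pV by (intro span_add span_scale)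
    then have e: "x + real n *\<^sub>R p = (\<Sum>a\<in>F. (crd x a + real n * crd p a) *\<^sub>R \<Phi> a)"
      using crd_expand[of "x + real n *\<^sub>R p"] unfolding coord by simp
    show ?thesis unfolding e using cover[of "\<lambda>a. crd x a + real n * crd p a"] nn[OF _ n] by blast
  qed
  define K where "K = {n. N \<le> real n}"
  have "\<forall>n\<in>K. \<exists>\<tau> b. \<tau> \<in> T \<and> (\<forall>v\<in>\<tau>. 0 < b v) \<and> x + real n *\<^sub>R p = (\<Sum>v\<in>\<tau>. b v *\<^sub>R \<Psi> v)"
    using ex by (simp add: K_def)
  then obtain t b where tb: "\<And>n. n \<in> K \<Longrightarrow> t n \<in> T"
      "\<And>n v. n \<in> K \<Longrightarrow> v \<in> t n \<Longrightarrow> 0 < b n v"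
      "\<And>n. n \<in> K \<Longrightarrow> x + real n *\<^sub>R p = (\<Sum>v\<in>t n. b n v *\<^sub>R \<Psi> v)"
    unfolding bchoice_iff by metis
  have "infinite K"
    unfolding infinite_nat_iff_unbounded K_def
  proof
    fix m
    obtain n where "max (real m) N < real n" using reals_Archimedean2 by blast
    then show "\<exists>n>m. n \<in> {n. N \<le> real n}" by (intro exI[of _ n]) auto
  qed
  moreover have "t ` K \<subseteq> T" using tb(1) by blast
  then have "finite (t ` K)" using abstract_complexD(2)[OF complex] finite_subset by blast
  ultimately obtain n1 where n1: "n1 \<in> K" and inf: "infinite {n \<in> K. t n = t n1}"
    using pigeonhole_infinite by blast
  define \<tau> where "\<tau> = t n1"
  have \<tau>: "\<tau> \<in> T" using tb(1) n1 by (simp add: \<tau>_def)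
  define I where "I = {n \<in> K. t n = \<tau>}"
  have unb: "\<exists>n>m. n \<in> I" for m
    using inf unfolding infinite_nat_iff_unbounded I_def \<tau>_def by blast
  obtain n2 where n2: "n1 < n2" "n2 \<in> I" using unb by blast
  \<comment> \<open>Two translates lie in the same cone, so \<open>p\<close> is their difference
    quotient and has coordinates \<open>c\<close> in \<open>\<tau>\<close>.\<close>
  define c where "c v = (b n2 v - b n1 v) / (real n2 - real n1)" for v
  have eq: "x + real n *\<^sub>R p = (\<Sum>v\<in>\<tau>. b n v *\<^sub>R \<Psi> v)" if "n \<in> I" for n
    using tb(3)[of n] that by (auto simp: I_def)
  have n1I: "n1 \<in> I" using n1 by (simp add: I_def \<tau>_def)
  have "(real n2 - real n1) *\<^sub>R p = (x + real n2 *\<^sub>R p) - (x + real n1 *\<^sub>R p)"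
    by (simp add: scaleR_diff_left)
  also have "\<dots> = (\<Sum>v\<in>\<tau>. (b n2 v - b n1 v) *\<^sub>R \<Psi> v)"
    unfolding eq[OF n2(2)] eq[OF n1I] by (simp add: scaleR_diff_left sum_subtractf)
  also have "\<dots> = (\<Sum>v\<in>\<tau>. (real n2 - real n1) *\<^sub>R c v *\<^sub>R \<Psi> v)"
    using n2(1) by (intro sum.cong) (simp_all add: c_def)
  also have "\<dots> = (real n2 - real n1) *\<^sub>R (\<Sum>v\<in>\<tau>. c v *\<^sub>R \<Psi> v)" by (simp add: scaleR_sum_right)
  finally have p: "p = (\<Sum>v\<in>\<tau>. c v *\<^sub>R \<Psi> v)" using n2(1) by simp
  \<comment> \<open>The coordinates of the translates are affine in \<open>n\<close> with slope
    \<open>c\<close>; a negative slope would make one of them negative for large members of the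
    infinite set \<open>I\<close>.\<close>
  have cn: "0 \<le> c v" if v: "v \<in> \<tau>" for v
  proof (rule ccontr)
    assume neg: "\<not> 0 \<le> c v"
    obtain m where m: "real n1 + b n1 v / (- c v) < real m" using reals_Archimedean2 by blast
    obtain n where n: "m < n" "n \<in> I" using unb by blast
    have "(\<Sum>v\<in>\<tau>. b n v *\<^sub>R \<Psi> v) = (x + real n1 *\<^sub>R p) + (real n - real n1) *\<^sub>R p"
      unfolding eq[OF n(2), symmetric] by (simp add: scaleR_diff_left)
    also have "\<dots> = (\<Sum>v\<in>\<tau>. (b n1 v + (real n - real n1) * c v) *\<^sub>R \<Psi> v)"
      unfolding eq[OF n1I] by (subst p) (simp add: scaleR_add_left sum.distrib scaleR_sum_right)
    finally have combs: "(\<Sum>v\<in>\<tau>. b n v *\<^sub>R \<Psi> v) = \<dots>" .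
    have "b n v = b n1 v + (real n - real n1) * c v" by (rule comb_unique[OF \<tau> combs v])
    moreover have "0 < b n v" using tb(2) n(2) v by (auto simp: I_def)
    moreover have "b n1 v / (- c v) < real n - real n1" using m n(1) by linarith
    then have "b n1 v < (real n - real n1) * (- c v)" using neg pos_divide_less_eq[of "- c v"] by simp
    ultimately show False by simp
  qed
  have "in_open {} ({} \<union> {v \<in> \<tau> - {}. 0 < c v}) (\<Sum>v\<in>\<tau>. c v *\<^sub>R \<Psi> v)"
    by (rule closed_in_open[OF \<tau>]) (use cn in auto)
  then have "in_open {} {v \<in> \<tau>. 0 < c v} p" unfolding p by simp
  moreover have "in_open {} \<sigma> p" unfolding in_open_def p_def by (intro exI[of _ "\<lambda>_. 1"]) simp
  ultimately have "{v \<in> \<tau>. 0 < c v} = \<sigma>"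
    using in_open_unique[of "{}" _ \<sigma>] \<sigma> subT[OF \<tau>, of "{v \<in> \<tau>. 0 < c v}"] by blast
  then have sub: "\<sigma> \<subseteq> \<tau>" by blast
  have "x = (\<Sum>v\<in>\<tau>. b n1 v *\<^sub>R \<Psi> v) - real n1 *\<^sub>R p" unfolding eq[OF n1I, symmetric] by simp
  also have "real n1 *\<^sub>R p = (\<Sum>v\<in>\<tau>. (if v \<in> \<sigma> then real n1 else 0) *\<^sub>R \<Psi> v)"
    unfolding p_def scaleR_sum_right using sub finT[OF \<tau>]
    by (intro sum.mono_neutral_cong_left) auto
  finally have "x = (\<Sum>v\<in>\<tau>. (b n1 v - (if v \<in> \<sigma> then real n1 else 0)) *\<^sub>R \<Psi> v)"
    by (simp add: scaleR_diff_left sum_subtractf)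
  then have "in_open \<sigma> \<tau> x" unfolding in_open_def
    using tb(2)[OF n1] by (intro exI[of _ "\<lambda>v. b n1 v - (if v \<in> \<sigma> then real n1 else 0)"]) (auto simp: \<tau>_def)
  then show ?thesis using \<tau> sub by blast
qed

section \<open>Two stratifications of the tangent cone\<close>

definition star_points :: "'b set \<Rightarrow> 'v set" where
  "star_points \<sigma> = star_cone \<sigma> - span (\<Psi> ` \<sigma>)"

definition open_face :: "'b set \<Rightarrow> 'v \<Rightarrow> 'b set" where
  "open_face \<sigma> x = (THE \<tau>. \<tau> \<in> T \<and> \<sigma> \<subseteq> \<tau> \<and> in_open \<sigma> \<tau> x)"

lemma open_face_eq:
  assumes "\<tau> \<in> T" "\<sigma> \<subseteq> \<tau>" "in_open \<sigma> \<tau> x"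
  shows "open_face \<sigma> x = \<tau>"
  unfolding open_face_def
  by (rule the_equality) (use assms in_open_unique[of \<sigma> _ \<tau>] in blast)+

lemma open_face_props:
  assumes "\<sigma> \<in> T" "x \<in> star_cone \<sigma>"
  shows "open_face \<sigma> x \<in> T" "\<sigma> \<subseteq> open_face \<sigma> x" "in_open \<sigma> (open_face \<sigma> x) x"
proof -
  obtain \<tau> where "\<tau> \<in> T" "\<sigma> \<subseteq> \<tau>" "in_open \<sigma> \<tau> x" using star_cone_in_open[OF assms] by blast
  then show "open_face \<sigma> x \<in> T" "\<sigma> \<subseteq> open_face \<sigma> x" "in_open \<sigma> (open_face \<sigma> x) x"
    using open_face_eq by simp_all
qed

lemma in_open_self_iff:
  assumes "\<sigma> \<in> T" shows "in_open \<sigma> \<sigma> x \<longleftrightarrow> x \<in> span (\<Psi> ` \<sigma>)"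
proof
  assume "in_open \<sigma> \<sigma> x"
  then obtain c where "x = (\<Sum>v\<in>\<sigma>. c v *\<^sub>R \<Psi> v)" unfolding in_open_def by blast
  then show "x \<in> span (\<Psi> ` \<sigma>)" by (simp add: span_sum span_scale span_base)
next
  assume "x \<in> span (\<Psi> ` \<sigma>)"
  then obtain c where "x = (\<Sum>v\<in>\<sigma>. c v *\<^sub>R \<Psi> v)"
    by (rule span_image_finite[OF finT[OF assms] inj_ray[OF assms]])
  then show "in_open \<sigma> \<sigma> x" unfolding in_open_def by blast
qed

lemma in_open_star_points:
  assumes \<tau>: "\<tau> \<in> T" and \<sigma>: "\<sigma> \<subseteq> \<tau>" and x: "in_open \<sigma> \<tau> x" and ne: "\<tau> \<noteq> \<sigma>"
  shows "x \<in> star_points \<sigma>" "open_face \<sigma> x = \<tau>"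
proof -
  have \<sigma>T: "\<sigma> \<in> T" by (rule subT[OF \<tau> \<sigma>])
  show eq: "open_face \<sigma> x = \<tau>" by (rule open_face_eq[OF \<tau> \<sigma> x])
  have "\<not> in_open \<sigma> \<sigma> x"
    using open_face_eq[OF \<sigma>T subset_refl] eq ne by metis
  then show "x \<in> star_points \<sigma>"
    using in_open_star_cone[OF \<tau> \<sigma> x] in_open_self_iff[OF \<sigma>T] by (simp add: star_points_def)
qed

lemma star_points_props:
  assumes \<sigma>: "\<sigma> \<in> T" and x: "x \<in> star_points \<sigma>"
  shows "open_face \<sigma> x \<in> T" "\<sigma> \<subseteq> open_face \<sigma> x" "in_open \<sigma> (open_face \<sigma> x) x" "open_face \<sigma> x \<noteq> \<sigma>"
proof -
  have xc: "x \<in> star_cone \<sigma>" and xs: "x \<notin> span (\<Psi> ` \<sigma>)" using x by (auto simp: star_points_def)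
  show "open_face \<sigma> x \<in> T" "\<sigma> \<subseteq> open_face \<sigma> x" and io: "in_open \<sigma> (open_face \<sigma> x) x"
    using open_face_props[OF \<sigma> xc] by auto
  show "open_face \<sigma> x \<noteq> \<sigma>" using io xs in_open_self_iff[OF \<sigma>, of x] by metis
qed

definition link_point :: "'b set \<Rightarrow> 'v \<Rightarrow> 'b set" where
  "link_point \<sigma> x = open_face \<sigma> x - \<sigma>"

text \<open>Closed strata are visibly convex in this form: the coefficients are free along
  \<open>\<sigma>\<close>, and along \<open>\<rho>\<close> they are nonnegative and not all
  zero.\<close>

lemma lower_star:
  assumes \<sigma>: "\<sigma> \<in> T" and \<rho>: "\<rho> \<in> link T \<sigma>"
  shows "{x \<in> star_points \<sigma>. link_point \<sigma> x \<subseteq> \<rho>}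
    = {\<Sum>v\<in>\<sigma> \<union> \<rho>. c v *\<^sub>R \<Psi> v | c. (\<forall>v\<in>\<rho>. 0 \<le> c v) \<and> (\<exists>v\<in>\<rho>. 0 < c v)}" (is "?L = ?R")
proof (intro equalityI subsetI)
  have \<sigma>\<rho>: "\<sigma> \<union> \<rho> \<in> T" "\<rho> \<inter> \<sigma> = {}" using \<rho> by (auto simp: link_altdef)
  {
    fix x assume x: "x \<in> ?L"
    define \<tau> where "\<tau> = open_face \<sigma> x"
    have \<tau>: "\<tau> \<in> T" "\<sigma> \<subseteq> \<tau>" "in_open \<sigma> \<tau> x" "\<tau> \<noteq> \<sigma>" "\<tau> - \<sigma> \<subseteq> \<rho>"
      using star_points_props[OF \<sigma>] x by (auto simp: \<tau>_def link_point_def)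
    obtain c where c: "\<forall>v\<in>\<tau> - \<sigma>. 0 < c v" "x = (\<Sum>v\<in>\<tau>. c v *\<^sub>R \<Psi> v)"
      using \<tau>(3) unfolding in_open_def by blast
    define d where "d v = (if v \<in> \<tau> then c v else 0)" for v
    have "x = (\<Sum>v\<in>\<sigma> \<union> \<rho>. d v *\<^sub>R \<Psi> v)"
      unfolding c(2) d_def using \<tau>(5) finT[OF \<sigma>\<rho>(1)] by (intro sum.mono_neutral_cong_left) auto
    moreover have "\<forall>v\<in>\<rho>. 0 \<le> d v"
    proof
      fix v assume "v \<in> \<rho>"
      then have "v \<in> \<tau> \<Longrightarrow> 0 < c v" using c(1) \<sigma>\<rho>(2) by blast
      then show "0 \<le> d v" by (simp add: d_def less_imp_le)
    qed
    moreover have "\<exists>v\<in>\<rho>. 0 < d v"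
    proof -
      obtain v where "v \<in> \<tau> - \<sigma>" using \<tau>(2,4) by blast
      then show ?thesis using c(1) \<tau>(5) by (intro bexI[of _ v]) (auto simp: d_def)
    qed
    ultimately show "x \<in> ?R" by blast
  next
    fix x assume "x \<in> ?R"
    then obtain c where c: "x = (\<Sum>v\<in>\<sigma> \<union> \<rho>. c v *\<^sub>R \<Psi> v)" "\<forall>v\<in>\<rho>. 0 \<le> c v" "\<exists>v\<in>\<rho>. 0 < c v" by blast
    define \<tau> where "\<tau> = \<sigma> \<union> {v \<in> (\<sigma> \<union> \<rho>) - \<sigma>. 0 < c v}"
    have "in_open \<sigma> \<tau> x"
      unfolding c(1) \<tau>_def by (rule closed_in_open[OF \<sigma>\<rho>(1)]) (use c(2) in auto)
    moreover have "\<tau> \<in> T" by (rule subT[OF \<sigma>\<rho>(1)]) (auto simp: \<tau>_def)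
    moreover have "\<sigma> \<subseteq> \<tau>" by (auto simp: \<tau>_def)
    moreover have "\<tau> \<noteq> \<sigma>" using c(3) \<sigma>\<rho>(2) by (auto simp: \<tau>_def)
    ultimately have "x \<in> star_points \<sigma>" "open_face \<sigma> x = \<tau>" using in_open_star_points by blast+
    then show "x \<in> ?L" by (auto simp: link_point_def \<tau>_def)
  }
qed

text \<open>Suppose the signs of \<open>x\<close> are among those of \<open>y\<close>, and
  \<open>y\<close> lies in the open stratum of \<open>\<tau>\<close>. The coordinates complementary
  to the rays of \<open>\<tau>\<close> vanish at \<open>y\<close> and so at \<open>x\<close>, which
  puts \<open>x\<close> into the span of these rays. The coordinates at rays outside
  \<open>\<sigma>\<close> are positive at \<open>y\<close>, hence nonnegative at \<open>x\<close>,
  and the stratum of \<open>x\<close> belongs to a face of \<open>\<tau>\<close>.\<close>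

lemma star_stratified:
  assumes \<sigma>: "\<sigma> \<in> T"
    and A: "\<And>\<tau> b. \<tau> \<in> T \<Longrightarrow> b \<in> extend_basis (\<Psi> ` \<tau>) \<Longrightarrow> (\<lambda>x. coef (\<Psi> ` \<tau>) x b) \<in> A"
  shows "stratified A (star_points \<sigma>) (link T \<sigma>) (link_point \<sigma>)"
  unfolding stratified_def
proof (intro conjI ballI impI)
  fix x assume x: "x \<in> star_points \<sigma>"
  show "link_point \<sigma> x \<in> link T \<sigma> - {{}}"
    using star_points_props[OF \<sigma> x] by (auto simp: link_point_def link_def)
  fix y assume y: "y \<in> star_points \<sigma>" and le: "sign_vector A x \<subseteq> sign_vector A y"
  define \<tau> where "\<tau> = open_face \<sigma> y"
  have \<tau>: "\<tau> \<in> T" "\<sigma> \<subseteq> \<tau>" "in_open \<sigma> \<tau> y" using star_points_props[OF \<sigma> y] by (auto simp: \<tau>_def)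
  obtain c where c: "\<forall>v\<in>\<tau> - \<sigma>. 0 < c v" "y = (\<Sum>v\<in>\<tau>. c v *\<^sub>R \<Psi> v)"
    using \<tau>(3) unfolding in_open_def by blast
  note ind = indep_ray[OF \<tau>(1)] and sup = extend_basis_superset[OF indep_ray[OF \<tau>(1)]]
  let ?co = "coef (\<Psi> ` \<tau>)"
  have sgn: "(0 < ?co x b \<longrightarrow> 0 < ?co y b) \<and> (?co x b < 0 \<longrightarrow> ?co y b < 0)"
    if "b \<in> extend_basis (\<Psi> ` \<tau>)" for b
    using bspec[OF le[unfolded sign_vector_subset_iff] A[OF \<tau>(1) that]] .
  have yspan: "y \<in> span (\<Psi> ` \<tau>)" unfolding c(2) by (intro span_sum span_scale span_base imageI)
  then have "?co x b = 0" if "b \<in> extend_basis (\<Psi> ` \<tau>) - \<Psi> ` \<tau>" for b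
    using sgn[of b] that coef_span_iff[OF ind sup, of y] by force
  then have "x \<in> span (\<Psi> ` \<tau>)" using coef_span_iff[OF ind sup, of x] by blast
  then have xe: "x = (\<Sum>v\<in>\<tau>. ?co x (\<Psi> v) *\<^sub>R \<Psi> v)"
    using coef_expansion_span[OF ind, of x] by (simp add: sum.reindex[OF inj_ray[OF \<tau>(1)]])
  have ye: "y = (\<Sum>v\<in>\<tau>. ?co y (\<Psi> v) *\<^sub>R \<Psi> v)"
    using coef_expansion_span[OF ind yspan] by (simp add: sum.reindex[OF inj_ray[OF \<tau>(1)]])
  have "0 \<le> ?co x (\<Psi> v)" if v: "v \<in> \<tau> - \<sigma>" for v
  proof -
    have "?co y (\<Psi> v) = c v" by (rule comb_unique[OF \<tau>(1)]) (use ye c(2) v in auto)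
    then have "0 < ?co y (\<Psi> v)" using c(1) v by simp
    then show ?thesis using sgn[of "\<Psi> v"] v sup by (meson DiffD1 imageI less_asym not_less subsetD)
  qed
  then have "in_open \<sigma> (\<sigma> \<union> {v \<in> \<tau> - \<sigma>. 0 < ?co x (\<Psi> v)}) x"
    by (subst (2) xe) (rule closed_in_open[OF \<tau>(1,2)])
  then have "open_face \<sigma> x = \<sigma> \<union> {v \<in> \<tau> - \<sigma>. 0 < ?co x (\<Psi> v)}"
    using \<tau>(2) by (intro open_face_eq subT[OF \<tau>(1)]) auto
  then show "link_point \<sigma> x \<subseteq> link_point \<sigma> y" unfolding link_point_def \<tau>_def by auto
next
  fix \<rho> assume \<rho>: "\<rho> \<in> link T \<sigma> - {{}}"
  then have \<rho>': "\<rho> \<in> link T \<sigma>" "\<rho> \<noteq> {}" by auto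
  show "{x \<in> star_points \<sigma>. link_point \<sigma> x \<subseteq> \<rho>} \<noteq> {}"
    unfolding lower_star[OF \<sigma> \<rho>'(1)] using \<rho>'(2) by (auto intro!: exI[of _ "\<lambda>_. 1"])
  show "convex {x \<in> star_points \<sigma>. link_point \<sigma> x \<subseteq> \<rho>}"
    unfolding lower_star[OF \<sigma> \<rho>'(1)]
  proof (rule convexI)
    fix x y and u w :: real
    assume x: "x \<in> {\<Sum>v\<in>\<sigma> \<union> \<rho>. c v *\<^sub>R \<Psi> v |c. (\<forall>v\<in>\<rho>. 0 \<le> c v) \<and> (\<exists>v\<in>\<rho>. 0 < c v)}"
      and y: "y \<in> {\<Sum>v\<in>\<sigma> \<union> \<rho>. c v *\<^sub>R \<Psi> v |c. (\<forall>v\<in>\<rho>. 0 \<le> c v) \<and> (\<exists>v\<in>\<rho>. 0 < c v)}"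
      and u: "0 \<le> u" "0 \<le> w" "u + w = 1"
    obtain c where c: "x = (\<Sum>v\<in>\<sigma> \<union> \<rho>. c v *\<^sub>R \<Psi> v)" "\<forall>v\<in>\<rho>. 0 \<le> c v" "\<exists>v\<in>\<rho>. 0 < c v" using x by blast
    obtain d where d: "y = (\<Sum>v\<in>\<sigma> \<union> \<rho>. d v *\<^sub>R \<Psi> v)" "\<forall>v\<in>\<rho>. 0 \<le> d v" "\<exists>v\<in>\<rho>. 0 < d v" using y by blast
    have "u *\<^sub>R x + w *\<^sub>R y = (\<Sum>v\<in>\<sigma> \<union> \<rho>. (u * c v + w * d v) *\<^sub>R \<Psi> v)"
      unfolding c(1) d(1) by (simp add: scaleR_sum_right scaleR_add_left sum.distrib)
    moreover have "\<forall>v\<in>\<rho>. 0 \<le> u * c v + w * d v" using c(2) d(2) u by simp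
    moreover have "\<exists>v\<in>\<rho>. 0 < u * c v + w * d v"
    proof (cases "u = 0")
      case True
      then show ?thesis using d(3) u(3) by simp
    next
      case False
      obtain v where "v \<in> \<rho>" "0 < c v" using c(3) by blast
      then show ?thesis using False u d(2) by (intro bexI[of _ v]) (auto intro: add_pos_nonneg)
    qed
    ultimately show "u *\<^sub>R x + w *\<^sub>R y \<in> {\<Sum>v\<in>\<sigma> \<union> \<rho>. c v *\<^sub>R \<Psi> v |c. (\<forall>v\<in>\<rho>. 0 \<le> c v) \<and> (\<exists>v\<in>\<rho>. 0 < c v)}"
      by (auto intro!: exI[of _ "\<lambda>v. u * c v + w * d v"])
  qed
qed

text \<open>The rays of \<open>\<sigma>\<close> are completed by \<open>E\<close> to a basis of the
  span of the face that carries them, and the remaining generators are kept. \<open>E\<close>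
  supplies the axes of the cross-polytope in the model, the remaining generators the vertices of its
  simplex.\<close>

lemma adapted_basis:
  assumes \<sigma>: "\<sigma> \<in> T"
  obtains E where "\<Psi> ` \<sigma> \<inter> E = {}" "E \<inter> \<Phi> ` (F - car \<sigma>) = {}" "\<Psi> ` \<sigma> \<inter> \<Phi> ` (F - car \<sigma>) = {}"
    "independent (\<Psi> ` \<sigma> \<union> E \<union> \<Phi> ` (F - car \<sigma>))"
    "span (\<Psi> ` \<sigma> \<union> E) = span (\<Phi> ` car \<sigma>)" "span (\<Psi> ` \<sigma> \<union> E \<union> \<Phi> ` (F - car \<sigma>)) = V"
    "finite E" "card E + card \<sigma> = card (car \<sigma>)"
proof -
  let ?G = "\<Phi> ` car \<sigma>" and ?J = "\<Phi> ` (F - car \<sigma>)"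
  have carF: "car \<sigma> \<subseteq> F" by (auto simp: car_def)
  then have finG: "finite (car \<sigma>)" using finF finite_subset by blast
  have GJ: "?G \<union> ?J = \<Phi> ` F" using carF by blast
  have sub: "\<Psi> ` \<sigma> \<subseteq> span ?G"
  proof
    fix x assume "x \<in> \<Psi> ` \<sigma>"
    then obtain v where v: "v \<in> \<sigma>" "x = \<Psi> v" by blast
    have "\<Psi> v = (\<Sum>a\<in>F. crd (\<Psi> v) a *\<^sub>R \<Phi> a)" using v \<sigma> by (intro crd_expand ray_V) auto
    also have "\<dots> = (\<Sum>a\<in>car \<sigma>. crd (\<Psi> v) a *\<^sub>R \<Phi> a)"
      using crd_not_car[OF \<sigma> v(1)] carF finF by (intro sum.mono_neutral_right) auto
    also have "\<dots> \<in> span ?G" by (intro span_sum span_scale span_base imageI)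
    finally show "x \<in> span ?G" using v by simp
  qed
  obtain B where B: "\<Psi> ` \<sigma> \<subseteq> B" "B \<subseteq> span ?G" "independent B" "span ?G \<subseteq> span B"
    using maximal_independent_subset_extend[OF sub indep_ray[OF \<sigma>]] by blast
  have spB: "span B = span ?G" using B(2,4) span_minimal[OF B(2) subspace_span] by blast
  have finB: "finite B" using B(3) finiteI_independent by blast
  have indG: "independent ?G" using independent_mono[OF indep] GJ by blast
  have cG: "card ?G = card (car \<sigma>)" using card_image inj_on_subset[OF inj carF] by blast
  have cB: "card B = card (car \<sigma>)"
    using dim_eq_card[OF spB B(3)] dim_eq_card_independent[OF indG] cG by (metis dim_span spB dim_eq_card_independent B(3))
  have spBJ: "span (B \<union> ?J) = V" unfolding GJ[symmetric] span_Un spB ..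
  have cF: "card (\<Phi> ` F) = card F" using card_image[OF inj] .
  have cJ: "card ?J = card F - card (car \<sigma>)"
    using card_image[OF inj_on_subset[OF inj], of "F - car \<sigma>"] card_Diff_subset[OF finG carF] by simp
  have dimV: "dim (B \<union> ?J) = card F"
    using dim_eq_card_independent[OF indep] cF spBJ by (metis dim_span)
  \<comment> \<open>Counting against the dimension forces \<open>B\<close> and the remaining
    generators to be disjoint; a spanning set of this size is then independent.\<close>
  have cBJ: "card (B \<union> ?J) = card F" "B \<inter> ?J = {}"
  proof -
    have fin: "finite (B \<union> ?J)" using finB finF by simp
    have "card F \<le> card (B \<union> ?J)" using dim_le_card[OF span_superset fin] dimV by simp
    moreover have "card (B \<union> ?J) + card (B \<inter> ?J) = card F"
      using card_Un_Int[OF finB, of ?J] finF cB cJ card_mono[OF finF carF] by simp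
    ultimately have "card (B \<union> ?J) = card F" "card (B \<inter> ?J) = 0" by linarith+
    moreover have "finite (B \<inter> ?J)" using finB by (rule finite_Int[OF disjI1])
    ultimately show "card (B \<union> ?J) = card F" "B \<inter> ?J = {}" by (auto simp only: card_0_eq)
  qed
  have "independent (B \<union> ?J)"
    by (rule card_le_dim_spanning[OF subset_refl span_superset]) (use finB finF dimV cBJ(1) in auto)
  moreover have "\<Psi> ` \<sigma> \<union> (B - \<Psi> ` \<sigma>) = B" using B(1) by blast
  moreover have "card (B - \<Psi> ` \<sigma>) + card \<sigma> = card (car \<sigma>)"
    using card_Diff_subset[OF _ B(1)] card_image[OF inj_ray[OF \<sigma>]] finT[OF \<sigma>] cB card_mono[OF finB B(1)] by simp
  moreover have "(B - \<Psi> ` \<sigma>) \<inter> ?J = {}" "\<Psi> ` \<sigma> \<inter> ?J = {}" using cBJ(2) B(1) by blast+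
  ultimately show thesis
    using that[of "B - \<Psi> ` \<sigma>"] spB spBJ cBJ(2) finB B(1) by auto
qed

text \<open>The generators in \<open>car \<sigma>\<close> lie in the span of \<open>B\<close>, so
  replacing them by \<open>B\<close> does not affect the coordinates along the other
  generators.\<close>

lemma crd_eq_coef:
  assumes \<sigma>: "\<sigma> \<in> T" and Bs: "independent (B \<union> \<Phi> ` (F - car \<sigma>))" "B \<inter> \<Phi> ` (F - car \<sigma>) = {}"
    "span B = span (\<Phi> ` car \<sigma>)" and j: "j \<in> F - car \<sigma>" and x: "x \<in> V"
  shows "coef (B \<union> \<Phi> ` (F - car \<sigma>)) x (\<Phi> j) = crd x j"
proof -
  let ?M = "B \<union> \<Phi> ` (F - car \<sigma>)"
  note sup = extend_basis_superset[OF Bs(1)]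
  have basis: "coef ?M (\<Phi> a) (\<Phi> j) = (if a = j then 1 else 0)" if a: "a \<in> F" for a
  proof (cases "a \<in> car \<sigma>")
    case True
    then have "\<Phi> a \<in> span B" unfolding Bs(3) by (intro span_base imageI)
    moreover have "\<Phi> j \<in> extend_basis ?M - B" using j sup Bs(2) by blast
    ultimately have "coef ?M (\<Phi> a) (\<Phi> j) = 0"
      using coef_span_iff[OF Bs(1), of B "\<Phi> a"] sup by blast
    then show ?thesis using True j by auto
  next
    case False
    then have "\<Phi> a \<in> extend_basis ?M" using a sup by blast
    then show ?thesis
      using coef_basis[OF Bs(1), of "\<Phi> a" "\<Phi> j"] inj_on_eq_iff[OF inj, of a j] a j by auto
  qed
  have "coef ?M x (\<Phi> j) = coef ?M (\<Sum>a\<in>F. crd x a *\<^sub>R \<Phi> a) (\<Phi> j)"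
    using crd_expand[OF x] by simp
  also have "\<dots> = (\<Sum>a\<in>F. crd x a * (if a = j then 1 else 0))"
    unfolding coef_sum[OF Bs(1)] by (intro sum.cong) (simp_all add: basis)
  also have "\<dots> = crd x j" using j finF by (simp add: sum.delta' if_distrib cong: if_cong)
  finally show ?thesis .
qed

definition cross_point :: "'v set \<Rightarrow> 'v set \<Rightarrow> 'v \<Rightarrow> ('v \<times> bool) set" where
  "cross_point M C x = {(w, b). w \<in> C \<and> (if b then 0 < coef M x w else coef M x w < 0)}"

text \<open>In the adapted basis the point set is cut out by coordinates: arbitrary along
  \<open>\<sigma>\<close> and \<open>E\<close>, nonnegative along \<open>W\<close>, and not all zero
  on \<open>E \<union> W\<close>. The sign pattern on \<open>E \<union> W\<close> is then a nonempty
  face of the model.\<close>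

lemma cross_stratified:
  assumes \<sigma>: "\<sigma> \<in> T"
    and M: "M = \<Psi> ` \<sigma> \<union> E \<union> W" and W: "W = \<Phi> ` (F - car \<sigma>)"
    and disj: "\<Psi> ` \<sigma> \<inter> E = {}" "E \<inter> W = {}" "\<Psi> ` \<sigma> \<inter> W = {}"
    and ind: "independent M" and sp: "span (\<Psi> ` \<sigma> \<union> E) = span (\<Phi> ` car \<sigma>)" "span M = V"
    and A: "\<And>b. b \<in> E \<union> W \<Longrightarrow> (\<lambda>x. coef M x b) \<in> A"
  shows "stratified A (star_points \<sigma>) (cross_simplex E W) (cross_point M (E \<union> W))"
proof -
  let ?co = "coef M"
  note sup = extend_basis_superset[OF ind]
  have crd: "?co x (\<Phi> j) = crd x j" if "j \<in> F - car \<sigma>" "x \<in> V" for x j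
    unfolding M W by (rule crd_eq_coef[OF \<sigma> _ _ sp(1) that]) (use ind disj M W in auto)
  have cone_iff: "x \<in> star_cone \<sigma> \<longleftrightarrow> x \<in> V \<and> (\<forall>w\<in>W. 0 \<le> ?co x w)" for x
    unfolding star_cone_def W using crd by auto
  have Vz: "?co x b = 0" if "x \<in> V" "b \<in> extend_basis M - M" for x b
    using coef_span_iff[OF ind sup, of x] sp(2) that by blast
  have spS: "x \<in> span (\<Psi> ` \<sigma>) \<longleftrightarrow> (\<forall>b\<in>E \<union> W. ?co x b = 0)" if x: "x \<in> V" for x
  proof -
    have "\<Psi> ` \<sigma> \<subseteq> extend_basis M" using sup M by blast
    moreover have "extend_basis M - \<Psi> ` \<sigma> = (extend_basis M - M) \<union> (E \<union> W)"
      using sup M disj by blast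
    ultimately show ?thesis using coef_span_iff[OF ind, of "\<Psi> ` \<sigma>" x] Vz[OF x] by blast
  qed
  have pts: "x \<in> star_points \<sigma> \<longleftrightarrow> x \<in> V \<and> (\<forall>w\<in>W. 0 \<le> ?co x w) \<and> (\<exists>b\<in>E \<union> W. ?co x b \<noteq> 0)" for x
    unfolding star_points_def using cone_iff spS by blast
  have lin: "?co (u *\<^sub>R x + w *\<^sub>R y) b = u * ?co x b + w * ?co y b" for u w x y b
    using linear_add[OF linear_coef[OF ind, of b]] linear_cmul[OF linear_coef[OF ind, of b]] by simp
  show ?thesis
    unfolding stratified_def
  proof (intro conjI ballI impI)
    fix x assume x: "x \<in> star_points \<sigma>"
    obtain b where b: "b \<in> E \<union> W" "?co x b \<noteq> 0" using x pts by blast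
    then have "(b, 0 < ?co x b) \<in> cross_point M (E \<union> W) x"
      unfolding cross_point_def by (auto simp: linorder_neq_iff)
    then have "cross_point M (E \<union> W) x \<noteq> {}" by blast
    moreover have "\<not> ?co x w < 0" if "w \<in> W" for w using x pts that by (simp add: not_less)
    then have "cross_point M (E \<union> W) x \<in> cross_simplex E W"
      unfolding cross_point_def cross_simplex_def by (auto split: if_splits)
    ultimately show "cross_point M (E \<union> W) x \<in> cross_simplex E W - {{}}" by simp
    fix y assume y: "y \<in> star_points \<sigma>" and le: "sign_vector A x \<subseteq> sign_vector A y"
    have "(0 < ?co x b \<longrightarrow> 0 < ?co y b) \<and> (?co x b < 0 \<longrightarrow> ?co y b < 0)" if "b \<in> E \<union> W" for b
      using bspec[OF le[unfolded sign_vector_subset_iff] A[OF that]] .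
    then show "cross_point M (E \<union> W) x \<subseteq> cross_point M (E \<union> W) y"
      unfolding cross_point_def by (auto split: if_splits)
  next
    fix U assume "U \<in> cross_simplex E W - {{}}"
    then have U: "U \<in> cross_simplex E W" "U \<noteq> {}" by auto
    have sgn: "(w, True) \<in> U \<Longrightarrow> (w, False) \<notin> U" for w using U(1) by (auto simp: cross_simplex_def)
    have low: "cross_point M (E \<union> W) x \<subseteq> U \<longleftrightarrow> (\<forall>w\<in>E \<union> W. (0 < ?co x w \<longrightarrow> (w, True) \<in> U) \<and>
        (?co x w < 0 \<longrightarrow> (w, False) \<in> U))" for x
      unfolding cross_point_def by (auto simp: subset_iff split: if_splits)
    have mem: "x \<in> {x \<in> star_points \<sigma>. cross_point M (E \<union> W) x \<subseteq> U} \<longleftrightarrow> x \<in> V \<and> (\<forall>w\<in>W. 0 \<le> ?co x w) \<and>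
        (\<exists>b\<in>E \<union> W. ?co x b \<noteq> 0) \<and> (\<forall>w\<in>E \<union> W. (0 < ?co x w \<longrightarrow> (w, True) \<in> U) \<and>
        (?co x w < 0 \<longrightarrow> (w, False) \<in> U))" for x
      using low[of x] pts[of x] by simp
    show "convex {x \<in> star_points \<sigma>. cross_point M (E \<union> W) x \<subseteq> U}"
    proof (rule convexI)
      fix x y and u t :: real
      assume x: "x \<in> {x \<in> star_points \<sigma>. cross_point M (E \<union> W) x \<subseteq> U}"
        and y: "y \<in> {x \<in> star_points \<sigma>. cross_point M (E \<union> W) x \<subseteq> U}"
        and u: "0 \<le> u" "0 \<le> t" "u + t = 1"
      note x' = x[unfolded mem] and y' = y[unfolded mem]
      let ?z = "u *\<^sub>R x + t *\<^sub>R y"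
      have 1: "?z \<in> V" using x' y' by (intro span_add span_scale) auto
      have 2: "\<forall>w\<in>W. 0 \<le> ?co ?z w" unfolding lin using x' y' u by simp
      have 3: "\<exists>b\<in>E \<union> W. ?co ?z b \<noteq> 0"
      proof (cases "u = 0")
        case True
        then show ?thesis using y' u(3) by simp
      next
        case False
        then have u0: "0 < u" using u by simp
        obtain b where b: "b \<in> E \<union> W" "?co x b \<noteq> 0" using x' by blast
        \<comment> \<open>There is no cancellation at \<open>b\<close>: a face of the model has at
          most one sign on each axis, so \<open>x\<close> and \<open>y\<close> do not have opposite
          signs there.\<close>
        have "u * ?co x b + t * ?co y b \<noteq> 0"
        proof (cases "0 < ?co x b")
          case True
          then have "(b, True) \<in> U" using x' b by blast
          then have "\<not> ?co y b < 0" using y' b sgn by blast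
          then have "0 < u * ?co x b + t * ?co y b" using True u0 u by (intro add_pos_nonneg) auto
          then show ?thesis by simp
        next
          case False
          then have neg: "?co x b < 0" using b by simp
          then have "(b, False) \<in> U" using x' b by blast
          then have "\<not> 0 < ?co y b" using y' b sgn by blast
          then have "u * ?co x b + t * ?co y b < 0"
            using neg u0 u by (intro add_neg_nonpos) (auto simp: mult_pos_neg mult_nonneg_nonpos)
          then show ?thesis by simp
        qed
        then show ?thesis using b(1) unfolding lin by blast
      qed
      have 4: "(0 < ?co ?z w \<longrightarrow> (w, True) \<in> U) \<and> (?co ?z w < 0 \<longrightarrow> (w, False) \<in> U)"
        if w: "w \<in> E \<union> W" for w
      proof (intro conjI impI)
        assume "0 < ?co ?z w"
        then have "0 < ?co x w \<or> 0 < ?co y w"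
          unfolding lin using u by (smt (verit) mult_nonneg_nonpos)
        then show "(w, True) \<in> U" using x' y' w by blast
      next
        assume "?co ?z w < 0"
        then have "?co x w < 0 \<or> ?co y w < 0"
          unfolding lin using u by (smt (verit) mult_nonneg_nonneg)
        then show "(w, False) \<in> U" using x' y' w by blast
      qed
      show "?z \<in> {x \<in> star_points \<sigma>. cross_point M (E \<union> W) x \<subseteq> U}"
        unfolding mem using 1 2 3 4 by blast
    qed
    obtain w b where wb: "(w, b) \<in> U" using U(2) by auto
    then have w: "w \<in> E \<union> W" "w \<in> W \<Longrightarrow> b" using U(1) by (cases b; auto simp: cross_simplex_def)+
    \<comment> \<open>The vertex \<open>(w, b)\<close> of \<open>U\<close> is realized by
      \<open>w\<close> or its negative.\<close>
    define x where "x = (if b then 1 else - 1) *\<^sub>R w"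
    have "w \<in> extend_basis M" using w(1) M sup by blast
    from coef_basis[OF ind this]
    have cox: "?co x v = (if v = w then (if b then 1 else - 1) else 0)" for v
      unfolding x_def using linear_cmul[OF linear_coef[OF ind, of v]] by simp
    have "x \<in> V" unfolding x_def sp(2)[symmetric] by (intro span_scale span_base) (use w(1) M in blast)
    then have "x \<in> {x \<in> star_points \<sigma>. cross_point M (E \<union> W) x \<subseteq> U}"
      unfolding mem cox using w wb by (auto split: if_splits)
    then show "{x \<in> star_points \<sigma>. cross_point M (E \<union> W) x \<subseteq> U} \<noteq> {}" by blast
  qed
qed

section \<open>Homology of the links and the boundary of the fan\<close>

definition bd :: "'b set set" where
  "bd = {\<tau> \<in> T. \<exists>a\<in>F. \<forall>v\<in>\<tau>. crd (\<Psi> v) a = 0}"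

lemma bd_iff: "\<tau> \<in> bd \<longleftrightarrow> \<tau> \<in> T \<and> car \<tau> \<noteq> F"
proof (cases "\<tau> \<in> T")
  case True
  have "(\<forall>v\<in>\<tau>. crd (\<Psi> v) a = 0) \<longleftrightarrow> a \<notin> car \<tau>" if "a \<in> F" for a
    using crd_not_car[OF True, of _ a] that by (auto simp: car_def)
  then show ?thesis using True by (auto simp: bd_def) (auto simp: car_def)
qed (simp add: bd_def)

text \<open>For \<open>F = {}\<close> there is no coordinate to vanish and \<open>bd\<close> is
  void, hence not a complex. This is the case that \<open>theta_poly\<close> settles by
  convention.\<close>

lemma abstract_complex_bd:
  assumes "F \<noteq> {}" shows "abstract_complex bd"
proof (rule abstract_complexI)
  show "finite bd" using abstract_complexD(2)[OF complex] by (simp add: bd_def)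
  show "{} \<in> bd" using assms abstract_complexD(3)[OF complex] by (auto simp: bd_def)
  show "H \<in> bd" if "G \<in> bd" "H \<subseteq> G" for G H
    using that subT[of G H] unfolding bd_def by blast
qed (use finT in \<open>auto simp: bd_def\<close>)

text \<open>Both stratifications of \<open>star_points \<sigma>\<close> are coarser than the signs
  of \<open>A\<close>, so link and model have the same homology. For an interior face
  \<open>W\<close> is empty and the model is a cross-polytope; for a boundary face the simplex on
  \<open>W\<close> makes the model a cone. The link inside \<open>bd\<close> is compared with the
  boundary of the model.\<close>

lemma link_homology:
  assumes \<sigma>: "\<sigma> \<in> T"
  shows "\<sigma> \<notin> bd \<Longrightarrow> sphere_homology TYPE('k::field) (int (card F) - int (card \<sigma>) - 1) (link T \<sigma>)"
    and "\<sigma> \<in> bd \<Longrightarrow> acyclic_complex TYPE('k) (link T \<sigma>)"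
    and "\<sigma> \<in> bd \<Longrightarrow> sphere_homology TYPE('k) (int (card F) - int (card \<sigma>) - 2) (link bd \<sigma>)"
proof -
  define W where "W = \<Phi> ` (F - car \<sigma>)"
  obtain E where E: "\<Psi> ` \<sigma> \<inter> E = {}" "E \<inter> W = {}" "\<Psi> ` \<sigma> \<inter> W = {}"
    "independent (\<Psi> ` \<sigma> \<union> E \<union> W)"
    "span (\<Psi> ` \<sigma> \<union> E) = span (\<Phi> ` car \<sigma>)" "span (\<Psi> ` \<sigma> \<union> E \<union> W) = V"
    "finite E" "card E + card \<sigma> = card (car \<sigma>)"
    unfolding W_def by (rule adapted_basis[OF \<sigma>])
  define M where "M = \<Psi> ` \<sigma> \<union> E \<union> W"
  have ind: "independent M" using E(4) by (simp add: M_def)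
  have finW: "finite W" using finF by (simp add: W_def)
  define A where "A = (\<Union>\<tau>\<in>T. (\<lambda>b x. coef (\<Psi> ` \<tau>) x b) ` extend_basis (\<Psi> ` \<tau>)) \<union> (\<lambda>b x. coef M x b) ` (E \<union> W)"
  have finA: "finite A"
    unfolding A_def using abstract_complexD(2)[OF complex] finite_extend_basis[OF indep_ray] E(7) finW by blast
  have linA: "linear f" if "f \<in> A" for f
    using that linear_coef[OF indep_ray] linear_coef[OF ind] by (auto simp: A_def)
  have st1: "stratified A (star_points \<sigma>) (link T \<sigma>) (link_point \<sigma>)"
    by (rule star_stratified[OF \<sigma>]) (auto simp: A_def)
  have st2: "stratified A (star_points \<sigma>) (cross_simplex E W) (cross_point M (E \<union> W))"
    by (rule cross_stratified[OF \<sigma> M_def W_def E(1-3) ind E(5) E(6)[folded M_def]]) (auto simp: A_def)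
  note cxl = abstract_complex_link[OF complex \<sigma>] and cxm = abstract_complex_cross_simplex[OF E(7) finW]
  have hom: "same_homology TYPE('k) 0 (link T \<sigma>) (cross_simplex E W)"
    by (rule two_stratifications[OF finA linA cxl cxm st1 st2])
  have carF: "car \<sigma> \<subseteq> F" by (auto simp: car_def)
  have cW: "card W + card (car \<sigma>) = card F"
    unfolding W_def using card_image[OF inj_on_subset[OF inj], of "F - car \<sigma>"]
      card_Diff_subset[OF finite_subset[OF carF finF] carF] card_mono[OF finF carF] by simp
  show "sphere_homology TYPE('k) (int (card F) - int (card \<sigma>) - 1) (link T \<sigma>)" if "\<sigma> \<notin> bd"
  proof -
    have eq: "car \<sigma> = F" using that \<sigma> bd_iff by blast
    then have "W = {}" by (simp add: W_def)
    then have "sphere_homology TYPE('k) (int (card E) - 1) (cross_simplex E W)"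
      using cross_polytope_sphere[OF E(7)] by simp
    moreover have "int (card F) - int (card \<sigma>) - 1 + 0 = int (card E) - 1" using E(8) eq by simp
    ultimately show ?thesis using sphere_homology_shift[OF hom] by metis
  qed
  assume b: "\<sigma> \<in> bd"
  then have "F - car \<sigma> \<noteq> {}" using bd_iff carF by blast
  then obtain j where j: "j \<in> F - car \<sigma>" by blast
  then have jW: "\<Phi> j \<in> W" by (simp add: W_def)
  show "acyclic_complex TYPE('k) (link T \<sigma>)"
    using cross_simplex_acyclic[OF E(7) finW jW] same_homology_acyclic[OF hom] by blast
  have Fne: "F \<noteq> {}" using j by blast
  note cxb = abstract_complex_bd[OF Fne]
  have bdT: "bd \<subseteq> T" by (auto simp: bd_def)
  have sub1: "link bd \<sigma> \<subseteq> link T \<sigma>" using bdT by (auto simp: link_altdef)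
  have sub2: "cross_simplex_boundary E W \<subseteq> cross_simplex E W" by (auto simp: cross_simplex_boundary_def)
  have cxm': "abstract_complex (cross_simplex_boundary E W)"
    by (rule abstract_complex_cross_simplex_boundary[OF E(7) finW]) (use jW in blast)
  note cxl' = abstract_complex_link[OF cxb b]
  \<comment> \<open>Both conditions say that some coordinate of \<open>x\<close> outside
    \<open>car \<sigma>\<close> vanishes, so the two subcomplexes stratify the same set of
    points.\<close>
  have "link_point \<sigma> x \<in> link bd \<sigma> \<longleftrightarrow> cross_point M (E \<union> W) x \<in> cross_simplex_boundary E W"
    if x: "x \<in> star_points \<sigma>" for x
  proof -
    define \<tau> where "\<tau> = open_face \<sigma> x"
    have \<tau>: "\<tau> \<in> T" "\<sigma> \<subseteq> \<tau>" "in_open \<sigma> \<tau> x" using star_points_props[OF \<sigma> x] by (auto simp: \<tau>_def)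
    obtain c where c: "\<forall>v\<in>\<tau> - \<sigma>. 0 < c v" "x = (\<Sum>v\<in>\<tau>. c v *\<^sub>R \<Psi> v)"
      using \<tau>(3) unfolding in_open_def by blast
    have xV: "x \<in> V" and xnn: "\<And>j. j \<in> F - car \<sigma> \<Longrightarrow> 0 \<le> crd x j"
      using x by (auto simp: star_points_def star_cone_def)
    \<comment> \<open>The coordinate of \<open>x\<close> is a sum of nonnegative terms with positive
      weights, so it vanishes only if it vanishes at every ray of the open face of
      \<open>x\<close>.\<close>
    have zero: "crd x j = 0 \<longleftrightarrow> (\<forall>v\<in>\<tau>. crd (\<Psi> v) j = 0)" if j: "j \<in> F - car \<sigma>" for j
    proof -
      have nn: "0 \<le> c v * crd (\<Psi> v) j" if "v \<in> \<tau> - \<sigma>" for v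
        using c(1) that ray_nonneg[of v j] \<tau>(1) j by (intro mult_nonneg_nonneg) (auto simp: less_imp_le)
      have "crd x j = 0 \<longleftrightarrow> (\<forall>v\<in>\<tau> - \<sigma>. c v * crd (\<Psi> v) j = 0)"
        unfolding c(2) in_open_crd[OF \<tau>(1,2) j]
        by (rule sum_nonneg_eq_0_iff) (use finT[OF \<tau>(1)] nn in auto)
      also have "\<dots> \<longleftrightarrow> (\<forall>v\<in>\<tau>. crd (\<Psi> v) j = 0)"
        using c(1) crd_not_car[OF \<sigma> _ j] by (metis DiffD1 DiffI less_irrefl mult_eq_0_iff)
      finally show ?thesis .
    qed
    have "\<sigma> \<union> (\<tau> - \<sigma>) = \<tau>" using \<tau>(2) by blast
    then have "link_point \<sigma> x \<in> link bd \<sigma> \<longleftrightarrow> \<tau> \<in> bd"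
      by (auto simp: link_point_def link_altdef \<tau>_def)
    also have "\<dots> \<longleftrightarrow> (\<exists>j\<in>F - car \<sigma>. \<forall>v\<in>\<tau>. crd (\<Psi> v) j = 0)"
    proof
      assume "\<tau> \<in> bd"
      then obtain a where a: "a \<in> F" "\<forall>v\<in>\<tau>. crd (\<Psi> v) a = 0" by (auto simp: bd_def)
      then have "a \<notin> car \<sigma>" using \<tau>(2) by (force simp: car_def)
      then show "\<exists>j\<in>F - car \<sigma>. \<forall>v\<in>\<tau>. crd (\<Psi> v) j = 0" using a by blast
    qed (use \<tau>(1) in \<open>auto simp: bd_def\<close>)
    also have "\<dots> \<longleftrightarrow> (\<exists>j\<in>F - car \<sigma>. crd x j = 0)" using zero by blast
    also have "\<dots> \<longleftrightarrow> (\<exists>j\<in>F - car \<sigma>. \<not> 0 < coef M x (\<Phi> j))"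
    proof (rule bex_cong[OF refl])
      fix j assume j: "j \<in> F - car \<sigma>"
      have "coef M x (\<Phi> j) = crd x j"
        unfolding M_def W_def by (rule crd_eq_coef[OF \<sigma> _ _ E(5) j xV]) (use E(2-4) W_def in auto)
      then show "crd x j = 0 \<longleftrightarrow> \<not> 0 < coef M x (\<Phi> j)" using xnn[OF j] by auto
    qed
    also have "\<dots> \<longleftrightarrow> \<not> W \<times> {True} \<subseteq> cross_point M (E \<union> W) x"
      unfolding W_def cross_point_def by auto
    also have "\<dots> \<longleftrightarrow> cross_point M (E \<union> W) x \<in> cross_simplex_boundary E W"
    proof -
      have "cross_point M (E \<union> W) x \<in> cross_simplex E W" using st2 x by (auto simp: stratified_def)
      then show ?thesis by (simp add: cross_simplex_boundary_def)
    qed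
    finally show ?thesis .
  qed
  then have X: "{x \<in> star_points \<sigma>. link_point \<sigma> x \<in> link bd \<sigma>}
      = {x \<in> star_points \<sigma>. cross_point M (E \<union> W) x \<in> cross_simplex_boundary E W}" by blast
  have hom': "same_homology TYPE('k) 0 (link bd \<sigma>) (cross_simplex_boundary E W)"
    by (rule two_stratifications[OF finA linA cxl' cxm' stratified_subcomplex[OF st1 sub1 cxl']
        stratified_subcomplex[OF st2 sub2 cxm', folded X]])
  have "int (card F) - int (card \<sigma>) - 2 + 0 = int (card E) + int (card W) - 2" using E(8) cW by simp
  then show "sphere_homology TYPE('k) (int (card F) - int (card \<sigma>) - 2) (link bd \<sigma>)"
    using sphere_homology_shift[OF hom'] cross_simplex_boundary_sphere[OF E(7) finW jW E(2)] by metis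
qed

lemma card_face_le: assumes "\<tau> \<in> T" shows "card \<tau> \<le> card F"
proof -
  have "\<Psi> ` \<tau> \<subseteq> V" using assms ray_V by blast
  then have "card (\<Psi> ` \<tau>) \<le> dim V" using independent_card_le_dim[OF _ indep_ray[OF assms]] by blast
  then show ?thesis
    using card_image[OF inj_ray[OF assms]] card_image[OF inj] dim_eq_card_independent[OF indep] by simp
qed

text \<open>The rays of a boundary face are independent and lie in the span of all generators but
  one.\<close>

lemma card_bd_face_less: assumes "\<tau> \<in> bd" shows "card \<tau> < card F"
proof -
  obtain a where a: "a \<in> F" "\<forall>v\<in>\<tau>. crd (\<Psi> v) a = 0" and \<tau>: "\<tau> \<in> T" using assms by (auto simp: bd_def)
  have "\<Psi> v \<in> span (\<Phi> ` (F - {a}))" if v: "v \<in> \<tau>" for v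
  proof -
    have "\<Psi> v = (\<Sum>b\<in>F. crd (\<Psi> v) b *\<^sub>R \<Phi> b)" using v \<tau> by (intro crd_expand ray_V) auto
    also have "\<dots> = (\<Sum>b\<in>F - {a}. crd (\<Psi> v) b *\<^sub>R \<Phi> b)"
      using a v finF by (intro sum.mono_neutral_right) auto
    also have "\<dots> \<in> span (\<Phi> ` (F - {a}))" by (intro span_sum span_scale span_base imageI)
    finally show ?thesis .
  qed
  then have "card (\<Psi> ` \<tau>) \<le> card (\<Phi> ` (F - {a}))"
    using independent_card_le_dim[OF _ indep_ray[OF \<tau>], of "span (\<Phi> ` (F - {a}))"]
      dim_le_card[OF subset_refl, of "\<Phi> ` (F - {a})"] finF by (auto simp: image_subset_iff)
  also have "\<dots> \<le> card (F - {a})" using finF by (simp add: card_image_le)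
  also have "\<dots> < card F" using a(1) finF by (rule card_Diff1_less[rotated])
  finally show ?thesis using card_image[OF inj_ray[OF \<tau>]] by simp
qed

lemma link_empty_face: "link \<Delta> {} = \<Delta>"
  by (simp add: link_altdef)

lemma complex_dim_link:
  assumes "\<tau> \<in> T" "\<tau> \<notin> bd"
  shows "complex_dim (link T \<tau>) = int (card F) - int (card \<tau>) - 1"
\<comment> \<open>Dimension does not involve the field, so any field may supply the lower
  bound.\<close>
proof (rule sphere_homology_dim[OF link_homology(1)[OF assms, where 'k = real] abstract_complex_link[OF complex assms(1)]])
  fix \<rho> assume "\<rho> \<in> link T \<tau>"
  then have \<rho>: "\<tau> \<union> \<rho> \<in> T" "\<rho> \<inter> \<tau> = {}" by (auto simp: link_altdef)
  then have "card (\<tau> \<union> \<rho>) = card \<tau> + card \<rho>" using finT[OF \<rho>(1)] by (intro card_Un_disjoint) auto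
  then show "face_dim \<rho> \<le> int (card F) - int (card \<tau>) - 1"
    using card_face_le[OF \<rho>(1)] by (simp add: face_dim_def)
qed

lemma complex_dim_link_bd:
  assumes "\<tau> \<in> bd"
  shows "complex_dim (link bd \<tau>) = int (card F) - int (card \<tau>) - 2"
proof -
  have \<tau>: "\<tau> \<in> T" and ne: "F \<noteq> {}" using assms by (auto simp: bd_def)
  show ?thesis
  proof (rule sphere_homology_dim[OF link_homology(3)[OF \<tau> assms, where 'k = real]
        abstract_complex_link[OF abstract_complex_bd[OF ne] assms]])
    fix \<rho> assume "\<rho> \<in> link bd \<tau>"
    then have \<rho>: "\<tau> \<union> \<rho> \<in> bd" "\<rho> \<inter> \<tau> = {}" by (auto simp: link_altdef)
    then have "\<tau> \<union> \<rho> \<in> T" by (simp add: bd_def)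
    from finT[OF this] have "card (\<tau> \<union> \<rho>) = card \<tau> + card \<rho>" using \<rho>(2) by (intro card_Un_disjoint) auto
    then show "face_dim \<rho> \<le> int (card F) - int (card \<tau>) - 2"
      using card_bd_face_less[OF \<rho>(1)] by (simp add: face_dim_def)
  qed
qed

lemma complex_dim_bd: "F \<noteq> {} \<Longrightarrow> complex_dim bd = int (card F) - 2"
  using complex_dim_link_bd[of "{}"] abstract_complexD(3)[OF abstract_complex_bd]
  by (simp add: link_empty_face)

text \<open>The sum of all generators has only positive coordinates, so the open cone that contains
  it belongs to a face outside \<open>bd\<close>. The homology of the link of that face supplies a
  face of full size.\<close>

lemma complex_dim_fan: "complex_dim T = int (card F) - 1"
proof -
  obtain \<tau> b where \<tau>: "\<tau> \<in> T" "\<forall>v\<in>\<tau>. 0 < b v" "(\<Sum>a\<in>F. 1 *\<^sub>R \<Phi> a) = (\<Sum>v\<in>\<tau>. b v *\<^sub>R \<Psi> v)"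
    using cover[of "\<lambda>_. 1"] by auto
  have "\<tau> \<notin> bd"
  proof
    assume "\<tau> \<in> bd"
    then obtain a where a: "a \<in> F" "\<forall>v\<in>\<tau>. crd (\<Psi> v) a = 0" by (auto simp: bd_def)
    have "1 = crd (\<Sum>a\<in>F. 1 *\<^sub>R \<Phi> a) a" using crd_comb[OF a(1), of "\<lambda>_. 1"] by simp
    also have "\<dots> = 0" unfolding \<tau>(3) crd_sum using a(2) by simp
    finally show False by simp
  qed
  from link_homology(1)[OF \<tau>(1) this, where 'k = real]
  have "homology_field TYPE(real) (link T \<tau>) (int (card F) - int (card \<tau>) - 1)"
    by (simp add: sphere_homology_def)
  then obtain \<rho> where \<rho>: "\<rho> \<in> link T \<tau>" "face_dim \<rho> = int (card F) - int (card \<tau>) - 1"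
    using homology_field_face by blast
  then have u: "\<tau> \<union> \<rho> \<in> T" "\<rho> \<inter> \<tau> = {}" by (auto simp: link_altdef)
  then have "card (\<tau> \<union> \<rho>) = card \<tau> + card \<rho>" using finT[OF u(1)] by (intro card_Un_disjoint) auto
  then have "face_dim (\<tau> \<union> \<rho>) = int (card F) - 1" using \<rho>(2) by (simp add: face_dim_def)
  moreover have "face_dim G \<le> int (card F) - 1" if "G \<in> T" for G
    using card_face_le[OF that] by (simp add: face_dim_def)
  ultimately show ?thesis by (intro complex_dim_eqI[OF complex _ u(1)])
qed

lemma homology_ball:
  assumes ne: "F \<noteq> {}"
  shows "homology_ball_with_boundary TYPE('k::field) T bd"
  unfolding homology_ball_with_boundary_def
proof (intro conjI ballI allI)
  show "homology_sphere TYPE('k) bd"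
    unfolding homology_sphere_def
  proof (intro conjI ballI)
    show "abstract_complex bd" by (rule abstract_complex_bd[OF ne])
    fix \<tau> assume \<tau>: "\<tau> \<in> bd"
    then have "sphere_homology TYPE('k) (complex_dim (link bd \<tau>)) (link bd \<tau>)"
      using link_homology(3)[OF _ \<tau>] complex_dim_link_bd[OF \<tau>] by (simp add: bd_def)
    then show "\<forall>i. if i = complex_dim (link bd \<tau>) then homology_field TYPE('k) (link bd \<tau>) i
        else homology_zero TYPE('k) (link bd \<tau>) i"
      by (simp add: sphere_homology_def)
  qed
  show "complex_dim bd = complex_dim T - 1" using complex_dim_fan complex_dim_bd[OF ne] by simp
  fix \<tau> i assume \<tau>: "\<tau> \<in> T"
  show "if \<tau> \<notin> bd \<and> i = complex_dim (link T \<tau>) then homology_field TYPE('k) (link T \<tau>) i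
      else homology_zero TYPE('k) (link T \<tau>) i"
  proof (cases "\<tau> \<in> bd")
    case True
    then show ?thesis using link_homology(2)[OF \<tau> True, where 'k = 'k] by (simp add: acyclic_complex_def)
  next
    case False
    then show ?thesis using link_homology(1)[OF \<tau> False, where 'k = 'k] complex_dim_link[OF \<tau> False]
      by (simp add: sphere_homology_def)
  qed
qed (use complex in \<open>auto simp: bd_def\<close>)

end

section \<open>Geometric triangulations\<close>

lemma convex_hull_image:
  assumes fin: "finite F" and inj: "inj_on \<phi> F"
  shows "x \<in> convex hull (\<phi> ` F) \<longleftrightarrow> (\<exists>t. (\<forall>a\<in>F. 0 \<le> t a) \<and> sum t F = 1 \<and> x = (\<Sum>a\<in>F. t a *\<^sub>R \<phi> a))"
proof
  assume "x \<in> convex hull (\<phi> ` F)"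
  then obtain u where u: "\<forall>y\<in>\<phi> ` F. 0 \<le> u y" "sum u (\<phi> ` F) = 1" "(\<Sum>y\<in>\<phi> ` F. u y *\<^sub>R y) = x"
    unfolding convex_hull_finite[OF finite_imageI[OF fin]] by blast
  show "\<exists>t. (\<forall>a\<in>F. 0 \<le> t a) \<and> sum t F = 1 \<and> x = (\<Sum>a\<in>F. t a *\<^sub>R \<phi> a)"
    using u by (intro exI[of _ "\<lambda>a. u (\<phi> a)"]) (auto simp: sum.reindex[OF inj])
next
  assume "\<exists>t. (\<forall>a\<in>F. 0 \<le> t a) \<and> sum t F = 1 \<and> x = (\<Sum>a\<in>F. t a *\<^sub>R \<phi> a)"
  then show "x \<in> convex hull (\<phi> ` F)"
    using convex_sum[OF fin convex_convex_hull] hull_inc[of _ "\<phi> ` F" convex] by blast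
qed

lemma realizationD:
  assumes "geometric_realization \<Delta> \<phi>" "F \<in> \<Delta>"
  shows "inj_on \<phi> F" "\<not> affine_dependent (\<phi> ` F)"
  using assms inj_on_subset[of \<phi> "\<Union>\<Delta>" F] unfolding geometric_realization_def by blast+

lemma realization_face:
  assumes "geometric_realization \<Delta> \<phi>" "F \<in> \<Delta>" "G \<in> \<Delta>"
  shows "(convex hull (\<phi> ` F) \<inter> convex hull (\<phi> ` G)) face_of convex hull (\<phi> ` F)"
  using assms unfolding geometric_realization_def simplicial_complex_def geometric_face_def by blast

lemma interior_point:
  assumes real: "geometric_realization \<Delta> \<phi>" and F: "F \<in> \<Delta>"
    and t: "\<And>a. a \<in> F \<Longrightarrow> 0 < t a" "sum t F = 1"
  shows "(\<Sum>a\<in>F. t a *\<^sub>R \<phi> a) \<in> rel_interior (convex hull (\<phi> ` F))"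
  unfolding rel_interior_convex_hull_explicit[OF realizationD(2)[OF real F]] mem_Collect_eq
proof (intro exI[of _ "\<lambda>y. t (inv_into F \<phi> y)"] conjI ballI)
  note inj = realizationD(1)[OF real F]
  show "0 < t (inv_into F \<phi> y)" if "y \<in> \<phi> ` F" for y using t(1) inv_into_into[OF that] .
  show "(\<Sum>y\<in>\<phi> ` F. t (inv_into F \<phi> y)) = 1" using t(2) by (simp add: sum.reindex[OF inj] inj)
  show "(\<Sum>y\<in>\<phi> ` F. t (inv_into F \<phi> y) *\<^sub>R y) = (\<Sum>a\<in>F. t a *\<^sub>R \<phi> a)"
    by (simp add: sum.reindex[OF inj] inj)
qed

text \<open>At height one, affine independence becomes linear independence, and a conic combination
  records its total weight in the last coordinate.\<close>

definition homogenize :: "('a \<Rightarrow> 'e::euclidean_space) \<Rightarrow> 'a \<Rightarrow> 'e \<times> real" where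
  "homogenize \<phi> a = (\<phi> a, 1)"

lemma homogenize_sum: "(\<Sum>a\<in>F. t a *\<^sub>R homogenize \<phi> a) = ((\<Sum>a\<in>F. t a *\<^sub>R \<phi> a), sum t F)"
  by (simp add: homogenize_def sum_prod)

lemma realization_independent:
  assumes real: "geometric_realization \<Delta> \<phi>" and F: "F \<in> \<Delta>" "finite F"
    and z: "(\<Sum>a\<in>F. t a *\<^sub>R homogenize \<phi> a) = 0" and a: "a \<in> F"
  shows "t a = 0"
proof (rule ccontr)
  assume nz: "t a \<noteq> 0"
  note inj = realizationD(1)[OF real F(1)]
  have "sum t F = 0" "(\<Sum>a\<in>F. t a *\<^sub>R \<phi> a) = 0"
    using z unfolding homogenize_sum by (simp_all add: zero_prod_def)
  then have "affine_dependent (\<phi> ` F)"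
    unfolding affine_dependent_explicit_finite[OF finite_imageI[OF F(2)]] using nz a
    by (intro exI[of _ "\<lambda>y. t (inv_into F \<phi> y)"])
      (auto simp: sum.reindex[OF inj] inj)
  then show False using realizationD(2)[OF real F(1)] by simp
qed

text \<open>Normalized to total weight one, the common vector gives a point in the relative interior
  of both hulls. Their intersection is a face of each, so the hulls agree, and the vertices are
  recovered as extreme points.\<close>

lemma realization_subset:
  assumes real: "geometric_realization \<Delta> \<phi>" and FG: "F \<in> \<Delta>" "G \<in> \<Delta>" and fin: "finite F" "finite G"
    and a: "\<And>v. v \<in> F \<Longrightarrow> 0 < a v" and b: "\<And>v. v \<in> G \<Longrightarrow> 0 < b v"
    and eq: "(\<Sum>v\<in>F. a v *\<^sub>R homogenize \<phi> v) = (\<Sum>v\<in>G. b v *\<^sub>R homogenize \<phi> v)"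
  shows "F \<subseteq> G"
proof (cases "F = {}")
  case False
  have eqs: "sum a F = sum b G" "(\<Sum>v\<in>F. a v *\<^sub>R \<phi> v) = (\<Sum>v\<in>G. b v *\<^sub>R \<phi> v)"
    using eq unfolding homogenize_sum by auto
  define s where "s = sum a F"
  have s: "0 < s" unfolding s_def by (rule sum_pos[OF fin(1) False a])
  define x where "x = (\<Sum>v\<in>F. (a v / s) *\<^sub>R \<phi> v)"
  have x2: "x = (\<Sum>v\<in>G. (b v / s) *\<^sub>R \<phi> v)"
  proof -
    have "(\<Sum>v\<in>H. (c v / s) *\<^sub>R \<phi> v) = (1 / s) *\<^sub>R (\<Sum>v\<in>H. c v *\<^sub>R \<phi> v)" for H c
      by (simp add: scaleR_sum_right)
    then show ?thesis unfolding x_def using eqs(2) by metis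
  qed
  have sums: "(\<Sum>v\<in>F. a v / s) = 1" "(\<Sum>v\<in>G. b v / s) = 1"
    using s eqs(1) by (simp_all add: s_def flip: sum_divide_distrib)
  let ?F = "convex hull (\<phi> ` F)" and ?G = "convex hull (\<phi> ` G)"
  have xF: "x \<in> rel_interior ?F" unfolding x_def using a s by (intro interior_point[OF real FG(1)] sums) simp
  have xG: "x \<in> rel_interior ?G" unfolding x2 using b s by (intro interior_point[OF real FG(2)] sums) simp
  have 1: "?F \<subseteq> ?F \<inter> ?G"
    by (rule subset_of_face_of[OF realization_face[OF real FG] subset_refl])
      (use xF xG rel_interior_subset in blast)
  have 2: "?G \<subseteq> ?G \<inter> ?F"
    by (rule subset_of_face_of[OF realization_face[OF real FG(2,1)] subset_refl])
      (use xF xG rel_interior_subset in blast)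
  have "?F = ?G" using 1 2 by blast
  then have "y \<in> \<phi> ` F \<longleftrightarrow> y \<in> \<phi> ` G" for y
    using extreme_point_of_convex_hull_affine_independent[OF realizationD(2)[OF real FG(1)], of y]
      extreme_point_of_convex_hull_affine_independent[OF realizationD(2)[OF real FG(2)], of y] by simp
  then have "\<phi> ` F \<subseteq> \<phi> ` G" by blast
  moreover have "inj_on \<phi> (\<Union>\<Delta>)" using real by (simp add: geometric_realization_def)
  ultimately show ?thesis using inj_on_image_subset_iff[of \<phi> "\<Union>\<Delta>" F G] FG by blast
qed simp

lemma realization_unique:
  assumes real: "geometric_realization \<Delta> \<phi>" and FG: "F \<in> \<Delta>" "G \<in> \<Delta>" and fin: "finite F" "finite G"
    and a: "\<And>v. v \<in> F \<Longrightarrow> 0 < a v" and b: "\<And>v. v \<in> G \<Longrightarrow> 0 < b v"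
    and eq: "(\<Sum>v\<in>F. a v *\<^sub>R homogenize \<phi> v) = (\<Sum>v\<in>G. b v *\<^sub>R homogenize \<phi> v)"
  shows "F = G \<and> (\<forall>v\<in>F. a v = b v)"
proof -
  have FG': "F = G"
    using realization_subset[OF real FG fin a b eq]
      realization_subset[OF real FG(2,1) fin(2,1) b a eq[symmetric]] by blast
  have "(\<Sum>v\<in>F. (a v - b v) *\<^sub>R homogenize \<phi> v) = 0"
    using eq FG' by (simp add: scaleR_diff_left sum_subtractf)
  then show ?thesis using realization_independent[OF real FG(1) fin(1), of "\<lambda>v. a v - b v"] FG' by simp
qed

text \<open>A realization provides that two hulls meet in a common face; which vertices span it
  comes from comparing supports. By \<open>realization_unique\<close> both expressions of a common
  point have the same support, which then lies in \<open>F \<inter> G\<close>.\<close>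

lemma hull_Int:
  assumes cx: "abstract_complex \<Delta>" and real: "geometric_realization \<Delta> \<phi>" and FG: "F \<in> \<Delta>" "G \<in> \<Delta>"
  shows "convex hull (\<phi> ` F) \<inter> convex hull (\<phi> ` G) \<subseteq> convex hull (\<phi> ` (F \<inter> G))"
proof
  note fin = abstract_complexD(5)[OF cx FG(1)] abstract_complexD(5)[OF cx FG(2)]
  fix x assume x: "x \<in> convex hull (\<phi> ` F) \<inter> convex hull (\<phi> ` G)"
  then obtain t where t: "\<forall>a\<in>F. 0 \<le> t a" "sum t F = 1" "x = (\<Sum>a\<in>F. t a *\<^sub>R \<phi> a)"
    using convex_hull_image[OF fin(1) realizationD(1)[OF real FG(1)], of x] by blast
  obtain u where u: "\<forall>a\<in>G. 0 \<le> u a" "sum u G = 1" "x = (\<Sum>a\<in>G. u a *\<^sub>R \<phi> a)"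
    using x convex_hull_image[OF fin(2) realizationD(1)[OF real FG(2)], of x] by blast
  have supp: "(\<Sum>a\<in>{a \<in> H. 0 < c a}. c a *\<^sub>R y a) = (\<Sum>a\<in>H. c a *\<^sub>R y a)"
    if "finite H" "\<forall>a\<in>H. 0 \<le> c a" for H c and y :: "'a \<Rightarrow> 'c::real_vector"
    by (rule sum.mono_neutral_left) (use that in \<open>auto simp: order_le_less\<close>)
  let ?F = "{a \<in> F. 0 < t a}" and ?G = "{a \<in> G. 0 < u a}"
  have eq: "(\<Sum>a\<in>?F. t a *\<^sub>R homogenize \<phi> a) = (\<Sum>a\<in>?G. u a *\<^sub>R homogenize \<phi> a)"
    unfolding supp[OF fin(1) t(1)] supp[OF fin(2) u(1)] unfolding homogenize_sum using t u by simp
  have "?F \<in> \<Delta>" by (rule abstract_complexD(4)[OF cx FG(1)]) simp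
  moreover have "?G \<in> \<Delta>" by (rule abstract_complexD(4)[OF cx FG(2)]) simp
  ultimately have "?F = ?G \<and> (\<forall>v\<in>?F. t v = u v)"
    by (rule realization_unique[OF real _ _ _ _ _ _ eq]) (simp_all add: fin)
  then have "?F = ?G" by (rule conjunct1)
  then have sub: "?F \<subseteq> F \<inter> G" by blast
  have zero: "\<forall>a\<in>F - F \<inter> G. t a = 0" using t(1) sub by (auto simp: order_le_less)
  have "sum t (F \<inter> G) = sum t F" by (rule sum.mono_neutral_left[OF fin(1) _ zero]) simp
  then have "sum t (F \<inter> G) = 1" using t(2) by simp
  moreover have "x = (\<Sum>a\<in>F \<inter> G. t a *\<^sub>R \<phi> a)"
    unfolding t(3) by (rule sum.mono_neutral_right[OF fin(1)]) (use zero in auto)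
  moreover have "inj_on \<phi> (F \<inter> G)" using realizationD(1)[OF real FG(1)] inj_on_subset by blast
  ultimately show "x \<in> convex hull (\<phi> ` (F \<inter> G))"
    using convex_hull_image[of "F \<inter> G" \<phi> x] fin(1) t(1) by auto
qed

section \<open>Carriers and restrictions of a triangulation\<close>

locale triangulated =
  fixes \<Delta> :: "'a set set" and \<phi> :: "'a \<Rightarrow> 'e::euclidean_space"
    and \<Delta>' :: "'b set set" and \<psi> :: "'b \<Rightarrow> 'e"
  assumes cx: "abstract_complex \<Delta>" and cx': "abstract_complex \<Delta>'"
    and tri: "triangulates \<Delta> \<phi> \<Delta>' \<psi>"
begin

lemma real: "geometric_realization \<Delta> \<phi>" and real': "geometric_realization \<Delta>' \<psi>"
  using tri by (auto simp: triangulates_def)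

abbreviation car :: "'b set \<Rightarrow> 'a set" where "car \<equiv> carrier_face \<Delta> \<phi> \<psi>"

text \<open>By \<open>hull_Int\<close> the faces whose hull contains that of \<open>\<tau>\<close>
  are closed under intersection, so a minimal one is the least, and the definite description in
  \<open>carrier_face\<close> is justified.\<close>

lemma carrier:
  assumes \<tau>: "\<tau> \<in> \<Delta>'"
  shows carrier_in: "car \<tau> \<in> \<Delta>"
    and carrier_hull: "convex hull (\<psi> ` \<tau>) \<subseteq> convex hull (\<phi> ` car \<tau>)"
    and carrier_least: "\<And>G. G \<in> \<Delta> \<Longrightarrow> convex hull (\<psi> ` \<tau>) \<subseteq> convex hull (\<phi> ` G) \<Longrightarrow> car \<tau> \<subseteq> G"
proof -
  let ?P = "\<lambda>G. G \<in> \<Delta> \<and> convex hull (\<psi> ` \<tau>) \<subseteq> convex hull (\<phi> ` G)"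
  have "\<exists>G. ?P G" using tri \<tau> unfolding triangulates_def geometric_face_def by blast
  then have ne: "{G. ?P G} \<noteq> {}" by simp
  have "finite {G. ?P G}" by (rule finite_subset[OF _ abstract_complexD(2)[OF cx]]) auto
  then obtain C where C0: "C \<in> {G. ?P G}" and min: "\<forall>G\<in>{G. ?P G}. G \<subseteq> C \<longrightarrow> C = G"
    using finite_has_minimal[OF _ ne] by auto
  have C: "?P C" using C0 by simp
  have least: "C \<subseteq> G" if G: "?P G" for G
  proof -
    have "convex hull (\<psi> ` \<tau>) \<subseteq> convex hull (\<phi> ` (C \<inter> G))"
      using hull_Int[OF cx real, of C G] C G by blast
    moreover have "C \<inter> G \<in> \<Delta>" using abstract_complexD(4)[OF cx, of C "C \<inter> G"] C by blast
    ultimately have "C = C \<inter> G" using bspec[OF min, of "C \<inter> G"] by simp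
    then show ?thesis by blast
  qed
  have "car \<tau> = C"
    unfolding carrier_face_def geometric_face_def
  proof (rule the_equality)
    fix G assume G: "G \<in> \<Delta> \<and> convex hull (\<psi> ` \<tau>) \<subseteq> convex hull (\<phi> ` G) \<and>
      (\<forall>H\<in>\<Delta>. convex hull (\<psi> ` \<tau>) \<subseteq> convex hull (\<phi> ` H) \<longrightarrow> G \<subseteq> H)"
    show "G = C" by (rule subset_antisym) (use G C least[of G] in auto)
  qed (use C least in blast)
  then show "car \<tau> \<in> \<Delta>" "convex hull (\<psi> ` \<tau>) \<subseteq> convex hull (\<phi> ` car \<tau>)"
    "\<And>G. G \<in> \<Delta> \<Longrightarrow> convex hull (\<psi> ` \<tau>) \<subseteq> convex hull (\<phi> ` G) \<Longrightarrow> car \<tau> \<subseteq> G"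
    using C least by blast+
qed

lemma carrier_subset_iff:
  assumes "\<tau> \<in> \<Delta>'" "F \<in> \<Delta>"
  shows "car \<tau> \<subseteq> F \<longleftrightarrow> convex hull (\<psi> ` \<tau>) \<subseteq> convex hull (\<phi> ` F)"
  using carrier_least[OF assms] carrier_hull[OF assms(1)] hull_mono[OF image_mono, of "car \<tau>" F convex \<phi>]
  by blast

abbreviation restr :: "'a set \<Rightarrow> 'b set set" where "restr \<equiv> restriction \<Delta> \<phi> \<Delta>' \<psi>"

lemma restr_eq:
  assumes "F \<in> \<Delta>"
  shows "restr F = {\<tau> \<in> \<Delta>'. convex hull (\<psi> ` \<tau>) \<subseteq> convex hull (\<phi> ` F)}"
  using carrier_subset_iff[OF _ assms] by (auto simp: restriction_def)

lemma abstract_complex_restr: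
  assumes "F \<in> \<Delta>" shows "abstract_complex (restr F)"
proof (rule abstract_complexI)
  show "finite (restr F)" using abstract_complexD(2)[OF cx'] by (simp add: restriction_def)
  show "{} \<in> restr F" using abstract_complexD(3)[OF cx'] by (simp add: restr_eq[OF assms])
  show "finite G" if "G \<in> restr F" for G
    using abstract_complexD(5)[OF cx'] that by (simp add: restriction_def)
  show "H \<in> restr F" if "G \<in> restr F" "H \<subseteq> G" for G H
    using that abstract_complexD(4)[OF cx', of G H] hull_mono[OF image_mono[OF that(2)], of convex \<psi>]
    by (auto simp: restr_eq[OF assms])
qed

text \<open>After normalization a point of the simplex \<open>F\<close> lies in the relative
  interior of some face of \<open>\<Delta>'\<close>. The issue is that this face lies entirely in
  \<open>F\<close>.\<close>

lemma cover_restr: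
  assumes F: "F \<in> \<Delta>" and t: "\<And>a. a \<in> F \<Longrightarrow> 0 \<le> t a"
  shows "\<exists>\<tau>\<in>restr F. \<exists>b. (\<forall>v\<in>\<tau>. 0 < b v) \<and>
    (\<Sum>a\<in>F. t a *\<^sub>R homogenize \<phi> a) = (\<Sum>v\<in>\<tau>. b v *\<^sub>R homogenize \<psi> v)"
proof -
  note finF = abstract_complexD(5)[OF cx F]
  define s where "s = sum t F"
  show ?thesis
  proof (cases "s = 0")
    \<comment> \<open>Weight zero gives the origin, which is the open cone of the empty
      face.\<close>
    case True
    then have "\<forall>a\<in>F. t a = 0" using sum_nonneg_eq_0_iff[OF finF t] by (simp add: s_def)
    then show ?thesis
      using abstract_complexD(3)[OF abstract_complex_restr[OF F]] by (intro bexI[of _ "{}"]) auto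
  next
    case False
    moreover have "0 \<le> s" unfolding s_def by (rule sum_nonneg) (rule t)
    ultimately have s: "0 < s" by simp
    define x where "x = (\<Sum>a\<in>F. (t a / s) *\<^sub>R \<phi> a)"
    have xF: "x \<in> convex hull (\<phi> ` F)"
      unfolding convex_hull_image[OF finF realizationD(1)[OF real F]] x_def using t s
      by (intro exI[of _ "\<lambda>a. t a / s"]) (auto simp: s_def simp flip: sum_divide_distrib)
    then obtain \<tau>1 where \<tau>1: "\<tau>1 \<in> \<Delta>'" "x \<in> convex hull (\<psi> ` \<tau>1)"
      using tri F unfolding triangulates_def geometric_face_def by blast
    note fin1 = abstract_complexD(5)[OF cx' \<tau>1(1)]
    obtain u where u: "\<forall>v\<in>\<tau>1. 0 \<le> u v" "sum u \<tau>1 = 1" "x = (\<Sum>v\<in>\<tau>1. u v *\<^sub>R \<psi> v)"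
      using \<tau>1(2) convex_hull_image[OF fin1 realizationD(1)[OF real' \<tau>1(1)], of x] by blast
    define \<tau> where "\<tau> = {v \<in> \<tau>1. 0 < u v}"
    have \<tau>: "\<tau> \<in> \<Delta>'" using abstract_complexD(4)[OF cx' \<tau>1(1), of \<tau>] by (auto simp: \<tau>_def)
    have zero: "\<forall>v\<in>\<tau>1 - \<tau>. u v = 0" and sub: "\<tau> \<subseteq> \<tau>1"
      using u(1) by (auto simp: \<tau>_def order_le_less)
    have "sum u \<tau> = sum u \<tau>1" by (rule sum.mono_neutral_left[OF fin1 sub zero])
    then have usum: "sum u \<tau> = 1" using u(2) by simp
    have xsum: "x = (\<Sum>v\<in>\<tau>. u v *\<^sub>R \<psi> v)"
      unfolding u(3) by (rule sum.mono_neutral_right[OF fin1 sub]) (use zero in auto)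
    have xi: "x \<in> rel_interior (convex hull (\<psi> ` \<tau>))"
      unfolding xsum by (rule interior_point[OF real' \<tau> _ usum]) (simp add: \<tau>_def)
    let ?C = "convex hull (\<phi> ` car \<tau>)"
    \<comment> \<open>The simplex \<open>F\<close> meets the carrier of \<open>\<tau>\<close> in a
      face of that carrier. This face contains a relative interior point of the hull of
      \<open>\<tau>\<close>, hence the whole hull.\<close>
    have "convex hull (\<psi> ` \<tau>) \<subseteq> ?C \<inter> convex hull (\<phi> ` F)"
      using xi xF carrier_hull[OF \<tau>] rel_interior_subset
      by (intro subset_of_face_of[OF realization_face[OF real carrier_in[OF \<tau>] F]]) blast+
    then have "\<tau> \<in> restr F" using \<tau> by (simp add: restr_eq[OF F])
    moreover have "(\<Sum>a\<in>F. t a *\<^sub>R homogenize \<phi> a) = (\<Sum>v\<in>\<tau>. (s * u v) *\<^sub>R homogenize \<psi> v)"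
    proof -
      have "(\<Sum>a\<in>F. t a *\<^sub>R \<phi> a) = s *\<^sub>R x" using s by (simp add: x_def scaleR_sum_right)
      also have "\<dots> = (\<Sum>v\<in>\<tau>. (s * u v) *\<^sub>R \<psi> v)" unfolding xsum by (simp add: scaleR_sum_right)
      finally have "(\<Sum>a\<in>F. t a *\<^sub>R \<phi> a) = (\<Sum>v\<in>\<tau>. (s * u v) *\<^sub>R \<psi> v)" .
      moreover have "sum t F = (\<Sum>v\<in>\<tau>. s * u v)" using usum by (simp add: s_def flip: sum_distrib_left)
      ultimately show ?thesis unfolding homogenize_sum by simp
    qed
    moreover have "\<forall>v\<in>\<tau>. 0 < s * u v" using s by (simp add: \<tau>_def)
    ultimately show ?thesis by (intro bexI[of _ \<tau>] exI[of _ "\<lambda>v. s * u v"]) auto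
  qed
qed

lemma vertex_coords:
  assumes F: "F \<in> \<Delta>" and v: "v \<in> \<Union>(restr F)"
  shows "\<exists>t. (\<forall>a\<in>F. 0 \<le> t a) \<and> homogenize \<psi> v = (\<Sum>a\<in>F. t a *\<^sub>R homogenize \<phi> a)"
proof -
  obtain \<tau> where "v \<in> \<tau>" "convex hull (\<psi> ` \<tau>) \<subseteq> convex hull (\<phi> ` F)"
    using v by (auto simp: restr_eq[OF F])
  then have "\<psi> v \<in> convex hull (\<phi> ` F)" using hull_inc[of "\<psi> v" "\<psi> ` \<tau>" convex] by blast
  then show ?thesis
    unfolding convex_hull_image[OF abstract_complexD(5)[OF cx F] realizationD(1)[OF real F]] homogenize_sum
    by (auto simp: homogenize_def)
qed

lemma fan:
  assumes F: "F \<in> \<Delta>"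
  shows "simplex_fan F (homogenize \<phi>) (restr F) (homogenize \<psi>)"
proof
  note finF = abstract_complexD(5)[OF cx F]
  show "finite F" "abstract_complex (restr F)" by (rule finF, rule abstract_complex_restr[OF F])
  show inj: "inj_on (homogenize \<phi>) F"
    using realizationD(1)[OF real F] by (auto simp: inj_on_def homogenize_def)
  have "u w = 0" if "(\<Sum>w\<in>homogenize \<phi> ` F. u w *\<^sub>R w) = 0" "w \<in> homogenize \<phi> ` F" for u w
    using that realization_independent[OF real F finF, of "\<lambda>a. u (homogenize \<phi> a)"]
    by (auto simp: sum.reindex[OF inj])
  then show "independent (homogenize \<phi> ` F)"
    using dependent_finite[of "homogenize \<phi> ` F"] finF by blast
  show "\<tau> = \<tau>' \<and> (\<forall>v\<in>\<tau>. a v = b v)"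
    if "\<tau> \<in> restr F" "\<tau>' \<in> restr F" "\<And>v. v \<in> \<tau> \<Longrightarrow> 0 < a v" "\<And>v. v \<in> \<tau>' \<Longrightarrow> 0 < b v"
      "(\<Sum>v\<in>\<tau>. a v *\<^sub>R homogenize \<psi> v) = (\<Sum>v\<in>\<tau>'. b v *\<^sub>R homogenize \<psi> v)" for \<tau> \<tau>' a b
  proof -
    have "\<tau> \<in> \<Delta>'" "\<tau>' \<in> \<Delta>'" using that(1,2) by (auto simp: restriction_def)
    then show ?thesis
      using realization_unique[OF real' _ _ _ _ that(3-5)] abstract_complexD(5)[OF cx'] by blast
  qed
  show "\<exists>t. (\<forall>a\<in>F. 0 \<le> t a) \<and> homogenize \<psi> v = (\<Sum>a\<in>F. t a *\<^sub>R homogenize \<phi> a)"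
    if "v \<in> \<Union>(restr F)" for v by (rule vertex_coords[OF F that])
  show "\<exists>\<tau>\<in>restr F. \<exists>b. (\<forall>v\<in>\<tau>. 0 < b v) \<and>
      (\<Sum>a\<in>F. t a *\<^sub>R homogenize \<phi> a) = (\<Sum>v\<in>\<tau>. b v *\<^sub>R homogenize \<psi> v)"
    if "\<And>a. a \<in> F \<Longrightarrow> 0 \<le> t a" for t by (rule cover_restr[OF F that])
qed

text \<open>The coordinate at \<open>a\<close> vanishes at all vertices of a face exactly when the
  face lies in the facet of \<open>F\<close> opposite \<open>a\<close>, that is, when its carrier
  misses \<open>a\<close>.\<close>

lemma fan_boundary:
  assumes F: "F \<in> \<Delta>"
  shows "simplex_fan.bd F (homogenize \<phi>) (restr F) (homogenize \<psi>) = {\<tau> \<in> \<Delta>'. car \<tau> \<subset> F}"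
proof -
  interpret fn: simplex_fan F "homogenize \<phi>" "restr F" "homogenize \<psi>" by (rule fan[OF F])
  note finF = abstract_complexD(5)[OF cx F]
  have "(\<exists>a\<in>F. \<forall>v\<in>\<tau>. fn.crd (homogenize \<psi> v) a = 0) \<longleftrightarrow> car \<tau> \<noteq> F" if \<tau>: "\<tau> \<in> restr F" for \<tau>
  proof
    have \<tau>': "\<tau> \<in> \<Delta>'" "car \<tau> \<subseteq> F" using \<tau> by (auto simp: restriction_def)
    {
      assume "car \<tau> \<noteq> F"
      then obtain a where a: "a \<in> F" "a \<notin> car \<tau>" using \<tau>' by blast
      have "fn.crd (homogenize \<psi> v) a = 0" if v: "v \<in> \<tau>" for v
      proof -
        have "\<tau> \<in> restr (car \<tau>)" using \<tau>' by (simp add: restriction_def)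
        then obtain t where t: "homogenize \<psi> v = (\<Sum>b\<in>car \<tau>. t b *\<^sub>R homogenize \<phi> b)"
          using vertex_coords[OF carrier_in[OF \<tau>'(1)]] v by blast
        also have "\<dots> = (\<Sum>b\<in>F. (if b \<in> car \<tau> then t b else 0) *\<^sub>R homogenize \<phi> b)"
          using \<tau>'(2) finF by (intro sum.mono_neutral_cong_left) auto
        finally show ?thesis using fn.crd_comb[OF a(1)] a(2) by simp
      qed
      then show "\<exists>a\<in>F. \<forall>v\<in>\<tau>. fn.crd (homogenize \<psi> v) a = 0" using a(1) by blast
    next
      assume "\<exists>a\<in>F. \<forall>v\<in>\<tau>. fn.crd (homogenize \<psi> v) a = 0"
      then obtain a where a: "a \<in> F" "\<forall>v\<in>\<tau>. fn.crd (homogenize \<psi> v) a = 0" by blast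
      have Fa: "F - {a} \<in> \<Delta>" using abstract_complexD(4)[OF cx F] by blast
      have "\<psi> v \<in> convex hull (\<phi> ` (F - {a}))" if v: "v \<in> \<tau>" for v
      proof -
        have vU: "v \<in> \<Union>(restr F)" using v \<tau> by blast
        let ?t = "fn.crd (homogenize \<psi> v)"
        have "homogenize \<psi> v = (\<Sum>b\<in>F. ?t b *\<^sub>R homogenize \<phi> b)"
          by (rule fn.crd_expand[OF fn.ray_V[OF vU]])
        also have "\<dots> = (\<Sum>b\<in>F - {a}. ?t b *\<^sub>R homogenize \<phi> b)"
          using a v finF by (intro sum.mono_neutral_right) auto
        finally have "\<psi> v = (\<Sum>b\<in>F - {a}. ?t b *\<^sub>R \<phi> b)" "sum ?t (F - {a}) = 1"
          unfolding homogenize_sum by (auto simp: homogenize_def)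
        then show ?thesis
          unfolding convex_hull_image[OF finite_Diff[OF finF] realizationD(1)[OF real Fa]]
          using fn.ray_nonneg[OF vU] by (intro exI[of _ ?t]) auto
      qed
      then have "convex hull (\<psi> ` \<tau>) \<subseteq> convex hull (\<phi> ` (F - {a}))"
        by (intro hull_minimal convex_convex_hull) blast
      then have "car \<tau> \<subseteq> F - {a}" by (rule carrier_least[OF \<tau>'(1) Fa])
      then show "car \<tau> \<noteq> F" using a(1) by blast
    }
  qed
  then show ?thesis unfolding fn.bd_def by (auto simp: restriction_def)
qed

lemma restr_ball:
  assumes F: "F \<in> \<Delta>" "F \<noteq> {}"
  shows "ball_boundary TYPE('k::field) (restr F) = {\<tau> \<in> \<Delta>'. car \<tau> \<subset> F}"
    "complex_dim {\<tau> \<in> \<Delta>'. car \<tau> \<subset> F} = int (card F) - 2"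
    "abstract_complex {\<tau> \<in> \<Delta>'. car \<tau> \<subset> F}"
proof -
  interpret fn: simplex_fan F "homogenize \<phi>" "restr F" "homogenize \<psi>" by (rule fan[OF F(1)])
  note eq = fan_boundary[OF F(1), symmetric]
  show "ball_boundary TYPE('k) (restr F) = {\<tau> \<in> \<Delta>'. car \<tau> \<subset> F}"
    unfolding eq by (rule homology_ball_boundary_unique[OF fn.homology_ball[OF F(2)]])
  show "complex_dim {\<tau> \<in> \<Delta>'. car \<tau> \<subset> F} = int (card F) - 2"
    unfolding eq by (rule fn.complex_dim_bd[OF F(2)])
  show "abstract_complex {\<tau> \<in> \<Delta>'. car \<tau> \<subset> F}"
    unfolding eq by (rule fn.abstract_complex_bd[OF F(2)])
qed

lemma complex_dim_restr: "F \<in> \<Delta> \<Longrightarrow> complex_dim (restr F) = int (card F) - 1"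
  by (rule simplex_fan.complex_dim_fan[OF fan])

lemma card_le_carrier:
  assumes "\<tau> \<in> \<Delta>'" shows "card \<tau> \<le> card (car \<tau>)"
  by (rule simplex_fan.card_face_le[OF fan[OF carrier_in[OF assms]]])
    (use assms in \<open>simp add: restriction_def\<close>)

end

section \<open>Counting faces by carrier\<close>

abbreviation px :: "int poly" where "px \<equiv> [:0, 1:]"
abbreviation py :: "int poly" where "py \<equiv> [:1, - 1:]"

lemma py_eq: "py = 1 - px"
  by (simp add: one_pCons)

lemma card_le_complex_dim:
  assumes "abstract_complex \<Delta>" "F \<in> \<Delta>" "complex_dim \<Delta> = int n - 1"
  shows "card F \<le> n"
proof -
  have "face_dim F \<le> complex_dim \<Delta>"
    unfolding complex_dim_def using abstract_complexD(2)[OF assms(1)] assms(2) by (intro Max_ge) auto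
  then show ?thesis using assms(3) by (simp add: face_dim_def)
qed

section \<open>Face sums and pure complexes\<close>

lemma h_poly_sum:
  assumes cx: "abstract_complex \<Delta>" and d: "complex_dim \<Delta> = int n - 1"
  shows "h_poly \<Delta> = (\<Sum>F\<in>\<Delta>. px ^ card F * py ^ (n - card F))"
proof -
  have n: "nat (complex_dim \<Delta> + 1) = n" using d by simp
  have fn: "of_nat (face_number \<Delta> (int i - 1)) * px ^ i * py ^ (n - i)
      = (\<Sum>F\<in>{F \<in> \<Delta>. card F = i}. px ^ card F * py ^ (n - card F))" for i
    by (simp add: face_number_def face_dim_def mult.assoc)
  have "h_poly \<Delta> = (\<Sum>i=0..n. \<Sum>F\<in>{F \<in> \<Delta>. card F = i}. px ^ card F * py ^ (n - card F))"
    unfolding h_poly_def Let_def n fn ..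
  also have "\<dots> = (\<Sum>F\<in>\<Delta>. px ^ card F * py ^ (n - card F))"
    by (rule sum.group) (use abstract_complexD(2)[OF cx] card_le_complex_dim[OF cx _ d] in auto)
  finally show ?thesis .
qed

text \<open>The common size of the facets is carried along, because it is the exponent
  \<open>n\<close> in the h-polynomial and drops by \<open>card F\<close> in the link of
  \<open>F\<close>.\<close>

definition pure_of_card :: "'a set set \<Rightarrow> nat \<Rightarrow> bool" where
  "pure_of_card \<Delta> n \<longleftrightarrow> abstract_complex \<Delta> \<and> (\<forall>F\<in>\<Delta>. \<exists>G\<in>\<Delta>. F \<subseteq> G \<and> card G = n) \<and> (\<forall>F\<in>\<Delta>. card F \<le> n)"

lemma pure_of_cardI:
  assumes cx: "abstract_complex \<Delta>" and pure: "pure_complex \<Delta>"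
  obtains n where "pure_of_card \<Delta> n"
proof -
  have facet: "\<exists>G\<in>facets \<Delta>. F \<subseteq> G" if F: "F \<in> \<Delta>" for F
  proof -
    obtain G where G: "G \<in> \<Delta>" "F \<subseteq> G" "\<forall>H\<in>\<Delta>. G \<subseteq> H \<longrightarrow> G = H"
      using finite_has_maximal2[OF abstract_complexD(2)[OF cx] F] by blast
    then show ?thesis by (auto simp: facets_def)
  qed
  obtain G0 where G0: "G0 \<in> facets \<Delta>" using facet[OF abstract_complexD(3)[OF cx]] by blast
  have card: "card G = card G0" if "G \<in> facets \<Delta>" for G
    using pure G0 that unfolding pure_complex_def face_dim_def by fastforce
  have "pure_of_card \<Delta> (card G0)"
    unfolding pure_of_card_def
  proof (intro conjI ballI cx)
    fix F assume F: "F \<in> \<Delta>"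
    obtain G where G: "G \<in> facets \<Delta>" "F \<subseteq> G" using facet[OF F] by blast
    then have GD: "G \<in> \<Delta>" by (simp add: facets_def)
    then show "\<exists>G\<in>\<Delta>. F \<subseteq> G \<and> card G = card G0" using G card by blast
    show "card F \<le> card G0"
      using card_mono[OF abstract_complexD(5)[OF cx GD] G(2)] card[OF G(1)] by simp
  qed
  then show thesis by (rule that)
qed

lemma pure_of_card_link:
  assumes p: "pure_of_card \<Delta> n" and F: "F \<in> \<Delta>"
  shows "pure_of_card (link \<Delta> F) (n - card F)"
proof -
  have cx: "abstract_complex \<Delta>" using p by (simp add: pure_of_card_def)
  show ?thesis
    unfolding pure_of_card_def
  proof (intro conjI ballI abstract_complex_link[OF cx F])
    fix G assume "G \<in> link \<Delta> F"
    then have G: "G \<inter> F = {}" "F \<union> G \<in> \<Delta>" by (auto simp: link_altdef)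
    note fin = abstract_complexD(5)[OF cx G(2)]
    have "card (F \<union> G) = card F + card G" using fin G(1) by (intro card_Un_disjoint) auto
    then show "card G \<le> n - card F" using p G(2) unfolding pure_of_card_def by fastforce
    obtain H where H: "H \<in> \<Delta>" "F \<union> G \<subseteq> H" "card H = n" using p G(2) unfolding pure_of_card_def by blast
    have "H - F \<in> link \<Delta> F" using H by (auto simp: link_def)
    moreover have "card (H - F) = n - card F"
      using H abstract_complexD(5)[OF cx F] by (simp add: card_Diff_subset)
    ultimately show "\<exists>H\<in>link \<Delta> F. G \<subseteq> H \<and> card H = n - card F"
      using H(2) G(1) by (intro bexI[of _ "H - F"]) auto
  qed
qed

section \<open>Flags and the recursion for subdivided links\<close>

lemma maximal_flag:
  assumes "finite G"
  shows "\<exists>c. c \<subseteq> Pow G - {{}} \<and> (\<forall>x\<in>c. \<forall>y\<in>c. comparable x y) \<and> card c = card G"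
  using assms
proof (induction G rule: finite_induct)
  case empty
  show ?case by (intro exI[of _ "{}"]) simp
next
  case (insert x G)
  then obtain c where c: "c \<subseteq> Pow G - {{}}" "\<forall>x\<in>c. \<forall>y\<in>c. comparable x y" "card c = card G" by blast
  have fin: "finite c" using c(1) insert.hyps(1) finite_subset by blast
  have "insert x G \<notin> c" using c(1) insert.hyps(2) by auto
  then have "card (insert (insert x G) c) = card (insert x G)" using fin c(3) insert.hyps by simp
  moreover have "insert (insert x G) c \<subseteq> Pow (insert x G) - {{}}" using c(1) by auto
  moreover have "\<forall>y\<in>insert (insert x G) c. \<forall>z\<in>insert (insert x G) c. comparable y z"
    using c(1,2) by auto
  ultimately show ?case by blast
qed

lemma order_complexD:
  assumes "c \<in> order_complex P"
  shows "c \<subseteq> P" "\<And>x y. x \<in> c \<Longrightarrow> y \<in> c \<Longrightarrow> comparable x y"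
  using assms by (auto simp: order_complex_def clique_complex_def)

text \<open>The members of a flag have distinct cardinalities between 1 and
  \<open>n\<close>.\<close>

lemma card_flag_le:
  assumes p: "pure_of_card \<Delta> n" and c: "c \<in> order_complex (\<Delta> - {{}})"
  shows "card c \<le> n"
proof -
  have cx: "abstract_complex \<Delta>" using p by (simp add: pure_of_card_def)
  have fin: "finite F" if "F \<in> c" for F
    using abstract_complexD(5)[OF cx] order_complexD(1)[OF c] that by blast
  have "inj_on card c"
  proof (rule inj_onI)
    fix F G assume FG: "F \<in> c" "G \<in> c" "card F = card G"
    then show "F = G"
      using order_complexD(2)[OF c FG(1,2)] card_subset_eq[OF fin[OF FG(2)], of F]
        card_subset_eq[OF fin[OF FG(1)], of G] by auto
  qed
  moreover have "card ` c \<subseteq> {1..n}"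
  proof
    fix k assume "k \<in> card ` c"
    then obtain F where F: "F \<in> c" "k = card F" by blast
    then have "F \<in> \<Delta>" "F \<noteq> {}" using order_complexD(1)[OF c] by auto
    then show "k \<in> {1..n}"
      using F p fin[OF F(1)] by (auto simp: pure_of_card_def Suc_le_eq card_gt_0_iff)
  qed
  ultimately have "card c \<le> card {1..n}" by (intro card_inj_on_le) auto
  then show ?thesis by simp
qed

lemma h_poly_sd:
  assumes p: "pure_of_card \<Delta> n"
  shows "h_poly (barycentric_subdivision \<Delta>)
    = (\<Sum>c\<in>order_complex (\<Delta> - {{}}). px ^ card c * py ^ (n - card c))"
proof -
  have cx: "abstract_complex \<Delta>" using p by (simp add: pure_of_card_def)
  have cxs: "abstract_complex (order_complex (\<Delta> - {{}}))"
    using abstract_complexD(2)[OF cx] by (intro abstract_complex_order) simp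
  obtain G where G: "G \<in> \<Delta>" "card G = n"
    using p abstract_complexD(3)[OF cx] unfolding pure_of_card_def by blast
  obtain c where c: "c \<subseteq> Pow G - {{}}" "\<forall>x\<in>c. \<forall>y\<in>c. comparable x y" "card c = card G"
    using maximal_flag[OF abstract_complexD(5)[OF cx G(1)]] by blast
  have "c \<subseteq> \<Delta> - {{}}" using c(1) abstract_complexD(4)[OF cx G(1)] by auto
  then have "c \<in> order_complex (\<Delta> - {{}})"
    using c(2) by (simp add: order_complex_def clique_complex_def)
  moreover have "face_dim d \<le> int n - 1" if "d \<in> order_complex (\<Delta> - {{}})" for d
    using card_flag_le[OF p that] by (simp add: face_dim_def)
  ultimately have "complex_dim (order_complex (\<Delta> - {{}})) = int n - 1"
    using c(3) G(2) by (intro complex_dim_eqI[OF cxs, of _ c]) (auto simp: face_dim_def)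
  then show ?thesis unfolding barycentric_subdivision_order by (rule h_poly_sum[OF cxs])
qed

lemma finite_chain_Inter:
  assumes "finite c" "c \<noteq> {}" "\<And>x y. x \<in> c \<Longrightarrow> y \<in> c \<Longrightarrow> comparable x y"
  shows "\<Inter>c \<in> c"
proof -
  obtain m where m: "m \<in> c" "\<forall>b\<in>c. b \<subseteq> m \<longrightarrow> m = b" using finite_has_minimal[OF assms(1,2)] by blast
  have "m \<subseteq> b" if "b \<in> c" for b using assms(3)[OF m(1) that] m(2) that by blast
  then have "\<Inter>c = m" using m(1) by blast
  then show ?thesis using m(1) by simp
qed

text \<open>Removing \<open>E\<close> from the larger members identifies the flags with least member
  \<open>E\<close> with the flags of its link. The additional member \<open>E\<close> is the source
  of the factor \<open>px\<close> in the recursion.\<close>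

lemma flags_with_least:
  assumes cx: "abstract_complex \<Delta>" and E: "E \<in> \<Delta> - {{}}"
  defines "h \<equiv> \<lambda>d. insert E ((\<union>) E ` d)"
  shows "{c \<in> order_complex (\<Delta> - {{}}) - {{}}. \<Inter>c = E} = h ` order_complex (link \<Delta> E - {{}})"
    and "inj_on h (order_complex (link \<Delta> E - {{}}))"
    and "\<And>d. d \<in> order_complex (link \<Delta> E - {{}}) \<Longrightarrow> card (h d) = Suc (card d)"
proof -
  let ?L = "order_complex (link \<Delta> E - {{}})"
  have lk: "G \<inter> E = {}" "E \<union> G \<in> \<Delta>" "G \<noteq> {}" if "d \<in> ?L" "G \<in> d" for d G
    using order_complexD(1)[OF that(1)] that(2) by (auto simp: link_altdef)
  have notE: "E \<notin> (\<union>) E ` d" if d: "d \<in> ?L" for d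
  proof
    assume "E \<in> (\<union>) E ` d"
    then obtain G where G: "G \<in> d" "E = E \<union> G" by blast
    then show False using lk(1,3)[OF d G(1)] by blast
  qed
  have inv: "(\<lambda>G. G - E) ` (h d - {E}) = d" if d: "d \<in> ?L" for d
  proof -
    have "E \<union> G - E = G" if "G \<in> d" for G using lk(1)[OF d that] by blast
    note cancel = this
    have "h d - {E} = (\<union>) E ` d" using notE[OF d] by (auto simp: h_def)
    moreover have "(\<lambda>G. G - E) ` (\<union>) E ` d = (\<lambda>G. G) ` d"
      unfolding image_image by (rule image_cong[OF refl cancel])
    ultimately show ?thesis by simp
  qed
  then show "inj_on h ?L" by (rule inj_on_inverseI)
  show "card (h d) = Suc (card d)" if d: "d \<in> ?L" for d
  proof -
    have fin: "finite d"
      using abstract_complexD(5)[OF abstract_complex_order, of "link \<Delta> E - {{}}" d] d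
        abstract_complexD(2)[OF abstract_complex_link[OF cx, of E]] E by simp
    have "inj_on ((\<union>) E) d"
    proof (rule inj_onI)
      fix G H assume GH: "G \<in> d" "H \<in> d" "E \<union> G = E \<union> H"
      then show "G = H" using lk(1)[OF d GH(1)] lk(1)[OF d GH(2)] by blast
    qed
    then show ?thesis using fin notE[OF d] by (simp add: h_def card_image)
  qed
  show "{c \<in> order_complex (\<Delta> - {{}}) - {{}}. \<Inter>c = E} = h ` ?L"
  proof (intro equalityI subsetI)
    fix c assume c: "c \<in> {c \<in> order_complex (\<Delta> - {{}}) - {{}}. \<Inter>c = E}"
    then have co: "c \<in> order_complex (\<Delta> - {{}})" and ne: "c \<noteq> {}" and I: "\<Inter>c = E" by auto
    have fin: "finite c"
      using abstract_complexD(5)[OF abstract_complex_order co] abstract_complexD(2)[OF cx] by simp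
    have Ec: "E \<in> c" using finite_chain_Inter[OF fin ne order_complexD(2)[OF co]] I by simp
    have sub: "E \<subseteq> G" if "G \<in> c" for G using I that by blast
    define d where "d = (\<lambda>G. G - E) ` (c - {E})"
    have "d \<subseteq> link \<Delta> E - {{}}"
    proof
      fix H assume "H \<in> d"
      then obtain G where G: "G \<in> c" "G \<noteq> E" "H = G - E" by (auto simp: d_def)
      then have "G \<in> \<Delta>" "E \<subseteq> G" using order_complexD(1)[OF co] sub by auto
      then show "H \<in> link \<Delta> E - {{}}" using G(2,3) by (auto simp: link_def)
    qed
    moreover have "comparable x y" if "x \<in> d" "y \<in> d" for x y
    proof -
      obtain G H where "G \<in> c" "H \<in> c" "x = G - E" "y = H - E" using \<open>x \<in> d\<close> \<open>y \<in> d\<close> by (auto simp: d_def)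
      then show ?thesis using order_complexD(2)[OF co, of G H] by blast
    qed
    ultimately have dL: "d \<in> ?L" by (auto simp: order_complex_def clique_complex_def)
    have "(\<union>) E ` d = (\<lambda>G. G) ` (c - {E})"
    proof -
      have "E \<union> (G - E) = G" if "G \<in> c - {E}" for G using sub[of G] that by blast
      then show ?thesis unfolding d_def image_image by (rule image_cong[OF refl])
    qed
    then have "h d = c" using Ec by (auto simp: h_def)
    then show "c \<in> h ` ?L" using dL by blast
  next
    fix c assume "c \<in> h ` ?L"
    then obtain d where d: "d \<in> ?L" "c = h d" by blast
    have "c \<subseteq> \<Delta> - {{}}"
    proof
      fix x assume "x \<in> c"
      then consider "x = E" | G where "G \<in> d" "x = E \<union> G" by (auto simp: d(2) h_def)
      then show "x \<in> \<Delta> - {{}}"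
      proof cases
        case 1 then show ?thesis using E by simp
      next
        case 2 then show ?thesis using lk(2)[OF d(1) 2(1)] E by blast
      qed
    qed
    moreover have "comparable x y" if xy: "x \<in> c" "y \<in> c" for x y
    proof -
      have ex: "\<exists>G\<in>insert {} d. z = E \<union> G" if "z \<in> c" for z using that by (auto simp: d(2) h_def)
      obtain G H where GH: "G \<in> insert {} d" "H \<in> insert {} d" "x = E \<union> G" "y = E \<union> H"
        using ex[OF xy(1)] ex[OF xy(2)] by blast
      have "comparable G H" using GH(1,2) order_complexD(2)[OF d(1), of G H] by auto
      then show ?thesis unfolding GH(3,4) by blast
    qed
    ultimately have "c \<in> order_complex (\<Delta> - {{}})" by (auto simp: order_complex_def clique_complex_def)
    moreover have "\<Inter>c = E" by (auto simp: d(2) h_def)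
    moreover have "c \<noteq> {}" by (simp add: d(2) h_def)
    ultimately show "c \<in> {c \<in> order_complex (\<Delta> - {{}}) - {{}}. \<Inter>c = E}" by simp
  qed
qed

lemma h_poly_sd_recursion:
  fixes \<Delta> :: "'a set set"
  assumes p: "pure_of_card \<Delta> n"
  shows "h_poly (barycentric_subdivision \<Delta>) = py ^ n +
    px * (\<Sum>E\<in>\<Delta> - {{}}. py ^ (card E - 1) * h_poly (barycentric_subdivision (link \<Delta> E)))"
proof -
  have cx: "abstract_complex \<Delta>" using p by (simp add: pure_of_card_def)
  note finD = abstract_complexD(2)[OF cx]
  let ?C = "order_complex (\<Delta> - {{}})" and ?g = "\<lambda>c :: 'a set set. px ^ card c * py ^ (n - card c)"
  have cxs: "abstract_complex ?C" using finD by (intro abstract_complex_order) simp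
  note finC = abstract_complexD(2)[OF cxs]
  have fibre: "sum ?g {c \<in> ?C - {{}}. \<Inter>c = E}
      = px * (py ^ (card E - 1) * h_poly (barycentric_subdivision (link \<Delta> E)))"
    if E: "E \<in> \<Delta> - {{}}" for E
  proof -
    let ?h = "\<lambda>d. insert E ((\<union>) E ` d)" and ?L = "order_complex (link \<Delta> E - {{}})"
    have ED: "E \<in> \<Delta>" using E by blast
    note pl = pure_of_card_link[OF p ED]
    have cE: "1 \<le> card E" "card E \<le> n"
      using E p abstract_complexD(5)[OF cx ED] by (auto simp: pure_of_card_def Suc_le_eq card_gt_0_iff)
    have "sum ?g {c \<in> ?C - {{}}. \<Inter>c = E} = (\<Sum>d\<in>?L. ?g (?h d))"
      unfolding flags_with_least(1)[OF cx E] by (rule sum.reindex_cong[OF flags_with_least(2)[OF cx E]]) auto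
    also have "\<dots> = (\<Sum>d\<in>?L. px * (py ^ (card E - 1) * (px ^ card d * py ^ (n - card E - card d))))"
    proof (rule sum.cong[OF refl])
      fix d assume d: "d \<in> ?L"
      have "card d \<le> n - card E" by (rule card_flag_le[OF pl d])
      \<comment> \<open>\<open>E\<close> takes up one vertex of the flag, while the facets of its
        link are smaller by \<open>card E\<close>; the difference is the exponent
        \<open>card E - 1\<close>.\<close>
      then have "n - Suc (card d) = (card E - 1) + (n - card E - card d)" using cE by simp
      then show "?g (?h d) = px * (py ^ (card E - 1) * (px ^ card d * py ^ (n - card E - card d)))"
        unfolding flags_with_least(3)[OF cx E d] by (simp add: power_add mult.assoc mult.left_commute)
    qed
    also have "\<dots> = px * (py ^ (card E - 1) * h_poly (barycentric_subdivision (link \<Delta> E)))"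
      unfolding h_poly_sd[OF pl] sum_distrib_left ..
    finally show ?thesis .
  qed
  have img: "Inter ` (?C - {{}}) \<subseteq> \<Delta> - {{}}"
  proof
    fix E assume "E \<in> Inter ` (?C - {{}})"
    then obtain c where c: "c \<in> ?C" "c \<noteq> {}" "E = \<Inter>c" by auto
    then have "E \<in> c"
      using finite_chain_Inter[OF abstract_complexD(5)[OF cxs c(1)] c(2) order_complexD(2)[OF c(1)]] by simp
    then show "E \<in> \<Delta> - {{}}" using order_complexD(1)[OF c(1)] by blast
  qed
  \<comment> \<open>The empty flag has no least member; it contributes
    \<open>py ^ n\<close>.\<close>
  have "h_poly (barycentric_subdivision \<Delta>) = ?g {} + sum ?g (?C - {{}})"
    unfolding h_poly_sd[OF p] using sum.remove[OF finC abstract_complexD(3)[OF cxs], of ?g] .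
  also have "sum ?g (?C - {{}}) = (\<Sum>E\<in>\<Delta> - {{}}. sum ?g {c \<in> ?C - {{}}. \<Inter>c = E})"
    by (rule sum.group[symmetric]) (use finC finD img in auto)
  also have "\<dots> = (\<Sum>E\<in>\<Delta> - {{}}. px * (py ^ (card E - 1) * h_poly (barycentric_subdivision (link \<Delta> E))))"
    by (rule sum.cong[OF refl fibre])
  finally show ?thesis by (simp add: sum_distrib_left)
qed

text \<open>The link of \<open>E\<close> in the link of \<open>G\<close> is the link of
  \<open>G \<union> E\<close>, so the recursion inside a link can be indexed by the faces of
  \<open>\<Delta>\<close> above \<open>G\<close>.\<close>

lemma h_poly_sd_link_recursion:
  assumes p: "pure_of_card \<Delta> n" and G: "G \<in> \<Delta>"
  shows "h_poly (barycentric_subdivision (link \<Delta> G)) = py ^ (n - card G) +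
    px * (\<Sum>F\<in>{F \<in> \<Delta>. G \<subset> F}. py ^ (card F - card G - 1) * h_poly (barycentric_subdivision (link \<Delta> F)))"
proof -
  have cx: "abstract_complex \<Delta>" using p by (simp add: pure_of_card_def)
  have "(\<Sum>E\<in>link \<Delta> G - {{}}. py ^ (card E - 1) * h_poly (barycentric_subdivision (link (link \<Delta> G) E)))
    = (\<Sum>F\<in>{F \<in> \<Delta>. G \<subset> F}. py ^ (card F - card G - 1) * h_poly (barycentric_subdivision (link \<Delta> F)))"
  proof (rule sum.reindex_bij_witness[of _ "\<lambda>F. F - G" "\<lambda>E. G \<union> E"])
    fix E assume "E \<in> link \<Delta> G - {{}}"
    then have E: "E \<inter> G = {}" "G \<union> E \<in> \<Delta>" "E \<noteq> {}" by (auto simp: link_altdef)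
    show "G \<union> E - G = E" using E(1) by blast
    show "G \<union> E \<in> {F \<in> \<Delta>. G \<subset> F}" using E by blast
    have "link (link \<Delta> G) E = link \<Delta> (G \<union> E)"
      using E(1) unfolding link_altdef by (auto simp: Un_assoc Un_left_commute Un_commute)
    moreover have "card (G \<union> E) = card G + card E"
      using abstract_complexD(5)[OF cx E(2)] E(1) by (intro card_Un_disjoint) auto
    ultimately show "py ^ (card (G \<union> E) - card G - 1) * h_poly (barycentric_subdivision (link \<Delta> (G \<union> E)))
        = py ^ (card E - 1) * h_poly (barycentric_subdivision (link (link \<Delta> G) E))" by simp
  next
    fix F assume F: "F \<in> {F \<in> \<Delta>. G \<subset> F}"
    then show "G \<union> (F - G) = F" by blast
    then show "F - G \<in> link \<Delta> G - {{}}" using F by (auto simp: link_altdef)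
  qed
  then show ?thesis using h_poly_sd_recursion[OF pure_of_card_link[OF p G]] by simp
qed

section \<open>Theta polynomials and the final summation\<close>

context triangulated begin

definition interior_sum :: "'a set \<Rightarrow> int poly" where
  "interior_sum G = (\<Sum>\<tau>\<in>{\<tau> \<in> \<Delta>'. car \<tau> = G}. px ^ card \<tau> * py ^ (card G - card \<tau>))"

lemma sum_by_carrier:
  assumes S: "S \<subseteq> \<Delta>" and n: "\<And>G. G \<in> S \<Longrightarrow> card G \<le> n"
  shows "(\<Sum>\<tau>\<in>{\<tau> \<in> \<Delta>'. car \<tau> \<in> S}. px ^ card \<tau> * py ^ (n - card \<tau>))
    = (\<Sum>G\<in>S. py ^ (n - card G) * interior_sum G)"
proof -
  let ?g = "\<lambda>\<tau>. px ^ card \<tau> * py ^ (n - card \<tau>)" and ?A = "{\<tau> \<in> \<Delta>'. car \<tau> \<in> S}"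
  have fin: "finite ?A" "finite S"
    using abstract_complexD(2)[OF cx'] abstract_complexD(2)[OF cx] S finite_subset by auto
  have "sum ?g ?A = (\<Sum>G\<in>S. sum ?g {\<tau> \<in> ?A. car \<tau> = G})"
    by (rule sum.group[symmetric, OF fin]) auto
  also have "\<dots> = (\<Sum>G\<in>S. py ^ (n - card G) * interior_sum G)"
  proof (rule sum.cong[OF refl])
    fix G assume G: "G \<in> S"
    have "{\<tau> \<in> ?A. car \<tau> = G} = {\<tau> \<in> \<Delta>'. car \<tau> = G}" using G by auto
    then have "sum ?g {\<tau> \<in> ?A. car \<tau> = G} = (\<Sum>\<tau>\<in>{\<tau> \<in> \<Delta>'. car \<tau> = G}. ?g \<tau>)" by simp
    also have "\<dots> = py ^ (n - card G) * interior_sum G"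
      unfolding interior_sum_def sum_distrib_left
    proof (rule sum.cong[OF refl])
      fix \<tau> assume "\<tau> \<in> {\<tau> \<in> \<Delta>'. car \<tau> = G}"
      then have "card \<tau> \<le> card G" using card_le_carrier by auto
      then have "n - card \<tau> = (n - card G) + (card G - card \<tau>)" using n[OF G] by simp
      then show "?g \<tau> = py ^ (n - card G) * (px ^ card \<tau> * py ^ (card G - card \<tau>))"
        by (simp add: power_add mult.left_commute)
    qed
    finally show "sum ?g {\<tau> \<in> ?A. car \<tau> = G} = py ^ (n - card G) * interior_sum G" .
  qed
  finally show ?thesis .
qed

text \<open>The restriction has one dimension more than its boundary, so the faces with proper
  carrier \<open>G\<close> are weighted by consecutive powers of \<open>py\<close> in the two
  h-polynomials. As \<open>py = 1 - px\<close>, the difference is \<open>- px\<close> times the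
  lower power.\<close>

lemma theta_restr:
  assumes F: "F \<in> \<Delta>"
  shows "theta_poly TYPE('k::field) (restr F) = interior_sum F
    - px * (\<Sum>G\<in>{G \<in> \<Delta>. G \<subset> F}. py ^ (card F - card G - 1) * interior_sum G)"
proof (cases "F = {}")
  case True
  \<comment> \<open>Only the empty face has empty carrier, so the restriction is \<open>{{}}\<close>
    and its theta polynomial is 1 by convention.\<close>
  have single: "\<tau> = {}" if "\<tau> \<in> \<Delta>'" "car \<tau> = {}" for \<tau>
    using card_le_carrier[OF that(1)] that(2) abstract_complexD(5)[OF cx' that(1)] by simp
  have "{} \<in> restr F" by (rule abstract_complexD(3)[OF abstract_complex_restr[OF F]])
  then have "{\<tau> \<in> \<Delta>'. car \<tau> = {}} = {{}}" "restr F = {{}}"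
    using single True by (auto simp: restriction_def)
  then show ?thesis using True by (simp add: theta_poly_def interior_sum_def)
next
  case False
  note cF = abstract_complexD(5)[OF cx F]
  have pos: "1 \<le> card F" using False cF by (simp add: Suc_le_eq card_gt_0_iff)
  let ?P = "{G \<in> \<Delta>. G \<subset> F}"
  have finP: "finite ?P" using abstract_complexD(2)[OF cx] by simp
  have less: "card G < card F" if "G \<in> ?P" for G using that psubset_card_mono[OF cF] by blast
  have dim0: "complex_dim {{} :: 'b set} = - 1"
    by (rule complex_dim_eqI[of _ _ "{}"]) (auto simp: abstract_complex_def face_dim_def)
  \<comment> \<open>This rules out the convention for \<open>{{}}\<close>, so
    \<open>theta_poly\<close> is a difference of two h-polynomials.\<close>
  have ne: "restr F \<noteq> {{}}"
  proof
    assume "restr F = {{}}"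
    then have "int (card F) - 1 = - 1" using complex_dim_restr[OF F] dim0 by metis
    then show False using pos by simp
  qed
  have F_notin: "F \<notin> ?P" by blast
  have "{\<tau> \<in> \<Delta>'. car \<tau> \<subseteq> F} = {\<tau> \<in> \<Delta>'. car \<tau> \<in> insert F ?P}"
    using carrier_in by blast
  then have r: "restr F = {\<tau> \<in> \<Delta>'. car \<tau> \<in> insert F ?P}" by (simp only: restriction_def)
  have "h_poly (restr F) = (\<Sum>\<tau>\<in>restr F. px ^ card \<tau> * py ^ (card F - card \<tau>))"
    by (rule h_poly_sum[OF abstract_complex_restr[OF F] complex_dim_restr[OF F]])
  also have "\<dots> = (\<Sum>G\<in>insert F ?P. py ^ (card F - card G) * interior_sum G)"
    unfolding r by (rule sum_by_carrier) (use F less in \<open>auto intro: less_imp_le\<close>)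
  also have "\<dots> = interior_sum F + (\<Sum>G\<in>?P. py ^ (card F - card G) * interior_sum G)"
    using finP F_notin by simp
  finally have h1: "h_poly (restr F) = interior_sum F + (\<Sum>G\<in>?P. py ^ (card F - card G) * interior_sum G)" .
  have b: "{\<tau> \<in> \<Delta>'. car \<tau> \<subset> F} = {\<tau> \<in> \<Delta>'. car \<tau> \<in> ?P}" using carrier_in by blast
  have "complex_dim {\<tau> \<in> \<Delta>'. car \<tau> \<subset> F} = int (card F - 1) - 1"
    using restr_ball(2)[OF F False] pos by (simp add: of_nat_diff)
  then have "h_poly {\<tau> \<in> \<Delta>'. car \<tau> \<subset> F}
      = (\<Sum>\<tau>\<in>{\<tau> \<in> \<Delta>'. car \<tau> \<subset> F}. px ^ card \<tau> * py ^ (card F - 1 - card \<tau>))"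
    by (rule h_poly_sum[OF restr_ball(3)[OF F False]])
  also have "\<dots> = (\<Sum>G\<in>?P. py ^ (card F - 1 - card G) * interior_sum G)"
    unfolding b by (rule sum_by_carrier) (use less in fastforce)+
  finally have h2: "h_poly {\<tau> \<in> \<Delta>'. car \<tau> \<subset> F} = (\<Sum>G\<in>?P. py ^ (card F - 1 - card G) * interior_sum G)" .
  have "theta_poly TYPE('k) (restr F) = interior_sum F
      + (\<Sum>G\<in>?P. py ^ (card F - card G) * interior_sum G - py ^ (card F - 1 - card G) * interior_sum G)"
    using ne by (simp add: theta_poly_def restr_ball(1)[OF F False] h1 h2 sum_subtractf)
  also have "(\<Sum>G\<in>?P. py ^ (card F - card G) * interior_sum G - py ^ (card F - 1 - card G) * interior_sum G)
      = (\<Sum>G\<in>?P. - (px * (py ^ (card F - card G - 1) * interior_sum G)))"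
  proof (rule sum.cong[OF refl])
    fix G assume G: "G \<in> ?P"
    define k where "k = card F - card G - 1"
    have k: "card F - card G = Suc k" "card F - 1 - card G = k" using less[OF G] by (auto simp: k_def)
    have "py ^ Suc k = py ^ k - px * py ^ k" unfolding power_Suc by (subst py_eq) (simp add: left_diff_distrib)
    then show "py ^ (card F - card G) * interior_sum G - py ^ (card F - 1 - card G) * interior_sum G
        = - (px * (py ^ (card F - card G - 1) * interior_sum G))"
      unfolding k k_def[symmetric] by (simp only: left_diff_distrib) (simp add: mult.assoc)
  qed
  finally show ?thesis by (simp only: sum_negf sum_distrib_left diff_conv_add_uminus)
qed

text \<open>The restriction to a single facet already has dimension \<open>n - 1\<close>, and the
  size of its carrier bounds every other face.\<close>

lemma complex_dim_triangulation:
  assumes p: "pure_of_card \<Delta> n"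
  shows "complex_dim \<Delta>' = int n - 1"
proof -
  obtain F where F: "F \<in> \<Delta>" "card F = n"
    using p abstract_complexD(3)[OF cx] unfolding pure_of_card_def by blast
  have "Max (face_dim ` restr F) \<in> face_dim ` restr F"
    using abstract_complexD(2,3)[OF abstract_complex_restr[OF F(1)]] by (intro Max_in) auto
  then obtain \<tau> where \<tau>: "\<tau> \<in> restr F" "face_dim \<tau> = int n - 1"
    using complex_dim_restr[OF F(1)] F(2) unfolding complex_dim_def by auto
  have "face_dim \<rho> \<le> int n - 1" if \<rho>: "\<rho> \<in> \<Delta>'" for \<rho>
  proof -
    have "card (car \<rho>) \<le> n" using p carrier_in[OF \<rho>] unfolding pure_of_card_def by blast
    then show ?thesis using card_le_carrier[OF \<rho>] by (simp add: face_dim_def)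
  qed
  then show ?thesis
    using \<tau> by (intro complex_dim_eqI[OF cx', of _ \<tau>]) (auto simp: restriction_def)
qed

text \<open>\<open>h_poly_sd_link_recursion\<close> is solved for \<open>py ^ (n - card G)\<close>
  and inserted into the sum by carriers. The correction terms run over pairs
  \<open>G \<subset> F\<close>; collected by the larger face instead of the smaller one, they are
  the boundary terms of \<open>theta_restr\<close>.\<close>

lemma h_poly_triangulation:
  assumes p: "pure_of_card \<Delta> n"
  shows "h_poly \<Delta>' = (\<Sum>F\<in>\<Delta>. theta_poly TYPE('k::field) (restr F)
    * h_poly (barycentric_subdivision (link \<Delta> F)))"
proof -
  let ?H = "\<lambda>F. h_poly (barycentric_subdivision (link \<Delta> F))"
  let ?w = "\<lambda>G F. px * (py ^ (card F - card G - 1) * interior_sum G * ?H F)"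
  note finD = abstract_complexD(2)[OF cx]
  have "h_poly \<Delta>' = (\<Sum>\<tau>\<in>\<Delta>'. px ^ card \<tau> * py ^ (n - card \<tau>))"
    by (rule h_poly_sum[OF cx' complex_dim_triangulation[OF p]])
  also have "\<dots> = (\<Sum>\<tau>\<in>{\<tau> \<in> \<Delta>'. car \<tau> \<in> \<Delta>}. px ^ card \<tau> * py ^ (n - card \<tau>))"
    using carrier_in by (intro sum.cong) auto
  also have "\<dots> = (\<Sum>G\<in>\<Delta>. py ^ (n - card G) * interior_sum G)"
    by (rule sum_by_carrier) (use p in \<open>auto simp: pure_of_card_def\<close>)
  also have "\<dots> = (\<Sum>G\<in>\<Delta>. interior_sum G * ?H G - (\<Sum>F\<in>{F \<in> \<Delta>. G \<subset> F}. ?w G F))"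
  proof (rule sum.cong[OF refl])
    fix G assume G: "G \<in> \<Delta>"
    have "(\<Sum>F\<in>{F \<in> \<Delta>. G \<subset> F}. ?w G F)
        = interior_sum G * (px * (\<Sum>F\<in>{F \<in> \<Delta>. G \<subset> F}. py ^ (card F - card G - 1) * ?H F))"
      unfolding sum_distrib_left by (intro sum.cong refl) (simp only: mult_ac)
    then show "py ^ (n - card G) * interior_sum G
        = interior_sum G * ?H G - (\<Sum>F\<in>{F \<in> \<Delta>. G \<subset> F}. ?w G F)"
      unfolding h_poly_sd_link_recursion[OF p G] by (simp only: distrib_left mult_ac add_diff_cancel_right')
  qed
  also have "\<dots> = (\<Sum>G\<in>\<Delta>. interior_sum G * ?H G) - (\<Sum>G\<in>\<Delta>. \<Sum>F\<in>{F \<in> \<Delta>. G \<subset> F}. ?w G F)"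
    by (rule sum_subtractf)
  also have "(\<Sum>G\<in>\<Delta>. \<Sum>F\<in>{F \<in> \<Delta>. G \<subset> F}. ?w G F) = (\<Sum>F\<in>\<Delta>. \<Sum>G\<in>{G \<in> \<Delta>. G \<subset> F}. ?w G F)"
    by (rule sum.swap_restrict[OF finD finD])
  also have "(\<Sum>G\<in>\<Delta>. interior_sum G * ?H G) - \<dots>
      = (\<Sum>F\<in>\<Delta>. interior_sum F * ?H F - (\<Sum>G\<in>{G \<in> \<Delta>. G \<subset> F}. ?w G F))"
    by (rule sum_subtractf[symmetric])
  also have "\<dots> = (\<Sum>F\<in>\<Delta>. theta_poly TYPE('k) (restr F) * ?H F)"
  proof (rule sum.cong[OF refl])
    fix F assume F: "F \<in> \<Delta>"
    have "(\<Sum>G\<in>{G \<in> \<Delta>. G \<subset> F}. ?w G F)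
        = px * (\<Sum>G\<in>{G \<in> \<Delta>. G \<subset> F}. py ^ (card F - card G - 1) * interior_sum G) * ?H F"
      unfolding sum_distrib_left sum_distrib_right by (intro sum.cong refl) (simp only: mult_ac)
    then show "interior_sum F * ?H F - (\<Sum>G\<in>{G \<in> \<Delta>. G \<subset> F}. ?w G F)
        = theta_poly TYPE('k) (restr F) * ?H F"
      unfolding theta_restr[OF F] by (simp only: left_diff_distrib)
  qed
  finally show ?thesis .
qed

end

theorem theorem3p4:
  fixes \<Delta> :: "'a set set" and \<phi> :: "'a \<Rightarrow> 'e::euclidean_space"
    and \<Delta>' :: "'b set set" and \<psi> :: "'b \<Rightarrow> 'e"
  assumes "abstract_complex \<Delta>" and "pure_complex \<Delta>"
    and "abstract_complex \<Delta>'"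
    and "triangulates \<Delta> \<phi> \<Delta>' \<psi>"
  shows "h_poly \<Delta>' =
    (\<Sum>F\<in>\<Delta>. theta_poly TYPE('k::field) (restriction \<Delta> \<phi> \<Delta>' \<psi> F)
              * h_poly (barycentric_subdivision (link \<Delta> F)))"
proof -
  interpret triangulated \<Delta> \<phi> \<Delta>' \<psi> using assms(1,3,4) by unfold_locales
  obtain n where "pure_of_card \<Delta> n" by (rule pure_of_cardI[OF assms(1,2)])
  then show ?thesis by (rule h_poly_triangulation)
qed

end
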